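(* Let $\Omega\subset\mathbb{R}^d$ be compact, $\tilde\Omega=\Omega\times[0,1]$, $C>0$, $\sigma\in(0,1)$, and let $\Lambda^\star:\mathrm{Lip}_C^\sigma(\tilde\Omega)\times\tilde\Omega\to\mathbb{R}^{d'}$ be continuous (weak$^*$ topology on $\mathrm{Lip}_C^\sigma(\tilde\Omega)$, Euclidean topology on $\tilde\Omega$) and causal identifiable. Then for every $\varepsilon>0$ there exist $L\in\mathbb{N}$, masked attention parameters $\theta_1,\dots,\theta_L$ and MLPs $F_{\xi_1},\dots,F_{\xi_L}$ such that $$\forall(\mu,x,t)\in\mathrm{Lip}_C^\sigma(\tilde\Omega)\times\tilde\Omega,\qquad\big|F_{\xi_L}\diamond\Gamma_{\theta_L}\diamond\cdots\diamond F_{\xi_1}\diamond\Gamma_{\theta_1}(\mu,x,t)-\Lambda^\star(\mu,x,t)\big|\le\varepsilon,$$ with $d_{\mathrm{in}}(\theta_\ell)\le d+3d'$, $d_{\mathrm{head}}(\theta_\ell)=k(\theta_\ell)=1$, $H(\theta_\ell)\le d'$ for all $\ell$.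
   Context: For a probability measure $\mu$ on $\mathbb{R}^m\times[0,1]$, $\bar\mu=P_\sharp\mu$ is its time marginal, $P(x,t)=t$. $\mathrm{Lip}_C^\sigma(\tilde\Omega)$ is the set of $\mu\in\mathcal{P}(\tilde\Omega)$ with $\bar\mu(\{0\})\ge\sigma$ admitting a disintegration $d\mu(x,s)=d\mu(x|s)\,d\bar\mu(s)$ such that $s\mapsto\mu(\cdot|s)\in\mathcal{P}(\Omega)$ satisfies $W_2(\mu(\cdot|s),\mu(\cdot|t))\le C|s-t|$ for all $s,t\in[0,1]$ ($W_2$ the 2-Wasserstein distance). Masked measure: for $t\in[0,1]$, $\mu_t=\frac{1_{[0,t]}}{\bar\mu([0,t])}\cdot\mu$ (at $t=0$ this is $\mu(\cdot|0)\otimes\delta_0$). A map $\Lambda$ on $\mathrm{Lip}_C^\sigma(\tilde\Omega)\times\tilde\Omega$ is causal if $\Lambda(\mu,x,t)=\Lambda(\mu_t,x,t)$ for all $(\mu,x,t)$, and identifiable if for all $\mu\in\mathrm{Lip}_C^\sigma(\tilde\Omega)$ and $t,t'\in[0,1]$, $\mu_t=\mu_{t'}$ implies $\Lambda(\mu_t,\cdot,t)=\Lambda(\mu_{t'},\cdot,t')$. Masked attention with parameters $\theta=(W^h,K^h,Q^h,V^h)_{h=1}^H$ ($K^h,Q^h\in\mathbb{R}^{k\times d_{\mathrm{in}}}$, $V^h\in\mathbb{R}^{d_{\mathrm{head}}\times d_{\mathrm{in}}}$, $W^h\in\mathbb{R}^{d_{\mathrm{in}}\times d_{\mathrm{head}}}$;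 sizes $d_{\mathrm{in}}(\theta),d_{\mathrm{head}}(\theta),k(\theta),H(\theta)$): for a compactly supported probability measure $\mu$ on $\mathbb{R}^{d_{\mathrm{in}}}\times[0,1]$ with $\bar\mu(\{0\})>0$ and $(x,t)\in\mathbb{R}^{d_{\mathrm{in}}}\times[0,1]$, $$\Gamma_\theta(\mu,x,t)=x+\sum_{h=1}^HW^h\int\frac{\exp(\frac1{\sqrt k}\langle Q^hx,K^hy\rangle)1_{[0,t]}(r)}{\int\exp(\frac1{\sqrt k}\langle Q^hx,K^hz\rangle)1_{[0,t]}(s)\,d\mu(z,s)}V^hy\,d\mu(y,r).$$ An MLP is a map $A_K\circ\rho\circ\cdots\circ\rho\circ A_1$ with affine $A_j$ and componentwise ReLU $\rho$ (affine maps allowed), regarded as a context-free map $F(\mu,x,t)=F(x)$. Masked composition: $(\Gamma_2\diamond\Gamma_1)(\mu,x,t)=\Gamma_2(\mu_1,\Gamma_1(\mu,x,t),t)$ with $\mu_1$ the push-forward of $\mu$ by $(x,t)\mapsto(\Gamma_1(\mu,x,t),t)$. Dimensions compatible: $d_{\mathrm{in}}(\theta_1)=d$, $F_{\xi_\ell}:\mathbb{R}^{d_{\mathrm{in}}(\theta_\ell)}\to\mathbb{R}^{d_{\mathrm{in}}(\theta_{\ell+1})}$, $F_{\xi_L}$ maps into $\mathbb{R}^{d'}$. *)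

theory Defs
  imports "HOL-Probability.Probability"
begin

type_synonym vec = "nat \<Rightarrow> real"
type_synonym mat = "nat \<Rightarrow> nat \<Rightarrow> real"
type_synonym pmeas = "(vec \<times> real) measure"

definition Rn :: "nat \<Rightarrow> vec set" where
  "Rn n = {v. \<forall>i\<ge>n. v i = 0}"

definition sqdist :: "nat \<Rightarrow> vec \<Rightarrow> vec \<Rightarrow> real" where
  "sqdist n x y = (\<Sum>i<n. (x i - y i)^2)"

definition edist :: "nat \<Rightarrow> vec \<Rightarrow> vec \<Rightarrow> real" where
  "edist n x y = sqrt (sqdist n x y)"

definition couplings :: "vec measure \<Rightarrow> vec measure \<Rightarrow> (vec \<times> vec) measure set" where
  "couplings \<alpha> \<beta> = {\<pi>. sets \<pi> = sets borel \<and> prob_space \<pi> \<and>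
      distr \<pi> borel fst = \<alpha> \<and> distr \<pi> borel snd = \<beta>}"

definition W2sq :: "nat \<Rightarrow> vec measure \<Rightarrow> vec measure \<Rightarrow> ennreal" where
  "W2sq n \<alpha> \<beta> = (INF \<pi>\<in>couplings \<alpha> \<beta>. \<integral>\<^sup>+ p. ennreal (sqdist n (fst p) (snd p)) \<partial>\<pi>)"

definition tmarg :: "pmeas \<Rightarrow> real measure" where
  "tmarg M = distr M borel snd"

definition LipCS :: "nat \<Rightarrow> vec set \<Rightarrow> real \<Rightarrow> real \<Rightarrow> pmeas set" where
  "LipCS d \<Omega> C \<sigma> = {M. prob_space M \<and> sets M = sets borel \<and>
      emeasure M (\<Omega> \<times> {0..1}) = 1 \<and>
      measure (tmarg M) {0} \<ge> \<sigma> \<and>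
      (\<exists>\<kappa> :: real \<Rightarrow> vec measure.
         (\<forall>s\<in>{0..1}. prob_space (\<kappa> s) \<and> sets (\<kappa> s) = sets borel \<and> emeasure (\<kappa> s) \<Omega> = 1) \<and>
         (\<forall>A\<in>sets borel. emeasure M A =
             (\<integral>\<^sup>+ s. emeasure (\<kappa> s) {x. (x, s) \<in> A} \<partial>(tmarg M))) \<and>
         (\<forall>s\<in>{0..1}. \<forall>t\<in>{0..1}. W2sq d (\<kappa> s) (\<kappa> t) \<le> ennreal ((C * \<bar>s - t\<bar>)^2)))}"

definition mask :: "pmeas \<Rightarrow> real \<Rightarrow> pmeas" where
  "mask M t = density M (\<lambda>p. ennreal (indicator {0..t} (snd p) / measure (tmarg M) {0..t}))"

definition weak_star :: "pmeas topology" where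
  "weak_star = topology_generated_by
     {{M. (\<integral>p. f p \<partial>M) \<in> U} | (f :: vec \<times> real \<Rightarrow> real) U. continuous_on UNIV f \<and> bounded (range f) \<and> open U}"

definition causal :: "nat \<Rightarrow> vec set \<Rightarrow> real \<Rightarrow> real \<Rightarrow> (pmeas \<Rightarrow> vec \<Rightarrow> real \<Rightarrow> vec) \<Rightarrow> bool" where
  "causal d \<Omega> C \<sigma> \<Lambda> \<longleftrightarrow>
     (\<forall>M\<in>LipCS d \<Omega> C \<sigma>. \<forall>x\<in>\<Omega>. \<forall>t\<in>{0..1}. \<Lambda> M x t = \<Lambda> (mask M t) x t)"

definition identifiable :: "nat \<Rightarrow> vec set \<Rightarrow> real \<Rightarrow> real \<Rightarrow> (pmeas \<Rightarrow> vec \<Rightarrow> real \<Rightarrow> vec) \<Rightarrow> bool" where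
  "identifiable d \<Omega> C \<sigma> \<Lambda> \<longleftrightarrow>
     (\<forall>M\<in>LipCS d \<Omega> C \<sigma>. \<forall>t\<in>{0..1}. \<forall>t'\<in>{0..1}.
        mask M t = mask M t' \<longrightarrow> (\<forall>x\<in>\<Omega>. \<Lambda> (mask M t) x t = \<Lambda> (mask M t') x t'))"

text \<open>Masked attention. Each head is (W, K, Q, V).\<close>
record attn_params =
  din :: nat
  dhead :: nat
  kdim :: nat
  heads :: "(mat \<times> mat \<times> mat \<times> mat) list"

definition score :: "attn_params \<Rightarrow> mat \<Rightarrow> mat \<Rightarrow> vec \<Rightarrow> vec \<Rightarrow> real" where
  "score \<theta> Q K x y =
     (\<Sum>a<kdim \<theta>. (\<Sum>b<din \<theta>. Q a b * x b) * (\<Sum>b<din \<theta>. K a b * y b)) / sqrt (real (kdim \<theta>))"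

definition attn :: "attn_params \<Rightarrow> pmeas \<Rightarrow> vec \<Rightarrow> real \<Rightarrow> vec" where
  "attn \<theta> M x t = (\<lambda>i. if i < din \<theta> then
      x i + (\<Sum>h<length (heads \<theta>). (case heads \<theta> ! h of (W, K, Q, V) \<Rightarrow>
        (\<Sum>j<dhead \<theta>. W i j *
           ((\<integral>p. exp (score \<theta> Q K x (fst p)) * indicator {0..t} (snd p) *
                  (\<Sum>l<din \<theta>. V j l * fst p l) \<partial>M)
            / (\<integral>p. exp (score \<theta> Q K x (fst p)) * indicator {0..t} (snd p) \<partial>M)))))
    else 0)"

text \<open>MLPs: list of widths n_0,...,n_K and affine layers (A_j, b_j).\<close>
type_synonym mlp = "nat list \<times> (mat \<times> vec) list"

definition affine_map :: "nat \<Rightarrow> nat \<Rightarrow> mat \<Rightarrow> vec \<Rightarrow> vec \<Rightarrow> vec" where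
  "affine_map n m A c x = (\<lambda>i. if i < m then (\<Sum>j<n. A i j * x j) + c i else 0)"

definition relu :: "vec \<Rightarrow> vec" where
  "relu v = (\<lambda>i. max 0 (v i))"

fun mlp_eval :: "nat list \<Rightarrow> (mat \<times> vec) list \<Rightarrow> vec \<Rightarrow> vec" where
  "mlp_eval (n # m # ns) [(A, c)] x = affine_map n m A c x"
| "mlp_eval (n # m # ns) ((A, c) # l # ls) x = mlp_eval (m # ns) (l # ls) (relu (affine_map n m A c x))"
| "mlp_eval _ _ x = x"

definition mlp_ok :: "mlp \<Rightarrow> nat \<Rightarrow> nat \<Rightarrow> bool" where
  "mlp_ok \<xi> a b \<longleftrightarrow> snd \<xi> \<noteq> [] \<and> length (fst \<xi>) = length (snd \<xi>) + 1 \<and>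
      hd (fst \<xi>) = a \<and> last (fst \<xi>) = b"

definition mlp_map :: "mlp \<Rightarrow> pmeas \<Rightarrow> vec \<Rightarrow> real \<Rightarrow> vec" where
  "mlp_map \<xi> M x t = mlp_eval (fst \<xi>) (snd \<xi>) x"

definition mcomp :: "(pmeas \<Rightarrow> vec \<Rightarrow> real \<Rightarrow> vec) \<Rightarrow> (pmeas \<Rightarrow> vec \<Rightarrow> real \<Rightarrow> vec) \<Rightarrow> (pmeas \<Rightarrow> vec \<Rightarrow> real \<Rightarrow> vec)"
  (infixr \<open>\<diamond>\<close> 60) where
  "(G2 \<diamond> G1) M x t = G2 (distr M borel (\<lambda>(y, s). (G1 M y s, s))) (G1 M x t) t"

text \<open>Network F_L <> (Gamma_L <> (... <> (F_1 <> Gamma_1))), layers listed first to last.\<close>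
fun tnet_aux :: "(pmeas \<Rightarrow> vec \<Rightarrow> real \<Rightarrow> vec) \<Rightarrow> (attn_params \<times> mlp) list \<Rightarrow> (pmeas \<Rightarrow> vec \<Rightarrow> real \<Rightarrow> vec)" where
  "tnet_aux G [] = G"
| "tnet_aux G ((\<theta>, \<xi>) # ls) = tnet_aux (mlp_map \<xi> \<diamond> (attn \<theta> \<diamond> G)) ls"

fun tnet :: "(attn_params \<times> mlp) list \<Rightarrow> (pmeas \<Rightarrow> vec \<Rightarrow> real \<Rightarrow> vec)" where
  "tnet [] = (\<lambda>M x t. x)"
| "tnet ((\<theta>, \<xi>) # ls) = tnet_aux (mlp_map \<xi> \<diamond> attn \<theta>) ls"

definition compatible :: "nat \<Rightarrow> nat \<Rightarrow> (attn_params \<times> mlp) list \<Rightarrow> bool" where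
  "compatible d d' ls \<longleftrightarrow> ls \<noteq> [] \<and> din (fst (ls ! 0)) = d \<and>
     (\<forall>i<length ls. mlp_ok (snd (ls ! i)) (din (fst (ls ! i)))
         (if Suc i < length ls then din (fst (ls ! Suc i)) else d'))"

end

theory Submission
  imports Defs
begin

text \<open>
  Causality and identifiability are rigid: if the time marginal of \<open>N\<close> lives on a finite grid, then
  \<open>t \<mapsto> \<Lambda> N x t\<close> takes finitely many values and, being continuous, is constant. Rounding up the time
  marginal of any \<open>M\<close> gives such measures converging weakly to \<open>M\<close>, so \<open>\<Lambda> M x t\<close> depends only on \<open>x\<close> and
  on the law \<open>\<alpha>\<close> of the particles at time \<open>0\<close>. The probability measures on \<open>\<Omega>\<close> are weakly compact, so
  by Stone-Weierstrass \<open>\<Lambda>\<close> is uniformly close to a polynomial in the coordinates of \<open>x\<close> and the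
  moments of \<open>\<alpha>\<close>.

  Such a polynomial is evaluated by a register machine with \<open>d\<close> input registers, \<open>d'\<close> accumulators and
  two scratch registers (whence the width \<open>d + d' + 2 \<le> d + 3 d'\<close>). Products are ReLU approximations
  of squares. A head with zero keys and queries adds to a register \<open>c\<close> its running average;
  iterating \<open>c \<leftarrow> (c + avg c) / 2\<close> converges uniformly to the mean of \<open>c\<close> at time \<open>0\<close>, since the
  mass \<open>\<sigma>\<close> at time \<open>0\<close> contracts the error by the factor \<open>1 - \<sigma> / 2\<close>.
\<close>

section \<open>Weak compactness\<close>

text \<open>\<open>weak_star\<close> is a topology on all measures of the type, so
  \<open>\<Lambda>\<close> is only ever followed along sequences. Compactness is applied instead to
  pairs of a point and a moment sequence, which form a subset of a metrizable product space.

  The rounded measures must stay inside the class. Only the time marginal is moved and the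
  disintegration kernel is kept, so the Wasserstein bound is untouched, and the atom at
  \<open>0\<close> cannot shrink because \<open>0\<close> is a grid point. The Wasserstein bound
  itself is used to show that s \<mapsto> \<integral> f(x, s) d\<kappa>(s) is continuous; this
  yields both the measurability of the kernel and the convergence of the rounded measures.

  A head meets the time of a particle only through the mask, so it cannot single out the particles
  at time \<open>0\<close>: a plain average at time t mixes in everything up to t. Since the
  residual connection produces c + avg c, the MLP halves it, and the result is an averaging operator
  that preserves the mean at time \<open>0\<close>. Its factor is (1 + (1 - \<sigma>)) / 2.\<close>

definition cantor_digit :: "real \<Rightarrow> real" where
  "cantor_digit y = max 0 (min 1 (3 * y - 1))"

text \<open>On the Cantor set \<open>cantor_digit\<close> is half the first ternary digit and
  \<open>cantor_shift\<close> deletes that digit. Both are piecewise linear and continuous on the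
  whole line, since the gap between 1/3 and 2/3 leaves room to interpolate.\<close>

definition cantor_shift :: "real \<Rightarrow> real" where
  "cantor_shift y = 3 * y - 2 * cantor_digit y"

definition cantor_sum :: "(nat \<Rightarrow> real) \<Rightarrow> real" where
  "cantor_sum b = (\<Sum>j. 2 * b j / 3 ^ Suc j)"

text \<open>A single point codes a whole sequence of reals: the ternary position
  \<open>prod_encode (i, k)\<close> stores the k-th binary digit of coordinate i.\<close>

definition cantor_decode :: "real \<Rightarrow> vec" where
  "cantor_decode y = (\<lambda>i. \<Sum>k. cantor_digit ((cantor_shift ^^ prod_encode (i, k)) y) / 2 ^ Suc k)"

definition binary_digit :: "real \<Rightarrow> nat \<Rightarrow> real" where
  "binary_digit x k = of_int \<lfloor>2 ^ Suc k * x\<rfloor> - 2 * of_int \<lfloor>2 ^ k * x\<rfloor>"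

lemma binary_digit_cases: "binary_digit x k = 0 \<or> binary_digit x k = 1"
proof -
  have "\<lfloor>2 ^ Suc k * x\<rfloor> = 2 * \<lfloor>2 ^ k * x\<rfloor> \<or> \<lfloor>2 ^ Suc k * x\<rfloor> = 2 * \<lfloor>2 ^ k * x\<rfloor> + 1"
    by simp linarith
  then show ?thesis
    unfolding binary_digit_def by auto
qed

text \<open>The digits telescope: the n-th partial sum is the floor of 2^n x divided by 2^n. The
  case n = 0 is where x < 1 enters.\<close>

lemma binary_digit_sums:
  assumes "0 \<le> x" "x < 1"
  shows "(\<lambda>k. binary_digit x k / 2 ^ Suc k) sums x"
proof -
  have eq: "(\<Sum>k<n. binary_digit x k / 2 ^ Suc k) = of_int \<lfloor>2 ^ n * x\<rfloor> / 2 ^ n" for n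
  proof (induction n)
    case 0
    have "\<lfloor>x\<rfloor> = 0"
      using assms by (simp add: floor_eq_iff)
    then show ?case by simp
  next
    case (Suc n)
    then show ?case
      by (simp add: binary_digit_def field_simps)
  qed
  have "(\<lambda>n. of_int \<lfloor>2 ^ n * x\<rfloor> / 2 ^ n) \<longlonglongrightarrow> x"
  proof (rule real_tendsto_sandwich)
    show "\<forall>\<^sub>F n in sequentially. x - (1/2) ^ n \<le> of_int \<lfloor>2 ^ n * x\<rfloor> / 2 ^ n"
    proof (intro always_eventually allI)
      fix n :: nat
      have "2 ^ n * x - 1 \<le> of_int \<lfloor>2 ^ n * x\<rfloor>"
        by linarith
      then have "(2 ^ n * x - 1) / 2 ^ n \<le> of_int \<lfloor>2 ^ n * x\<rfloor> / 2 ^ n"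
        by (intro divide_right_mono) auto
      then show "x - (1/2) ^ n \<le> of_int \<lfloor>2 ^ n * x\<rfloor> / 2 ^ n"
        by (simp add: diff_divide_distrib power_one_over)
    qed
    show "\<forall>\<^sub>F n in sequentially. of_int \<lfloor>2 ^ n * x\<rfloor> / 2 ^ n \<le> x"
      by (intro always_eventually allI) (simp add: divide_le_eq mult.commute)
    have "(\<lambda>n. x - (1/2) ^ n) \<longlonglongrightarrow> x - 0"
      by (intro tendsto_intros LIMSEQ_power_zero) auto
    then show "(\<lambda>n. x - (1/2) ^ n) \<longlonglongrightarrow> x" by simp
  qed simp
  then show ?thesis
    unfolding sums_def eq .
qed

lemma cantor_summable:
  fixes b :: "nat \<Rightarrow> real"
  assumes "\<And>j. b j \<in> {0, 1}"
  shows "summable (\<lambda>j. 2 * b j / 3 ^ Suc j)"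
proof (rule summable_comparison_test)
  show "\<exists>N. \<forall>n\<ge>N. norm (2 * b n / 3 ^ Suc n) \<le> (2/3) * (1/3) ^ n"
  proof (intro exI allI impI)
    fix n
    consider "b n = 0" | "b n = 1" using assms[of n] by blast
    then show "norm (2 * b n / 3 ^ Suc n) \<le> (2/3) * (1/3) ^ n"
      by cases (simp_all add: power_divide)
  qed
  show "summable (\<lambda>n. (2/3) * (1/3::real) ^ n)"
    by (intro summable_mult summable_geometric) auto
qed

lemma cantor_sum_bounds:
  assumes "\<And>j. b j \<in> {0, 1}"
  shows "0 \<le> cantor_sum b" "cantor_sum b \<le> 1"
proof -
  have b: "0 \<le> b j" "b j \<le> 1" for j
    using assms[of j] by auto
  show "0 \<le> cantor_sum b"
    unfolding cantor_sum_def using b by (intro suminf_nonneg cantor_summable assms) auto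
  have "(\<lambda>j. (2/3) * (1/3::real) ^ j) sums ((2/3) * (1 / (1 - 1/3)))"
    by (intro sums_mult geometric_sums) auto
  then have s: "(\<lambda>j. (2/3) * (1/3::real) ^ j) sums 1" by simp
  have "cantor_sum b \<le> (\<Sum>j. (2/3) * (1/3::real) ^ j)"
    unfolding cantor_sum_def
    by (intro suminf_le cantor_summable assms sums_summable[OF s])
       (use b in \<open>simp add: power_one_over divide_right_mono\<close>)
  also have "\<dots> = 1" using sums_unique[OF s] by simp
  finally show "cantor_sum b \<le> 1" .
qed

lemma cantor_sum_split:
  assumes "\<And>j. b j \<in> {0, 1}"
  shows "cantor_sum b = 2 * b 0 / 3 + cantor_sum (\<lambda>j. b (Suc j)) / 3"
proof -
  have "(\<Sum>j. 2 * b (Suc j) / 3 ^ Suc (Suc j)) = cantor_sum b - 2 * b 0 / 3 ^ Suc 0"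
    unfolding cantor_sum_def using suminf_split_head[OF cantor_summable[of b, OF assms]] .
  then have "cantor_sum b = 2 * b 0 / 3 ^ Suc 0 + (\<Sum>j. 2 * b (Suc j) / 3 ^ Suc (Suc j))"
    by linarith
  also have "(\<Sum>j. 2 * b (Suc j) / 3 ^ Suc (Suc j)) = (\<Sum>j. (2 * b (Suc j) / 3 ^ Suc j) / 3)"
    by simp
  also have "\<dots> = cantor_sum (\<lambda>j. b (Suc j)) / 3"
    unfolding cantor_sum_def by (rule suminf_divide[OF cantor_summable[of "\<lambda>j. b (Suc j)", OF assms]])
  finally show ?thesis by simp
qed

lemma cantor_digit_sum:
  assumes "\<And>j. b j \<in> {0, 1}"
  shows "cantor_digit (cantor_sum b) = b 0"
proof -
  have "0 \<le> cantor_sum (\<lambda>j. b (Suc j))" "cantor_sum (\<lambda>j. b (Suc j)) \<le> 1"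
    using assms by (intro cantor_sum_bounds; blast)+
  moreover have "cantor_sum b = 2 * b 0 / 3 + cantor_sum (\<lambda>j. b (Suc j)) / 3"
    using assms by (rule cantor_sum_split)
  moreover have "b 0 = 0 \<or> b 0 = 1"
    using assms[of 0] by blast
  ultimately show ?thesis
    by (auto simp: cantor_digit_def)
qed

lemma cantor_shift_sum:
  assumes "\<And>j. b j \<in> {0, 1}"
  shows "cantor_shift (cantor_sum b) = cantor_sum (\<lambda>j. b (Suc j))"
  using cantor_sum_split[of b, OF assms] cantor_digit_sum[of b, OF assms]
  unfolding cantor_shift_def by linarith

lemma cantor_shift_funpow_sum:
  assumes "\<And>j. b j \<in> {0, 1}"
  shows "(cantor_shift ^^ n) (cantor_sum b) = cantor_sum (\<lambda>j. b (n + j))"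
proof (induction n)
  case (Suc n)
  have "(cantor_shift ^^ Suc n) (cantor_sum b) = cantor_shift (cantor_sum (\<lambda>j. b (n + j)))"
    using Suc by simp
  also have "\<dots> = cantor_sum (\<lambda>j. b (n + Suc j))"
    by (rule cantor_shift_sum) (rule assms)
  finally show ?case by simp
qed simp

lemma cantor_decode_sum:
  assumes "\<And>i. 0 \<le> u i \<and> u i < 1"
  shows "cantor_decode (cantor_sum (\<lambda>j. binary_digit (u (fst (prod_decode j))) (snd (prod_decode j)))) = u"
    (is "cantor_decode (cantor_sum ?b) = u")
proof
  fix i
  have b: "?b j \<in> {0, 1}" for j
    using binary_digit_cases by auto
  have "cantor_digit ((cantor_shift ^^ n) (cantor_sum ?b)) = ?b n" for n
    unfolding cantor_shift_funpow_sum[OF b] by (subst cantor_digit_sum) (use b in auto)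
  then have "cantor_decode (cantor_sum ?b) i = (\<Sum>k. binary_digit (u i) k / 2 ^ Suc k)"
    by (simp add: cantor_decode_def)
  also have "\<dots> = u i"
    using sums_unique[OF binary_digit_sums[of "u i"]] assms[of i] by simp
  finally show "cantor_decode (cantor_sum ?b) i = u i" .
qed

text \<open>Every coordinate is a uniform limit of continuous functions, because
  \<open>cantor_digit\<close> is bounded by 1 off the Cantor set as well. Continuity on the whole
  line is what lets test functions on vectors be pulled back to test functions on the line.\<close>

lemma continuous_cantor_decode: "continuous_on UNIV cantor_decode"
proof (rule continuous_on_coordinatewise_then_product)
  fix i
  have dig: "continuous_on UNIV cantor_digit"
    unfolding cantor_digit_def by (intro continuous_intros)
  then have sh: "continuous_on UNIV cantor_shift"
    unfolding cantor_shift_def by (intro continuous_intros)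
  have pow: "continuous_on UNIV (cantor_shift ^^ n)" for n
  proof (induction n)
    case 0
    then show ?case by (simp add: continuous_on_id id_def)
  next
    case (Suc n)
    then show ?case
      using continuous_on_compose[OF Suc, of cantor_shift] continuous_on_subset[OF sh subset_UNIV] by simp
  qed
  have term_cont: "continuous_on UNIV (\<lambda>y. cantor_digit ((cantor_shift ^^ n) y))" for n
    by (rule continuous_on_compose2[OF dig pow]) auto
  have "uniform_limit UNIV (\<lambda>n y. \<Sum>k<n. cantor_digit ((cantor_shift ^^ prod_encode (i, k)) y) / 2 ^ Suc k)
      (\<lambda>y. \<Sum>k. cantor_digit ((cantor_shift ^^ prod_encode (i, k)) y) / 2 ^ Suc k) sequentially"
  proof (rule Weierstrass_m_test)
    show "norm (cantor_digit ((cantor_shift ^^ prod_encode (i, k)) y) / 2 ^ Suc k) \<le> (1/2) ^ k" for k y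
    proof -
      have "\<bar>cantor_digit z\<bar> \<le> 1" for z
        by (auto simp: cantor_digit_def)
      then have "\<bar>cantor_digit z\<bar> / 2 ^ Suc k \<le> 1 / 2 ^ Suc k" for z
        by (intro divide_right_mono) auto
      also have "1 / 2 ^ Suc k \<le> (1/2::real) ^ k"
        by (simp add: power_one_over field_simps)
      finally show ?thesis by simp
    qed
    show "summable (\<lambda>k. (1/2::real) ^ k)"
      by (intro summable_geometric) auto
  qed
  then have "continuous_on UNIV (\<lambda>y. \<Sum>k. cantor_digit ((cantor_shift ^^ prod_encode (i, k)) y) / 2 ^ Suc k)"
    by (rule uniform_limit_theorem[rotated])
       (auto intro!: always_eventually continuous_intros term_cont)
  then show "continuous_on UNIV (\<lambda>y. cantor_decode y i)"
    by (simp add: cantor_decode_def)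
qed

lemma borel_measurable_cantor_sum:
  assumes "\<And>j. (\<lambda>x. b x j) \<in> borel_measurable M"
  shows "(\<lambda>x. cantor_sum (b x)) \<in> borel_measurable M"
  unfolding cantor_sum_def using assms by (intro borel_measurable_suminf) simp

section \<open>Weak limits of laws on a compact set\<close>

definition concentrated :: "vec set \<Rightarrow> vec measure \<Rightarrow> bool" where
  "concentrated \<Omega> \<alpha> \<longleftrightarrow> prob_space \<alpha> \<and> sets \<alpha> = sets borel \<and> emeasure \<alpha> \<Omega> = 1"

lemma AE_in_full_measure:
  assumes "prob_space M" "A \<in> sets M" "emeasure M A = 1"
  shows "AE x in M. x \<in> A"
  using prob_space.AE_in_set_eq_1[OF assms(1,2)] assms(3) by (simp add: measure_def)

text \<open>The bound depends on the coordinate: compactness in the product topology controls each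
  coordinate separately.\<close>

lemma compact_vec_coordinate_bound:
  fixes \<Omega> :: "vec set"
  assumes "compact \<Omega>"
  obtains R where "\<And>x i. x \<in> \<Omega> \<Longrightarrow> \<bar>x i\<bar> \<le> R i" "\<And>i. 0 \<le> R i"
proof -
  have "\<exists>r\<ge>0. \<forall>x\<in>\<Omega>. \<bar>x i\<bar> \<le> r" for i
  proof -
    have "compact ((\<lambda>x. x i) ` \<Omega>)"
      by (intro compact_continuous_image assms continuous_on_subset[OF continuous_on_product_coordinates]) auto
    then have "bounded ((\<lambda>x. x i) ` \<Omega>)" by (rule compact_imp_bounded)
    then obtain r where "r > 0" "\<forall>y\<in>(\<lambda>x. x i) ` \<Omega>. norm y \<le> r"
      using bounded_pos by blast
    then show ?thesis by (intro exI[of _ r]) auto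
  qed
  then obtain R where "\<forall>i. R i \<ge> 0 \<and> (\<forall>x\<in>\<Omega>. \<bar>x i\<bar> \<le> R i)" by metis
  then show ?thesis using that by blast
qed

text \<open>Weak sequential compactness is transported from Helly's theorem on the line: the
  Borel map \<open>enc\<close> into the Cantor set has the left inverse \<open>dec\<close>, which is continuous on the whole line.\<close>

lemma concentrated_weakly_convergent_subsequence:
  assumes \<Omega>: "compact \<Omega>" and \<alpha>: "\<And>n. concentrated \<Omega> (\<alpha> n)"
  obtains r \<beta> where "strict_mono (r :: nat \<Rightarrow> nat)" "concentrated \<Omega> \<beta>"
    "\<And>f :: vec \<Rightarrow> real. continuous_on UNIV f \<Longrightarrow> bounded (range f) \<Longrightarrow>
       (\<lambda>n. \<integral>x. f x \<partial>\<alpha> (r n)) \<longlonglongrightarrow> (\<integral>x. f x \<partial>\<beta>)"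
proof -
  obtain R where R: "\<And>x i. x \<in> \<Omega> \<Longrightarrow> \<bar>x i\<bar> \<le> R i" "\<And>i. 0 \<le> R i"
    using compact_vec_coordinate_bound[OF \<Omega>] by blast
  have \<Omega>_borel[measurable]: "\<Omega> \<in> sets borel"
    using \<Omega> by (simp add: borel_closed compact_imp_closed)
  \<comment> \<open>Rescales [-R i, R i] into [0, 1). The extra 1 in the denominator keeps the value
    strictly below 1, as binary expansion requires, and avoids division by 0.\<close>
  define u where "u x i = (x i + R i) / (2 * R i + 1)" for x :: vec and i
  define enc where "enc x = cantor_sum (\<lambda>j. binary_digit (u x (fst (prod_decode j))) (snd (prod_decode j)))" for x
  define dec where "dec y = (\<lambda>i. (2 * R i + 1) * cantor_decode y i - R i)" for y
  have dec_enc: "dec (enc x) = x" if "x \<in> \<Omega>" for x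
  proof -
    have "0 \<le> u x i \<and> u x i < 1" for i
      using R(1)[OF that, of i] R(2)[of i] by (auto simp: u_def field_simps)
    then have "cantor_decode (enc x) = u x"
      unfolding enc_def by (rule cantor_decode_sum)
    moreover have "2 * R i + 1 \<noteq> 0" for i
      using R(2)[of i] by linarith
    ultimately show ?thesis
      by (simp add: dec_def u_def)
  qed
  have enc_bounds: "0 \<le> enc x" "enc x \<le> 1" for x
    unfolding enc_def using binary_digit_cases by (auto intro!: cantor_sum_bounds)
  have enc_meas[measurable]: "enc \<in> borel_measurable borel"
    unfolding enc_def binary_digit_def u_def
  proof (intro borel_measurable_cantor_sum)
    have [measurable]: "(\<lambda>x :: vec. x i) \<in> borel_measurable borel" for i
      by (intro borel_measurable_continuous_onI continuous_on_product_coordinates)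
    show "(\<lambda>x :: vec. real_of_int \<lfloor>2 ^ Suc (snd (prod_decode j)) *
          ((x (fst (prod_decode j)) + R (fst (prod_decode j))) / (2 * R (fst (prod_decode j)) + 1))\<rfloor> -
        2 * real_of_int \<lfloor>2 ^ snd (prod_decode j) *
          ((x (fst (prod_decode j)) + R (fst (prod_decode j))) / (2 * R (fst (prod_decode j)) + 1))\<rfloor>)
        \<in> borel_measurable borel" for j
      by measurable
  qed
  have dec_cont: "continuous_on UNIV dec"
    unfolding dec_def
    by (intro continuous_on_coordinatewise_then_product continuous_on_diff continuous_on_mult
        continuous_on_const continuous_on_product_then_coordinatewise[OF continuous_cantor_decode])
  then have dec_meas[measurable]: "dec \<in> borel_measurable borel"
    by (rule borel_measurable_continuous_onI)
  have prob: "prob_space (\<alpha> n)" and sets[measurable_cong]: "sets (\<alpha> n) = sets borel"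
    and full: "emeasure (\<alpha> n) \<Omega> = 1" for n
    using \<alpha>[of n] by (auto simp: concentrated_def)
  have AE\<Omega>: "AE x in \<alpha> n. x \<in> \<Omega>" for n
    by (rule AE_in_full_measure) (auto simp: prob sets full)
  define \<mu> where "\<mu> n = distr (\<alpha> n) borel enc" for n
  have rd: "real_distribution (\<mu> n)" for n
    unfolding \<mu>_def by (rule prob_space.real_distribution_distr[OF prob]) measurable
  \<comment> \<open>All encoded laws live on [0, 1], so one interval serves every
    \<epsilon>.\<close>
  have "tight \<mu>"
    unfolding tight_def
  proof (intro conjI allI impI rd)
    fix \<epsilon> :: real assume "0 < \<epsilon>"
    show "\<exists>a b. a < b \<and> (\<forall>n. 1 - \<epsilon> < measure (\<mu> n) {a<..b})"
    proof (intro exI conjI allI)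
      show "(-1::real) < 1" by simp
      fix n
      have "measure (\<mu> n) {-1<..1} = measure (\<alpha> n) (enc -` {-1<..1} \<inter> space (\<alpha> n))"
        unfolding \<mu>_def by (rule measure_distr) measurable
      also have "enc -` {-1<..1} \<inter> space (\<alpha> n) = space (\<alpha> n)"
        using enc_bounds(2) less_le_trans[OF _ enc_bounds(1), of "-1"] by auto
      also have "measure (\<alpha> n) (space (\<alpha> n)) = 1"
        by (rule prob_space.prob_space[OF prob])
      finally show "1 - \<epsilon> < measure (\<mu> n) {-1<..1}" using \<open>0 < \<epsilon>\<close> by simp
    qed
  qed
  then obtain r \<nu> where r: "strict_mono (r :: nat \<Rightarrow> nat)" and \<nu>: "real_distribution \<nu>"
    and conv: "weak_conv_m (\<mu> \<circ> id \<circ> r) \<nu>"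
    using tight_imp_convergent_subsubsequence[of \<mu> id] strict_mono_id by blast
  interpret \<nu>: real_distribution \<nu> by fact
  define \<beta> where "\<beta> = distr \<nu> borel dec"
  have prob_\<beta>: "prob_space \<beta>"
    unfolding \<beta>_def by (rule \<nu>.prob_space_distr) measurable
  have sets_\<beta>[measurable_cong]: "sets \<beta> = sets borel"
    by (simp add: \<beta>_def)
  have lim: "(\<lambda>n. \<integral>x. f x \<partial>\<alpha> (r n)) \<longlonglongrightarrow> (\<integral>x. f x \<partial>\<beta>)"
    if f: "continuous_on UNIV f" "bounded (range f)" for f :: "vec \<Rightarrow> real"
  proof -
    have [measurable]: "f \<in> borel_measurable borel"
      using f(1) by (rule borel_measurable_continuous_onI)
    obtain B where B: "\<And>x. norm (f x) \<le> B"
      using f(2) by (auto simp: bounded_iff)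
    have cont: "continuous_on UNIV (\<lambda>y. f (dec y))"
      by (rule continuous_on_compose2[OF f(1) dec_cont]) auto
    have "(\<lambda>n. \<integral>y. f (dec y) \<partial>(\<mu> \<circ> id \<circ> r) n) \<longlonglongrightarrow> (\<integral>y. f (dec y) \<partial>\<nu>)"
      by (rule weak_conv_imp_integral_bdd_continuous_conv[OF _ \<nu> conv])
         (use rd B cont in \<open>auto simp: continuous_on_eq_continuous_at\<close>)
    moreover have "(\<integral>y. f (dec y) \<partial>\<nu>) = (\<integral>x. f x \<partial>\<beta>)"
      unfolding \<beta>_def by (rule integral_distr[symmetric]) measurable
    moreover have "(\<integral>y. f (dec y) \<partial>\<mu> n) = (\<integral>x. f x \<partial>\<alpha> n)" for n
    proof -
      have "(\<integral>y. f (dec y) \<partial>\<mu> n) = (\<integral>x. f (dec (enc x)) \<partial>\<alpha> n)"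
        unfolding \<mu>_def by (rule integral_distr) measurable
      also have "\<dots> = (\<integral>x. f x \<partial>\<alpha> n)"
        by (rule integral_cong_AE) (use AE\<Omega>[of n] in \<open>auto simp: dec_enc\<close>)
      finally show ?thesis .
    qed
    ultimately show ?thesis by simp
  qed
  have "\<Omega> \<noteq> {}"
    using full[of 0] by auto
  have infdist_cont: "continuous_on UNIV (\<lambda>x. min 1 (infdist x \<Omega>))"
    by (intro continuous_intros)
  then have [measurable]: "(\<lambda>x. min 1 (infdist x \<Omega>)) \<in> borel_measurable borel"
    by (rule borel_measurable_continuous_onI)
  \<comment> \<open>The truncated distance to \<Omega> is a bounded continuous test function with
    integral 0 along the sequence. Its integral against the limit is therefore 0, which puts \<beta>
    on the closed set \<Omega>.\<close>
  have "(\<lambda>n. \<integral>x. min 1 (infdist x \<Omega>) \<partial>\<alpha> (r n)) \<longlonglongrightarrow> (\<integral>x. min 1 (infdist x \<Omega>) \<partial>\<beta>)"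
  proof (rule lim[OF infdist_cont])
    show "bounded (range (\<lambda>x. min 1 (infdist x \<Omega>)))"
      by (rule boundedI[of _ 1]) (auto simp: infdist_nonneg)
  qed
  moreover have "(\<integral>x. min 1 (infdist x \<Omega>) \<partial>\<alpha> n) = 0" for n
  proof -
    have "(\<integral>x. min 1 (infdist x \<Omega>) \<partial>\<alpha> n) = (\<integral>x. 0 \<partial>\<alpha> n)"
      by (rule integral_cong_AE) (use AE\<Omega>[of n] in \<open>auto\<close>)
    then show ?thesis by simp
  qed
  ultimately have zero: "(\<integral>x. min 1 (infdist x \<Omega>) \<partial>\<beta>) = 0"
    by (simp add: LIMSEQ_const_iff)
  interpret \<beta>: prob_space \<beta> by fact
  have "integrable \<beta> (\<lambda>x. min 1 (infdist x \<Omega>))"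
    by (rule \<beta>.integrable_const_bound[where B = 1]) (auto simp: infdist_nonneg)
  then have "AE x in \<beta>. min 1 (infdist x \<Omega>) = 0"
    using zero by (subst (asm) integral_nonneg_eq_0_iff_AE) (auto simp: infdist_nonneg)
  then have "AE x in \<beta>. x \<in> \<Omega>"
  proof (rule eventually_mono)
    fix x assume "min 1 (infdist x \<Omega>) = 0"
    then have "infdist x \<Omega> = 0" by linarith
    then show "x \<in> \<Omega>"
      using in_closed_iff_infdist_zero[OF compact_imp_closed[OF \<Omega>] \<open>\<Omega> \<noteq> {}\<close>] by blast
  qed
  then have "\<beta>.prob \<Omega> = 1"
    by (subst \<beta>.prob_eq_1) (auto simp: sets_\<beta>)
  then have "concentrated \<Omega> \<beta>"
    using prob_\<beta> by (simp add: concentrated_def sets_\<beta> \<beta>.emeasure_eq_measure)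
  then show ?thesis
    using that r lim by blast
qed

section \<open>Polynomials in the moments\<close>

text \<open>The constructors here and in \<open>polynomials\<close> match what the register machine
  does in one round: multiply an accumulator by one generator, or add a scaled monomial to a running
  sum. The later constructions are inductions over these rules.\<close>

inductive_set monomials :: "('a \<Rightarrow> real) set \<Rightarrow> ('a \<Rightarrow> real) set" for \<Gamma> where
  one: "(\<lambda>_. 1) \<in> monomials \<Gamma>"
| mult: "g \<in> \<Gamma> \<Longrightarrow> p \<in> monomials \<Gamma> \<Longrightarrow> (\<lambda>x. g x * p x) \<in> monomials \<Gamma>"

inductive_set polynomials :: "('a \<Rightarrow> real) set \<Rightarrow> ('a \<Rightarrow> real) set" for \<Gamma> where
  zero: "(\<lambda>_. 0) \<in> polynomials \<Gamma>"
| add: "p \<in> monomials \<Gamma> \<Longrightarrow> q \<in> polynomials \<Gamma> \<Longrightarrow> (\<lambda>x. a * p x + q x) \<in> polynomials \<Gamma>"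

lemma monomials_times:
  assumes "p \<in> monomials \<Gamma>" "q \<in> monomials \<Gamma>"
  shows "(\<lambda>x. p x * q x) \<in> monomials \<Gamma>"
  using assms
proof (induction rule: monomials.induct)
  case (mult g p)
  then show ?case
    using monomials.mult[of g \<Gamma> "\<lambda>x. p x * q x"] by (simp add: mult.assoc)
qed simp

lemma polynomials_monomial: "p \<in> monomials \<Gamma> \<Longrightarrow> (\<lambda>x. a * p x) \<in> polynomials \<Gamma>"
  using polynomials.add[OF _ polynomials.zero, of p \<Gamma> a] by simp

lemma polynomials_plus:
  assumes "p \<in> polynomials \<Gamma>" "q \<in> polynomials \<Gamma>"
  shows "(\<lambda>x. p x + q x) \<in> polynomials \<Gamma>"
  using assms
proof (induction rule: polynomials.induct)
  case (add p r a)
  then show ?case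
    using polynomials.add[of p \<Gamma> "\<lambda>x. r x + q x" a] by (simp add: add.assoc)
qed simp

lemma polynomials_monomial_times:
  assumes "q \<in> polynomials \<Gamma>" "p \<in> monomials \<Gamma>"
  shows "(\<lambda>x. a * p x * q x) \<in> polynomials \<Gamma>"
  using assms
proof (induction rule: polynomials.induct)
  case (add r s b)
  then show ?case
    using polynomials.add[OF monomials_times[of p \<Gamma> r], of "\<lambda>x. a * p x * s x" "a * b"]
    by (simp add: algebra_simps)
qed (simp add: polynomials.zero)

lemma polynomials_times:
  assumes "p \<in> polynomials \<Gamma>" "q \<in> polynomials \<Gamma>"
  shows "(\<lambda>x. p x * q x) \<in> polynomials \<Gamma>"
  using assms
proof (induction rule: polynomials.induct)
  case (add p r a)
  then show ?case
    using polynomials_plus[OF polynomials_monomial_times[of q \<Gamma> p a], of "\<lambda>x. r x * q x"]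
    by (simp add: algebra_simps)
qed (simp add: polynomials.zero)

lemma continuous_on_monomials:
  assumes "p \<in> monomials \<Gamma>" "\<And>g. g \<in> \<Gamma> \<Longrightarrow> continuous_on S g"
  shows "continuous_on S p"
  using assms(1) by induction (auto intro: continuous_on_mult assms(2))

lemma continuous_on_polynomials:
  assumes "p \<in> polynomials \<Gamma>" "\<And>g. g \<in> \<Gamma> \<Longrightarrow> continuous_on S g"
  shows "continuous_on S p"
  using assms(1)
proof induction
  case (add p q a)
  have "continuous_on S p"
    using add.hyps(1) assms(2) by (rule continuous_on_monomials)
  then show ?case
    using add.IH by (intro continuous_intros)
qed simp

text \<open>Stone-Weierstrass for the algebra generated by \<Gamma>. Continuity and separation of
  points have to be checked on the generators only.\<close>

lemma polynomials_uniformly_dense: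
  fixes S :: "'a::t2_space set" and f :: "'a \<Rightarrow> real"
  assumes "compact S" and cont: "\<And>g. g \<in> \<Gamma> \<Longrightarrow> continuous_on S g"
    and sep: "\<And>x y. x \<in> S \<Longrightarrow> y \<in> S \<Longrightarrow> x \<noteq> y \<Longrightarrow> \<exists>g\<in>\<Gamma>. g x \<noteq> g y"
    and f: "continuous_on S f" and "0 < e"
  obtains p where "p \<in> polynomials \<Gamma>" "\<And>x. x \<in> S \<Longrightarrow> \<bar>f x - p x\<bar> < e"
proof -
  interpret function_ring_on "polynomials \<Gamma>" S
  proof
    show "continuous_on S g" if "g \<in> polynomials \<Gamma>" for g
      using that cont by (rule continuous_on_polynomials)
    show "(\<lambda>_. c) \<in> polynomials \<Gamma>" for c
      using polynomials_monomial[OF monomials.one, of c] by simp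
    show "\<exists>g\<in>polynomials \<Gamma>. g x \<noteq> g y" if xy: "x \<in> S" "y \<in> S" "x \<noteq> y" for x y
    proof -
      obtain g where "g \<in> \<Gamma>" "g x \<noteq> g y"
        using sep[OF xy] by blast
      then show ?thesis
        using polynomials_monomial[OF monomials.mult[OF _ monomials.one], of g \<Gamma> 1] by auto
    qed
  qed (use \<open>compact S\<close> in \<open>auto intro: polynomials_plus polynomials_times\<close>)
  show ?thesis
    using Stone_Weierstrass_basic[OF f \<open>0 < e\<close>] that by blast
qed

section \<open>Moments determine weak convergence on a compact set\<close>

lemma tendsto_fun_iff:
  fixes f :: "'a \<Rightarrow> 'b \<Rightarrow> 'c::topological_space"
  shows "(f \<longlongrightarrow> l) F \<longleftrightarrow> (\<forall>i. ((\<lambda>x. f x i) \<longlongrightarrow> l i) F)"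
proof -
  have "(f \<longlongrightarrow> l) F \<longleftrightarrow> limitin (product_topology (\<lambda>i. euclidean) UNIV) f l F"
    by (simp add: euclidean_product_topology)
  then show ?thesis
    by (simp add: limitin_componentwise)
qed

abbreviation weakly_to :: "(nat \<Rightarrow> vec measure) \<Rightarrow> vec measure \<Rightarrow> bool" where
  "weakly_to \<alpha> \<beta> \<equiv> (\<forall>f :: vec \<Rightarrow> real. continuous_on UNIV f \<longrightarrow> bounded (range f) \<longrightarrow>
     (\<lambda>n. \<integral>x. f x \<partial>\<alpha> n) \<longlonglongrightarrow> (\<integral>x. f x \<partial>\<beta>))"

text \<open>A list of coordinate indices plays the role of a multi-index; lists that differ by a
  permutation name the same moment.\<close>

definition moment :: "vec measure \<Rightarrow> nat list \<Rightarrow> real" where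
  "moment \<alpha> l = (\<integral>x. prod_list (map x l) \<partial>\<alpha>)"

lemma continuous_on_prod_list_map: "continuous_on S (\<lambda>x :: vec. prod_list (map x l))"
  by (induction l) (auto intro!: continuous_intros continuous_on_subset[OF continuous_on_product_coordinates])

lemma coordinate_monomials: "p \<in> monomials (range (\<lambda>i (x :: vec). x i)) \<Longrightarrow> \<exists>l. p = (\<lambda>x. prod_list (map x l))"
proof (induction rule: monomials.induct)
  case one
  show ?case by (rule exI[of _ "[]"]) simp
next
  case (mult g p)
  then obtain i l where "g = (\<lambda>x. x i)" "p = (\<lambda>x. prod_list (map x l))" by blast
  then show ?case by (intro exI[of _ "i # l"]) simp
qed

lemma concentratedD:
  assumes "concentrated \<Omega> \<alpha>"
  shows "prob_space \<alpha>" "sets \<alpha> = sets borel" "emeasure \<alpha> \<Omega> = 1"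
  using assms by (auto simp: concentrated_def)

lemma concentrated_AE:
  assumes "compact \<Omega>" "concentrated \<Omega> \<alpha>"
  shows "AE x in \<alpha>. x \<in> \<Omega>"
  using assms
  by (intro AE_in_full_measure) (auto simp: concentrated_def borel_closed compact_imp_closed)

lemma concentrated_integrable:
  fixes f :: "vec \<Rightarrow> real"
  assumes "compact \<Omega>" "concentrated \<Omega> \<alpha>" "continuous_on UNIV f"
  shows "integrable \<alpha> f"
proof -
  interpret prob_space \<alpha> using concentratedD(1)[OF assms(2)] .
  have "compact (f ` \<Omega>)"
    using assms by (intro compact_continuous_image) (auto intro: continuous_on_subset)
  then obtain B where "\<And>x. x \<in> \<Omega> \<Longrightarrow> norm (f x) \<le> B"
    using compact_imp_bounded[of "f ` \<Omega>"] by (auto simp: bounded_iff)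
  moreover have "f \<in> borel_measurable \<alpha>"
    using borel_measurable_continuous_onI[OF assms(3)] concentratedD(2)[OF assms(2)]
    by (simp cong: measurable_cong_sets)
  ultimately show ?thesis
    using concentrated_AE[OF assms(1,2)] by (intro integrable_const_bound[where B = B]) auto
qed

text \<open>With \<open>e = 0\<close> this says that an integral only depends on the values of the
  integrand on \<Omega>; unbounded integrands are exchanged for truncated ones in this way.\<close>

lemma concentrated_integral_diff_le:
  fixes f g :: "vec \<Rightarrow> real"
  assumes "compact \<Omega>" "concentrated \<Omega> \<alpha>" "continuous_on UNIV f" "continuous_on UNIV g"
    and le: "\<And>x. x \<in> \<Omega> \<Longrightarrow> \<bar>f x - g x\<bar> \<le> e"
  shows "\<bar>(\<integral>x. f x \<partial>\<alpha>) - (\<integral>x. g x \<partial>\<alpha>)\<bar> \<le> e"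
proof -
  interpret prob_space \<alpha> using concentratedD(1)[OF assms(2)] .
  have int: "integrable \<alpha> f" "integrable \<alpha> g"
    using assms by (auto intro: concentrated_integrable)
  have "\<bar>(\<integral>x. f x \<partial>\<alpha>) - (\<integral>x. g x \<partial>\<alpha>)\<bar> = \<bar>\<integral>x. f x - g x \<partial>\<alpha>\<bar>"
    using int by simp
  also have "\<dots> \<le> (\<integral>x. \<bar>f x - g x\<bar> \<partial>\<alpha>)"
    by (rule integral_abs_bound)
  also have "\<dots> \<le> (\<integral>x. e \<partial>\<alpha>)"
    using int concentrated_AE[OF assms(1,2)] le by (intro integral_mono_AE) auto
  finally show ?thesis by (simp add: prob_space)
qed

text \<open>The coordinates separate points, so a test function is within e/3 of a polynomial on
  \<Omega>, and integrals of polynomials are linear combinations of moments. The remaining two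
  thirds go to the limit of those integrals and to the limit measure.\<close>

lemma weakly_to_if_moments:
  assumes \<Omega>: "compact \<Omega>" and \<alpha>: "\<And>n. concentrated \<Omega> (\<alpha> n)" and \<beta>: "concentrated \<Omega> \<beta>"
    and mom: "\<And>l. (\<lambda>n. moment (\<alpha> n) l) \<longlonglongrightarrow> moment \<beta> l"
  shows "weakly_to \<alpha> \<beta>"
proof (intro allI impI)
  fix f :: "vec \<Rightarrow> real" assume f: "continuous_on UNIV f" "bounded (range f)"
  let ?\<Gamma> = "range (\<lambda>i (x :: vec). x i)"
  have \<Gamma>: "continuous_on S g" if "g \<in> ?\<Gamma>" for g S
    using that by (auto intro: continuous_on_subset[OF continuous_on_product_coordinates])
  have poly: "(\<lambda>n. \<integral>x. p x \<partial>\<alpha> n) \<longlonglongrightarrow> (\<integral>x. p x \<partial>\<beta>)" if "p \<in> polynomials ?\<Gamma>" for p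
    using that
  proof (induction rule: polynomials.induct)
    case (add p q a)
    obtain l where l: "p = (\<lambda>x. prod_list (map x l))"
      using coordinate_monomials[OF add.hyps(1)] by blast
    have "(\<integral>x. a * p x + q x \<partial>\<gamma>) = a * moment \<gamma> l + (\<integral>x. q x \<partial>\<gamma>)" if "concentrated \<Omega> \<gamma>" for \<gamma>
    proof -
      have "integrable \<gamma> p" "integrable \<gamma> q"
        using \<Gamma> continuous_on_monomials[OF add.hyps(1)] continuous_on_polynomials[OF add.hyps(2)]
        by (auto intro!: concentrated_integrable[OF \<Omega> that])
      then show ?thesis by (simp add: l moment_def)
    qed
    then show ?case
      using \<alpha> \<beta> by (auto intro!: tendsto_intros mom add.IH)
  qed simp
  show "(\<lambda>n. \<integral>x. f x \<partial>\<alpha> n) \<longlonglongrightarrow> (\<integral>x. f x \<partial>\<beta>)"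
  proof (rule LIMSEQ_I)
    fix e :: real assume "0 < e"
    obtain p where p: "p \<in> polynomials ?\<Gamma>" "\<And>x. x \<in> \<Omega> \<Longrightarrow> \<bar>f x - p x\<bar> < e / 3"
    proof (rule polynomials_uniformly_dense[OF \<Omega>, of ?\<Gamma> f "e / 3"])
      show "\<exists>g\<in>?\<Gamma>. g x \<noteq> g y" if "x \<noteq> y" for x y
        using that by auto
      show "continuous_on \<Omega> f" using f(1) by (auto intro: continuous_on_subset)
    qed (use \<Gamma> \<open>0 < e\<close> in auto)
    have close: "\<bar>(\<integral>x. f x \<partial>\<gamma>) - (\<integral>x. p x \<partial>\<gamma>)\<bar> \<le> e / 3" if "concentrated \<Omega> \<gamma>" for \<gamma>
      using \<Gamma> p(2) by (intro concentrated_integral_diff_le[OF \<Omega> that f(1)])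
        (auto intro!: continuous_on_polynomials[OF p(1)] less_imp_le)
    obtain N where N: "\<And>n. n \<ge> N \<Longrightarrow> norm ((\<integral>x. p x \<partial>\<alpha> n) - (\<integral>x. p x \<partial>\<beta>)) < e / 3"
      using LIMSEQ_D[OF poly[OF p(1)], of "e / 3"] \<open>0 < e\<close> by auto
    show "\<exists>no. \<forall>n\<ge>no. norm ((\<integral>x. f x \<partial>\<alpha> n) - (\<integral>x. f x \<partial>\<beta>)) < e"
    proof (intro exI allI impI)
      fix n assume "N \<le> n"
      then show "norm ((\<integral>x. f x \<partial>\<alpha> n) - (\<integral>x. f x \<partial>\<beta>)) < e"
        using N[of n] close[OF \<alpha>[of n]] close[OF \<beta>] unfolding real_norm_def by linarith
    qed
  qed
qed

definition moment_gens :: "(vec \<times> (nat list \<Rightarrow> real) \<Rightarrow> real) set" where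
  "moment_gens = range (\<lambda>i q. fst q i) \<union> range (\<lambda>l q. snd q l)"

text \<open>This set stands in for \<Omega> times the space of laws on \<Omega>. It lies in a
  metrizable product, so it suffices to extract a subsequence for the points and then one for the
  laws.\<close>

lemma compact_moment_set:
  assumes \<Omega>: "compact \<Omega>"
  shows "compact {(x, moment \<alpha>) | x \<alpha>. x \<in> \<Omega> \<and> concentrated \<Omega> \<alpha>}" (is "compact ?S")
  unfolding compact_eq_seq_compact_metric
proof (rule seq_compactI)
  fix q :: "nat \<Rightarrow> vec \<times> (nat list \<Rightarrow> real)" assume "\<forall>n. q n \<in> ?S"
  then have "\<forall>n. \<exists>x \<alpha>. q n = (x, moment \<alpha>) \<and> x \<in> \<Omega> \<and> concentrated \<Omega> \<alpha>" by blast
  then obtain x \<alpha> where q: "\<And>n. q n = (x n, moment (\<alpha> n))" "\<And>n. x n \<in> \<Omega>" "\<And>n. concentrated \<Omega> (\<alpha> n)"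
    by metis
  obtain r z where r: "strict_mono r" "z \<in> \<Omega>" "(x \<circ> r) \<longlonglongrightarrow> z"
    using \<Omega> q(2) unfolding compact_eq_seq_compact_metric seq_compact_def by metis
  obtain s \<beta> where s: "strict_mono (s :: nat \<Rightarrow> nat)" "concentrated \<Omega> \<beta>"
    and w: "\<And>f :: vec \<Rightarrow> real. continuous_on UNIV f \<Longrightarrow> bounded (range f) \<Longrightarrow>
       (\<lambda>n. \<integral>x. f x \<partial>\<alpha> (r (s n))) \<longlonglongrightarrow> (\<integral>x. f x \<partial>\<beta>)"
    using concentrated_weakly_convergent_subsequence[OF \<Omega>, of "\<lambda>n. \<alpha> (r n)"] q(3) by blast
  have "(\<lambda>n. moment (\<alpha> (r (s n))) l) \<longlonglongrightarrow> moment \<beta> l" for l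
  proof -
    have "compact ((\<lambda>x. prod_list (map x l)) ` \<Omega>)"
      by (intro compact_continuous_image \<Omega> continuous_on_prod_list_map)
    then obtain B where B: "\<And>x. x \<in> \<Omega> \<Longrightarrow> \<bar>prod_list (map x l)\<bar> \<le> B"
      using compact_imp_bounded by (fastforce simp: bounded_iff)
    \<comment> \<open>Weak convergence speaks of bounded test functions only, whereas a monomial is
      unbounded on the whole space. Clipping at its bound on \<Omega> changes no integral against a
      law on \<Omega>.\<close>
    let ?f = "\<lambda>x :: vec. max (- \<bar>B\<bar>) (min \<bar>B\<bar> (prod_list (map x l)))"
    have cont: "continuous_on UNIV ?f"
      by (intro continuous_on_max continuous_on_min continuous_on_const continuous_on_prod_list_map)
    have eq: "(\<integral>x. ?f x \<partial>\<gamma>) = moment \<gamma> l" if "concentrated \<Omega> \<gamma>" for \<gamma>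
    proof -
      have "\<bar>(\<integral>x. ?f x \<partial>\<gamma>) - (\<integral>x. prod_list (map x l) \<partial>\<gamma>)\<bar> \<le> 0"
      proof (rule concentrated_integral_diff_le[OF \<Omega> that cont continuous_on_prod_list_map])
        show "\<bar>?f x - prod_list (map x l)\<bar> \<le> 0" if "x \<in> \<Omega>" for x
          using B[OF that] by auto
      qed
      then show ?thesis by (simp add: moment_def)
    qed
    have "(\<lambda>n. \<integral>x. ?f x \<partial>\<alpha> (r (s n))) \<longlonglongrightarrow> (\<integral>x. ?f x \<partial>\<beta>)"
      by (rule w[OF cont]) (rule boundedI[of _ "\<bar>B\<bar>"], auto)
    then show ?thesis
      using eq[OF q(3)] eq[OF s(2)] by simp
  qed
  then have "(\<lambda>n. moment (\<alpha> (r (s n)))) \<longlonglongrightarrow> moment \<beta>"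
    by (simp add: tendsto_fun_iff)
  moreover have "(\<lambda>n. x (r (s n))) \<longlonglongrightarrow> z"
    using LIMSEQ_subseq_LIMSEQ[OF r(3) s(1)] by (simp add: o_def)
  ultimately have "(\<lambda>n. (x (r (s n)), moment (\<alpha> (r (s n))))) \<longlonglongrightarrow> (z, moment \<beta>)"
    by (intro tendsto_Pair)
  then have "(q \<circ> (r \<circ> s)) \<longlonglongrightarrow> (z, moment \<beta>)"
    by (simp add: o_def q(1))
  moreover have "(z, moment \<beta>) \<in> ?S"
    using r(2) s(2) by blast
  moreover have "strict_mono (r \<circ> s)"
    using r(1) s(1) by (rule strict_mono_o)
  ultimately show "\<exists>l\<in>?S. \<exists>r. strict_mono r \<and> (q \<circ> r) \<longlonglongrightarrow> l"
    by (intro bexI[of _ "(z, moment \<beta>)"] exI[of _ "r \<circ> s"] conjI)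
qed

lemma approx_by_moment_polynomial:
  fixes G :: "vec measure \<Rightarrow> vec \<Rightarrow> real"
  assumes \<Omega>: "compact \<Omega>"
    and G: "\<And>\<alpha> \<beta> x z. (\<And>n. concentrated \<Omega> (\<alpha> n)) \<Longrightarrow> concentrated \<Omega> \<beta> \<Longrightarrow> (\<And>n. x n \<in> \<Omega>) \<Longrightarrow> z \<in> \<Omega> \<Longrightarrow>
      weakly_to \<alpha> \<beta> \<Longrightarrow> x \<longlonglongrightarrow> z \<Longrightarrow> (\<lambda>n. G (\<alpha> n) (x n)) \<longlonglongrightarrow> G \<beta> z"
    and "0 < e"
  obtains p where "p \<in> polynomials moment_gens"
    "\<And>\<alpha> x. concentrated \<Omega> \<alpha> \<Longrightarrow> x \<in> \<Omega> \<Longrightarrow> \<bar>G \<alpha> x - p (x, moment \<alpha>)\<bar> < e"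
proof -
  let ?S = "{(x, moment \<alpha>) | x \<alpha>. x \<in> \<Omega> \<and> concentrated \<Omega> \<alpha>}"
  have lim: "(\<lambda>n. G (\<alpha> n) (x n)) \<longlonglongrightarrow> G \<beta> z"
    if "\<And>n. concentrated \<Omega> (\<alpha> n)" "concentrated \<Omega> \<beta>" "\<And>n. x n \<in> \<Omega>" "z \<in> \<Omega>"
      "\<And>l. (\<lambda>n. moment (\<alpha> n) l) \<longlonglongrightarrow> moment \<beta> l" "x \<longlonglongrightarrow> z" for \<alpha> \<beta> x z
    using that weakly_to_if_moments[OF \<Omega>, of \<alpha> \<beta>] by (intro G) auto
  \<comment> \<open>\<open>G\<close> is transported to the moment set through an arbitrary law with
    the given moments; the next step shows that the choice does not matter.\<close>
  define g where "g q = G (SOME \<alpha>. concentrated \<Omega> \<alpha> \<and> moment \<alpha> = snd q) (fst q)" for q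
  have g: "g (x, moment \<alpha>) = G \<alpha> x" if "concentrated \<Omega> \<alpha>" "x \<in> \<Omega>" for \<alpha> x
  proof -
    define \<beta> where "\<beta> = (SOME \<beta>. concentrated \<Omega> \<beta> \<and> moment \<beta> = moment \<alpha>)"
    have \<beta>: "concentrated \<Omega> \<beta> \<and> moment \<beta> = moment \<alpha>"
      unfolding \<beta>_def by (rule someI[of _ \<alpha>]) (use that in simp)
    \<comment> \<open>A constant sequence \<beta> with the moments of \<alpha> converges weakly to
      \<alpha>, so sequential continuity forces G \<beta> x = G \<alpha> x.\<close>
    have "(\<lambda>n :: nat. G \<beta> x) \<longlonglongrightarrow> G \<alpha> x"
      using that \<beta> by (intro lim) auto
    then show ?thesis
      by (simp add: g_def LIMSEQ_const_iff \<beta>_def)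
  qed
  have cont_g: "continuous_on ?S g"
    unfolding continuous_on_sequentially
  proof (intro ballI allI impI, elim conjE)
    fix q a assume a: "a \<in> ?S" and "\<forall>n. q n \<in> ?S" and qa: "q \<longlonglongrightarrow> a"
    then have "\<forall>n. \<exists>x \<alpha>. q n = (x, moment \<alpha>) \<and> x \<in> \<Omega> \<and> concentrated \<Omega> \<alpha>" by blast
    then obtain x \<alpha> where q: "\<And>n. q n = (x n, moment (\<alpha> n))" "\<And>n. x n \<in> \<Omega>" "\<And>n. concentrated \<Omega> (\<alpha> n)"
      by metis
    obtain z \<beta> where z: "a = (z, moment \<beta>)" "z \<in> \<Omega>" "concentrated \<Omega> \<beta>"
      using a by blast
    have "(\<lambda>n. moment (\<alpha> n)) \<longlonglongrightarrow> moment \<beta>" "x \<longlonglongrightarrow> z"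
      using tendsto_snd[OF qa] tendsto_fst[OF qa] by (auto simp: q(1) z(1))
    then have "(\<lambda>n. G (\<alpha> n) (x n)) \<longlonglongrightarrow> G \<beta> z"
      using q z by (intro lim) (auto simp: tendsto_fun_iff)
    then show "(g \<circ> q) \<longlonglongrightarrow> g a"
      using q z by (simp add: o_def g)
  qed
  have cont_h: "continuous_on ?S h" if "h \<in> moment_gens" for h
    using that unfolding moment_gens_def
    by (auto intro!: continuous_on_product_then_coordinatewise[OF continuous_on_fst[OF continuous_on_id]]
        continuous_on_product_then_coordinatewise[OF continuous_on_snd[OF continuous_on_id]])
  have sep: "\<exists>h\<in>moment_gens. h q \<noteq> h q'" if "q \<in> ?S" "q' \<in> ?S" "q \<noteq> q'" for q q'
  proof -
    consider i where "fst q i \<noteq> fst q' i" | l where "snd q l \<noteq> snd q' l"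
      using \<open>q \<noteq> q'\<close> by (auto simp: prod_eq_iff fun_eq_iff)
    then show ?thesis
    proof cases
      case 1
      then show ?thesis by (intro bexI[of _ "\<lambda>q. fst q i"]) (auto simp: moment_gens_def)
    next
      case 2
      then show ?thesis by (intro bexI[of _ "\<lambda>q. snd q l"]) (auto simp: moment_gens_def)
    qed
  qed
  obtain p where p: "p \<in> polynomials moment_gens" "\<And>q. q \<in> ?S \<Longrightarrow> \<bar>g q - p q\<bar> < e"
    using polynomials_uniformly_dense[OF compact_moment_set[OF \<Omega>] cont_h sep cont_g \<open>0 < e\<close>] by blast
  show ?thesis
  proof (rule that[OF p(1)])
    fix \<alpha> x assume "concentrated \<Omega> \<alpha>" "x \<in> \<Omega>"
    then have "(x, moment \<alpha>) \<in> ?S" "g (x, moment \<alpha>) = G \<alpha> x"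
      by (auto intro: g)
    then show "\<bar>G \<alpha> x - p (x, moment \<alpha>)\<bar> < e"
      using p(2)[of "(x, moment \<alpha>)"] by simp
  qed
qed

section \<open>Rigidity of causal identifiable maps\<close>

text \<open>Eventual membership holds for the subbasic sets by assumption and survives finite
  intersections and unions, hence an induction over the generated topology.\<close>

lemma limitin_weak_star:
  assumes "\<And>f :: vec \<times> real \<Rightarrow> real. continuous_on UNIV f \<Longrightarrow> bounded (range f) \<Longrightarrow>
      (\<lambda>n. \<integral>p. f p \<partial>M n) \<longlonglongrightarrow> (\<integral>p. f p \<partial>N)"
  shows "limitin weak_star M N sequentially"
  unfolding limitin_def
proof (intro conjI allI impI)
  let ?B = "{{M. (\<integral>p. f p \<partial>M) \<in> U} | (f :: vec \<times> real \<Rightarrow> real) U.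
    continuous_on UNIV f \<and> bounded (range f) \<and> open U}"
  \<comment> \<open>The topspace is the union of the subbase; the zero test function with the full
    line already contributes every measure.\<close>
  have "{M. (\<integral>p. (0::real) \<partial>(M :: pmeas)) \<in> UNIV} \<in> ?B"
    by (intro CollectI exI[of _ "\<lambda>p. 0::real"] exI[of _ "UNIV :: real set"] conjI) auto
  then have "UNIV \<in> ?B" by simp
  then show "N \<in> topspace weak_star"
    unfolding weak_star_def topology_generated_by_topspace by (intro UnionI[of UNIV]) auto
  fix U assume U: "openin weak_star U \<and> N \<in> U"
  then have "generate_topology_on ?B U"
    unfolding weak_star_def openin_topology_generated_by_iff by simp
  then have "N \<in> U \<longrightarrow> (\<forall>\<^sub>F n in sequentially. M n \<in> U)"
  proof induction
    case (Int a b)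
    then show ?case by (auto intro: eventually_conj)
  next
    case (UN K)
    show ?case
    proof
      assume "N \<in> \<Union>K"
      then obtain k where k: "k \<in> K" "N \<in> k" by blast
      then have "\<forall>\<^sub>F n in sequentially. M n \<in> k" using UN.IH by blast
      then show "\<forall>\<^sub>F n in sequentially. M n \<in> \<Union>K"
        by (rule eventually_mono) (use k(1) in blast)
    qed
  next
    case (Basis s)
    then have "\<exists>(f :: vec \<times> real \<Rightarrow> real) V. s = {M. (\<integral>p. f p \<partial>M) \<in> V} \<and>
        continuous_on UNIV f \<and> bounded (range f) \<and> open V"
      unfolding mem_Collect_eq .
    then obtain f :: "vec \<times> real \<Rightarrow> real" and V where fV: "s = {M. (\<integral>p. f p \<partial>M) \<in> V}"
      "continuous_on UNIV f" "bounded (range f)" "open V" by (elim exE conjE)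
    show ?case
      using topological_tendstoD[OF assms[OF fV(2,3)] fV(4)] by (simp add: fV(1))
  qed simp
  then show "\<forall>\<^sub>F n in sequentially. M n \<in> U" using U by blast
qed

text \<open>The sequential form in which continuity of \<Lambda> is used below. Convergence of the
  values is in the product topology, that is, coordinatewise.\<close>

lemma continuous_map_weak_star_tendsto:
  fixes \<Lambda> :: "pmeas \<Rightarrow> vec \<Rightarrow> real \<Rightarrow> vec"
  assumes "continuous_map (prod_topology (subtopology weak_star \<L>) (subtopology euclidean (\<Omega> \<times> {0..1})))
      euclidean (\<lambda>(M, (x, t)). \<Lambda> M x t)"
    and "\<And>n. M n \<in> \<L>" "N \<in> \<L>" "\<And>n. x n \<in> \<Omega>" "z \<in> \<Omega>" "\<And>n. t n \<in> {0..1}" "u \<in> {0..1}"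
    and lim: "\<And>f :: vec \<times> real \<Rightarrow> real. continuous_on UNIV f \<Longrightarrow> bounded (range f) \<Longrightarrow>
      (\<lambda>n. \<integral>p. f p \<partial>M n) \<longlonglongrightarrow> (\<integral>p. f p \<partial>N)"
    and "x \<longlonglongrightarrow> z" "t \<longlonglongrightarrow> u"
  shows "(\<lambda>n. \<Lambda> (M n) (x n) (t n)) \<longlonglongrightarrow> \<Lambda> N z u"
proof -
  have "limitin (subtopology weak_star \<L>) M N sequentially"
    using assms(2,3) limitin_weak_star[OF lim] by (simp add: limitin_subtopology)
  moreover have "limitin (subtopology euclidean (\<Omega> \<times> {0..1})) (\<lambda>n. (x n, t n)) (z, u) sequentially"
    using assms by (auto simp: limitin_subtopology intro!: tendsto_Pair)
  ultimately have "limitin (prod_topology (subtopology weak_star \<L>) (subtopology euclidean (\<Omega> \<times> {0..1})))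
      (\<lambda>n. (M n, (x n, t n))) (N, (z, u)) sequentially"
    by (simp add: limitin_pairwise o_def)
  from continuous_map_limit[OF assms(1) this] show ?thesis
    by (simp add: o_def)
qed

definition lip_kernel :: "nat \<Rightarrow> vec set \<Rightarrow> real \<Rightarrow> (real \<Rightarrow> vec measure) \<Rightarrow> bool" where
  "lip_kernel d \<Omega> C \<kappa> \<longleftrightarrow> (\<forall>s\<in>{0..1}. concentrated \<Omega> (\<kappa> s)) \<and>
     (\<forall>s\<in>{0..1}. \<forall>t\<in>{0..1}. W2sq d (\<kappa> s) (\<kappa> t) \<le> ennreal ((C * \<bar>s - t\<bar>)\<^sup>2))"

text \<open>Separates the conditions on the kernel alone from those on the time marginal, so that
  the marginal can be replaced while the kernel stays.\<close>

lemma LipCS_iff: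
  "M \<in> LipCS d \<Omega> C \<sigma> \<longleftrightarrow> prob_space M \<and> sets M = sets borel \<and> emeasure M (\<Omega> \<times> {0..1}) = 1 \<and>
     measure (tmarg M) {0} \<ge> \<sigma> \<and>
     (\<exists>\<kappa>. lip_kernel d \<Omega> C \<kappa> \<and> (\<forall>A\<in>sets borel. emeasure M A =
        (\<integral>\<^sup>+ s. emeasure (\<kappa> s) {x. (x, s) \<in> A} \<partial>(tmarg M))))"
  unfolding LipCS_def lip_kernel_def concentrated_def by auto

lemma continuous_on_sqdist:
  assumes "continuous_on S f" "continuous_on S g"
  shows "continuous_on S (\<lambda>p. sqdist d (f p) (g p))"
  unfolding sqdist_def
  by (intro continuous_on_sum continuous_on_power continuous_on_diff
      continuous_on_product_then_coordinatewise[OF assms(1)] continuous_on_product_then_coordinatewise[OF assms(2)])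

lemma sqdist_eq_0_Rn:
  assumes "x \<in> Rn d" "y \<in> Rn d" "sqdist d x y = 0"
  shows "x = y"
proof
  fix i
  show "x i = y i"
  proof (cases "i < d")
    case True
    then have "(x i - y i)\<^sup>2 = 0"
      using assms(3) by (simp add: sqdist_def sum_nonneg_eq_0_iff)
    then show ?thesis by simp
  qed (use assms in \<open>simp add: Rn_def\<close>)
qed

lemma sqdist_nonneg: "0 \<le> sqdist d x y"
  by (simp add: sqdist_def sum_nonneg)

text \<open>A bound on \<open>W2sq\<close> controls an expected squared distance and nothing
  pointwise, so uniform continuity is recast as a bound linear in the squared distance. Where f
  varies by at least e, a compact set, the squared distance has a positive minimum \<delta>; K is
  then the maximal variation divided by \<delta>. Inclusion in \<open>Rn d\<close> makes
  \<open>sqdist d\<close> separate the points of \<Omega>.\<close>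

lemma quadratic_modulus:
  fixes f :: "vec \<times> real \<Rightarrow> real"
  assumes \<Omega>: "compact \<Omega>" "\<Omega> \<subseteq> Rn d" and f: "continuous_on UNIV f" and "0 < e"
  obtains K where "0 \<le> K" "\<And>x y s t. x \<in> \<Omega> \<Longrightarrow> y \<in> \<Omega> \<Longrightarrow> s \<in> {0..1} \<Longrightarrow> t \<in> {0..1} \<Longrightarrow>
    \<bar>f (x, s) - f (y, t)\<bar> \<le> e + K * (sqdist d x y + (s - t)\<^sup>2)"
proof -
  let ?Q = "(\<Omega> \<times> {0..1::real}) \<times> (\<Omega> \<times> {0..1::real})"
  define g where "g q = sqdist d (fst (fst q)) (fst (snd q)) + (snd (fst q) - snd (snd q))\<^sup>2"
    for q :: "(vec \<times> real) \<times> (vec \<times> real)"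
  define h where "h q = \<bar>f (fst q) - f (snd q)\<bar>" for q
  have Q: "compact ?Q"
    using \<Omega>(1) by (intro compact_Times) auto
  have h: "continuous_on UNIV h"
    unfolding h_def
    by (intro continuous_on_rabs continuous_on_diff continuous_on_compose2[OF f] continuous_on_fst
        continuous_on_snd continuous_on_id) auto
  have g: "continuous_on UNIV g"
    unfolding g_def by (intro continuous_on_add continuous_on_power continuous_on_diff continuous_on_sqdist
        continuous_on_fst continuous_on_snd continuous_on_id)
  obtain B where B: "\<And>q. q \<in> ?Q \<Longrightarrow> h q \<le> B"
  proof -
    have "bounded (h ` ?Q)"
      by (intro compact_imp_bounded compact_continuous_image Q continuous_on_subset[OF h]) auto
    then obtain B where "\<forall>q\<in>?Q. \<bar>h q\<bar> \<le> B"
      by (auto simp: bounded_iff)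
    then show ?thesis by (intro that[of B]) (meson abs_le_D1)
  qed
  define A where "A = ?Q \<inter> {q. e \<le> h q}"
  have A: "compact A"
    unfolding A_def by (intro compact_Int_closed Q closed_Collect_le continuous_on_const h)
  have g_nonneg: "0 \<le> g q" for q
    by (simp add: g_def sqdist_nonneg)
  have g_pos: "0 < g q" if "q \<in> A" for q
  proof (rule ccontr)
    assume "\<not> 0 < g q"
    then have "g q = 0" using g_nonneg[of q] by linarith
    then have "sqdist d (fst (fst q)) (fst (snd q)) = 0" "snd (fst q) = snd (snd q)"
      by (auto simp: g_def add_nonneg_eq_0_iff sqdist_nonneg)
    then have "fst q = snd q"
      using that \<Omega>(2) sqdist_eq_0_Rn[of "fst (fst q)" d "fst (snd q)"]
      by (auto simp: A_def subset_iff intro!: prod_eqI)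
    then show False
      using that \<open>0 < e\<close> by (simp add: A_def h_def)
  qed
  obtain \<delta> where \<delta>: "0 < \<delta>" "\<And>q. q \<in> A \<Longrightarrow> \<delta> \<le> g q"
  proof (cases "A = {}")
    case False
    obtain q where "q \<in> A" "\<forall>q'\<in>A. g q \<le> g q'"
      using continuous_attains_inf[OF A False continuous_on_subset[OF g]] by blast
    then show ?thesis using that g_pos by blast
  qed (use that[of 1] in auto)
  show ?thesis
  proof (rule that[of "\<bar>B\<bar> / \<delta>"])
    show "0 \<le> \<bar>B\<bar> / \<delta>" using \<delta>(1) by simp
    fix x y s t assume "x \<in> \<Omega>" "y \<in> \<Omega>" "s \<in> {0..1::real}" "t \<in> {0..1::real}"
    then have q: "((x, s), (y, t)) \<in> ?Q" by simp
    have "h ((x, s), (y, t)) \<le> e + \<bar>B\<bar> / \<delta> * g ((x, s), (y, t))"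
    proof (cases "((x, s), (y, t)) \<in> A")
      case True
      have "h ((x, s), (y, t)) \<le> \<bar>B\<bar>"
        using B[OF q] by linarith
      also have "\<bar>B\<bar> = \<bar>B\<bar> / \<delta> * \<delta>" using \<delta>(1) by simp
      also have "\<dots> \<le> \<bar>B\<bar> / \<delta> * g ((x, s), (y, t))"
        using \<delta> True by (intro mult_left_mono) auto
      finally show ?thesis using \<open>0 < e\<close> by linarith
    next
      case False
      then have "h ((x, s), (y, t)) < e" using q by (simp add: A_def)
      moreover have "0 \<le> \<bar>B\<bar> / \<delta> * g ((x, s), (y, t))"
        using \<delta>(1) g_nonneg by simp
      ultimately show ?thesis by linarith
    qed
    then show "\<bar>f (x, s) - f (y, t)\<bar> \<le> e + \<bar>B\<bar> / \<delta> * (sqdist d x y + (s - t)\<^sup>2)"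
      by (simp add: h_def g_def)
  qed
qed

text \<open>The modulus is integrated against a nearly optimal coupling of the two kernel
  values.\<close>

lemma kernel_integral_diff_le:
  fixes f :: "vec \<times> real \<Rightarrow> real"
  assumes \<Omega>: "compact \<Omega>" and \<kappa>: "lip_kernel d \<Omega> C \<kappa>" and f: "continuous_on UNIV f"
    and st: "s \<in> {0..1}" "t \<in> {0..1}" "s \<noteq> t" and "0 \<le> K"
    and mod: "\<And>x y. x \<in> \<Omega> \<Longrightarrow> y \<in> \<Omega> \<Longrightarrow> \<bar>f (x, s) - f (y, t)\<bar> \<le> e + K * (sqdist d x y + (s - t)\<^sup>2)"
  shows "\<bar>(\<integral>x. f (x, s) \<partial>\<kappa> s) - (\<integral>x. f (x, t) \<partial>\<kappa> t)\<bar> \<le> e + K * ((C\<^sup>2 + 2) * (s - t)\<^sup>2)"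
proof -
  have conc: "concentrated \<Omega> (\<kappa> s)" "concentrated \<Omega> (\<kappa> t)"
    using \<kappa> st by (auto simp: lip_kernel_def)
  have "W2sq d (\<kappa> s) (\<kappa> t) \<le> ennreal ((C * \<bar>s - t\<bar>)\<^sup>2)"
    using \<kappa> st by (auto simp: lip_kernel_def)
  \<comment> \<open>The infimum over couplings need not be attained. Raising C^2 to C^2 + 1 leaves
    strict room because s \<noteq> t; the time term then accounts for the final C^2 + 2.\<close>
  also have "\<dots> < ennreal ((C\<^sup>2 + 1) * (s - t)\<^sup>2)"
    using st(3) by (subst ennreal_less_iff) (auto simp: power_mult_distrib algebra_simps)
  finally obtain \<pi> where \<pi>: "\<pi> \<in> couplings (\<kappa> s) (\<kappa> t)"
    and lt: "(\<integral>\<^sup>+ p. ennreal (sqdist d (fst p) (snd p)) \<partial>\<pi>) < ennreal ((C\<^sup>2 + 1) * (s - t)\<^sup>2)"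
    unfolding W2sq_def by (auto simp: INF_less_iff)
  have sets[measurable_cong]: "sets \<pi> = sets borel" and prob: "prob_space \<pi>"
    and marg: "distr \<pi> borel fst = \<kappa> s" "distr \<pi> borel snd = \<kappa> t"
    using \<pi> unfolding couplings_def by blast+
  interpret prob_space \<pi> by fact
  have [measurable]: "(fst :: vec \<times> vec \<Rightarrow> vec) \<in> borel_measurable borel" "(snd :: vec \<times> vec \<Rightarrow> vec) \<in> borel_measurable borel"
    by (intro borel_measurable_continuous_onI continuous_on_fst continuous_on_snd continuous_on_id)+
  have [measurable]: "\<Omega> \<in> sets borel"
    using \<Omega> by (simp add: borel_closed compact_imp_closed)
  have "AE x in distr \<pi> borel fst. x \<in> \<Omega>"
    unfolding marg by (rule concentrated_AE[OF \<Omega> conc(1)])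
  then have AE1: "AE p in \<pi>. fst p \<in> \<Omega>"
    by (subst (asm) AE_distr_iff) auto
  have "AE x in distr \<pi> borel snd. x \<in> \<Omega>"
    unfolding marg by (rule concentrated_AE[OF \<Omega> conc(2)])
  then have AE2: "AE p in \<pi>. snd p \<in> \<Omega>"
    by (subst (asm) AE_distr_iff) auto
  have fs: "continuous_on UNIV (\<lambda>x. f (x, r))" for r
    by (intro continuous_on_compose2[OF f] continuous_on_Pair continuous_on_id continuous_on_const) auto
  have [measurable]: "(\<lambda>x. f (x, r)) \<in> borel_measurable borel" for r
    by (rule borel_measurable_continuous_onI[OF fs])
  have int1: "integrable \<pi> (\<lambda>p. f (fst p, s))"
    using concentrated_integrable[OF \<Omega> conc(1) fs] unfolding marg(1)[symmetric]
    by (subst (asm) integrable_distr_eq) auto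
  have int2: "integrable \<pi> (\<lambda>p. f (snd p, t))"
    using concentrated_integrable[OF \<Omega> conc(2) fs] unfolding marg(2)[symmetric]
    by (subst (asm) integrable_distr_eq) auto
  have [measurable]: "(\<lambda>p :: vec \<times> vec. sqdist d (fst p) (snd p)) \<in> borel_measurable borel"
    by (intro borel_measurable_continuous_onI continuous_on_sqdist continuous_on_fst continuous_on_snd continuous_on_id)
  have int3: "integrable \<pi> (\<lambda>p. sqdist d (fst p) (snd p))"
    using lt by (intro integrableI_nonneg) (auto simp: sqdist_nonneg intro: less_trans)
  have "ennreal (\<integral>p. sqdist d (fst p) (snd p) \<partial>\<pi>) < ennreal ((C\<^sup>2 + 1) * (s - t)\<^sup>2)"
    using lt int3 by (subst (asm) nn_integral_eq_integral) (auto simp: sqdist_nonneg)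
  then have le3: "(\<integral>p. sqdist d (fst p) (snd p) \<partial>\<pi>) \<le> (C\<^sup>2 + 1) * (s - t)\<^sup>2"
    by (subst (asm) ennreal_less_iff) (auto simp: sqdist_nonneg)
  have "(\<integral>x. f (x, s) \<partial>\<kappa> s) = (\<integral>p. f (fst p, s) \<partial>\<pi>)" "(\<integral>x. f (x, t) \<partial>\<kappa> t) = (\<integral>p. f (snd p, t) \<partial>\<pi>)"
    unfolding marg[symmetric] by (simp_all add: integral_distr)
  then have "\<bar>(\<integral>x. f (x, s) \<partial>\<kappa> s) - (\<integral>x. f (x, t) \<partial>\<kappa> t)\<bar> = \<bar>\<integral>p. f (fst p, s) - f (snd p, t) \<partial>\<pi>\<bar>"
    using int1 int2 by simp
  also have "\<dots> \<le> (\<integral>p. \<bar>f (fst p, s) - f (snd p, t)\<bar> \<partial>\<pi>)"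
    by (rule integral_abs_bound)
  also have "\<dots> \<le> (\<integral>p. e + K * (sqdist d (fst p) (snd p) + (s - t)\<^sup>2) \<partial>\<pi>)"
  proof (rule integral_mono_AE)
    show "AE p in \<pi>. \<bar>f (fst p, s) - f (snd p, t)\<bar> \<le> e + K * (sqdist d (fst p) (snd p) + (s - t)\<^sup>2)"
      using AE1 AE2 by eventually_elim (rule mod)
  qed (use int1 int2 int3 in auto)
  also have "\<dots> = e + K * ((\<integral>p. sqdist d (fst p) (snd p) \<partial>\<pi>) + (s - t)\<^sup>2)"
    using int3 by (simp add: prob_space)
  also have "\<dots> \<le> e + K * ((C\<^sup>2 + 2) * (s - t)\<^sup>2)"
    using le3 \<open>0 \<le> K\<close> by (intro add_left_mono mult_left_mono) (auto simp: algebra_simps)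
  finally show ?thesis .
qed

lemma continuous_on_kernel_integral:
  fixes f :: "vec \<times> real \<Rightarrow> real"
  assumes \<Omega>: "compact \<Omega>" "\<Omega> \<subseteq> Rn d" and \<kappa>: "lip_kernel d \<Omega> C \<kappa>" and f: "continuous_on UNIV f"
  shows "continuous_on {0..1} (\<lambda>s. \<integral>x. f (x, s) \<partial>\<kappa> s)" (is "continuous_on _ ?\<phi>")
  unfolding continuous_on_iff
proof (intro ballI allI impI)
  fix s and e :: real assume s: "s \<in> {0..1::real}" and "0 < e"
  obtain K where K: "0 \<le> K" "\<And>x y s t. x \<in> \<Omega> \<Longrightarrow> y \<in> \<Omega> \<Longrightarrow> s \<in> {0..1} \<Longrightarrow> t \<in> {0..1} \<Longrightarrow>
    \<bar>f (x, s) - f (y, t)\<bar> \<le> e / 2 + K * (sqdist d x y + (s - t)\<^sup>2)"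
    using quadratic_modulus[OF \<Omega> f, of "e / 2"] \<open>0 < e\<close> by auto
  define L where "L = K * (C\<^sup>2 + 2) + 1"
  have "0 < L" using K(1) by (auto simp: L_def intro!: add_nonneg_pos)
  \<comment> \<open>The bound 1 gives (t - s)^2 \<le> |t - s|; the other bound makes L |t - s|
    smaller than e/2.\<close>
  define \<delta> where "\<delta> = min 1 (e / (2 * L))"
  have "0 < \<delta>" using \<open>0 < e\<close> \<open>0 < L\<close> by (simp add: \<delta>_def)
  moreover have "dist (?\<phi> t) (?\<phi> s) < e" if t: "t \<in> {0..1}" "dist t s < \<delta>" for t
  proof (cases "t = s")
    case False
    have "\<bar>?\<phi> t - ?\<phi> s\<bar> \<le> e / 2 + K * ((C\<^sup>2 + 2) * (t - s)\<^sup>2)"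
      using K t s False by (intro kernel_integral_diff_le[OF \<Omega>(1) \<kappa> f]) auto
    also have "K * ((C\<^sup>2 + 2) * (t - s)\<^sup>2) \<le> L * (t - s)\<^sup>2"
      by (simp add: L_def algebra_simps)
    also have "\<dots> \<le> L * \<bar>t - s\<bar>"
    proof (intro mult_left_mono)
      have "\<bar>t - s\<bar> * \<bar>t - s\<bar> \<le> \<bar>t - s\<bar> * 1"
        using t(2) by (intro mult_left_mono) (auto simp: \<delta>_def dist_real_def)
      then show "(t - s)\<^sup>2 \<le> \<bar>t - s\<bar>" by (simp add: power2_eq_square)
    qed (use \<open>0 < L\<close> in simp)
    also have "\<dots> < L * (e / (2 * L))"
      using t(2) \<open>0 < L\<close> by (intro mult_strict_left_mono) (auto simp: \<delta>_def dist_real_def)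
    also have "\<dots> = e / 2" using \<open>0 < L\<close> by simp
    finally show ?thesis by (simp add: dist_real_def)
  qed (use \<open>0 < e\<close> in simp)
  ultimately show "\<exists>\<delta>>0. \<forall>t\<in>{0..1}. dist t s < \<delta> \<longrightarrow> dist (?\<phi> t) (?\<phi> s) < e" by blast
qed

section \<open>Members of the class as mixtures over time\<close>

definition clamp01 :: "real \<Rightarrow> real" where
  "clamp01 s = max 0 (min 1 s)"

lemma clamp01_range [simp]: "clamp01 s \<in> {0..1}" "0 \<le> clamp01 s" "clamp01 s \<le> 1"
  by (auto simp: clamp01_def)

lemma clamp01_id: "s \<in> {0..1} \<Longrightarrow> clamp01 s = s"
  by (auto simp: clamp01_def)

lemma continuous_on_clamp01: "continuous_on S clamp01"
  unfolding clamp01_def by (intro continuous_intros)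

lemma measurable_clamp01 [measurable]: "clamp01 \<in> borel_measurable borel"
  by (rule borel_measurable_continuous_onI[OF continuous_on_clamp01])

lemma measurable_fst_vec [measurable]: "(fst :: vec \<times> real \<Rightarrow> vec) \<in> borel_measurable borel"
  by (intro borel_measurable_continuous_onI continuous_on_fst continuous_on_id)

lemma measurable_snd_vec [measurable]: "(snd :: vec \<times> real \<Rightarrow> real) \<in> borel_measurable borel"
  by (intro borel_measurable_continuous_onI continuous_on_snd continuous_on_id)

lemma continuous_on_at_time: "continuous_on S (\<lambda>x :: vec. (x, s :: real))"
  by (intro continuous_on_Pair continuous_on_id continuous_on_const)

lemma measurable_at_time [measurable]: "(\<lambda>x :: vec. (x, s :: real)) \<in> borel_measurable borel"
  by (rule borel_measurable_continuous_onI[OF continuous_on_at_time])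

text \<open>Attaches the time stamp to the law at that time. Nothing is known about \<kappa> outside
  [0, 1], so clamping turns it into a Markov kernel on the whole line, as the Giry monad operations
  expect.\<close>

definition time_kernel :: "(real \<Rightarrow> vec measure) \<Rightarrow> real \<Rightarrow> pmeas" where
  "time_kernel \<kappa> s = distr (\<kappa> (clamp01 s)) borel (\<lambda>x. (x, clamp01 s))"

lemma lip_kernel_clamp:
  assumes "lip_kernel d \<Omega> C \<kappa>"
  shows "concentrated \<Omega> (\<kappa> (clamp01 s))" "prob_space (\<kappa> (clamp01 s))" "sets (\<kappa> (clamp01 s)) = sets borel"
    "space (\<kappa> (clamp01 s)) = UNIV"
proof -
  show c: "concentrated \<Omega> (\<kappa> (clamp01 s))"
    using assms by (simp add: lip_kernel_def)
  show "prob_space (\<kappa> (clamp01 s))" and s: "sets (\<kappa> (clamp01 s)) = sets borel"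
    using concentratedD[OF c] by auto
  show "space (\<kappa> (clamp01 s)) = UNIV"
    using sets_eq_imp_space_eq[OF s] by simp
qed

lemma prob_space_time_kernel:
  assumes "lip_kernel d \<Omega> C \<kappa>"
  shows "prob_space (time_kernel \<kappa> s)"
  unfolding time_kernel_def
  by (rule prob_space.prob_space_distr[OF lip_kernel_clamp(2)[OF assms]])
     (simp add: measurable_cong_sets[OF lip_kernel_clamp(3)[OF assms] refl])

lemma sets_time_kernel [simp, measurable_cong]: "sets (time_kernel \<kappa> s) = sets borel"
  by (simp add: time_kernel_def)

lemma emeasure_time_kernel:
  assumes "lip_kernel d \<Omega> C \<kappa>" "A \<in> sets borel"
  shows "emeasure (time_kernel \<kappa> s) A = emeasure (\<kappa> (clamp01 s)) {x. (x, clamp01 s) \<in> A}"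
  unfolding time_kernel_def using assms(2)
  by (subst emeasure_distr)
     (simp_all add: measurable_cong_sets[OF lip_kernel_clamp(3)[OF assms(1)] refl] lip_kernel_clamp(4)[OF assms(1)] vimage_def)

lemma integral_time_kernel:
  fixes f :: "vec \<times> real \<Rightarrow> real"
  assumes "lip_kernel d \<Omega> C \<kappa>" "f \<in> borel_measurable borel"
  shows "(\<integral>p. f p \<partial>time_kernel \<kappa> s) = (\<integral>x. f (x, clamp01 s) \<partial>\<kappa> (clamp01 s))"
  unfolding time_kernel_def using assms(2)
  by (subst integral_distr) (simp_all add: measurable_cong_sets[OF lip_kernel_clamp(3)[OF assms(1)] refl])

lemma continuous_on_integral_time_kernel:
  fixes f :: "vec \<times> real \<Rightarrow> real"
  assumes \<Omega>: "compact \<Omega>" "\<Omega> \<subseteq> Rn d" and \<kappa>: "lip_kernel d \<Omega> C \<kappa>" and f: "continuous_on UNIV f"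
  shows "continuous_on UNIV (\<lambda>s. \<integral>p. f p \<partial>time_kernel \<kappa> s)"
  unfolding integral_time_kernel[OF \<kappa> borel_measurable_continuous_onI[OF f]]
  by (rule continuous_on_compose2[OF continuous_on_kernel_integral[OF \<Omega> \<kappa> f] continuous_on_clamp01]) auto

text \<open>Measurability of \<kappa> is not part of \<open>LipCS\<close>; it comes from the
  continuity of s \<mapsto> \<integral> f d(\<open>time_kernel\<close> \<kappa> s) for continuous f,
  because the indicator of an open set is a pointwise limit of such f and open sets
  generate.\<close>

lemma measurable_time_kernel:
  assumes \<Omega>: "compact \<Omega>" "\<Omega> \<subseteq> Rn d" and \<kappa>: "lip_kernel d \<Omega> C \<kappa>"
  shows "time_kernel \<kappa> \<in> borel \<rightarrow>\<^sub>M prob_algebra borel"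
proof (rule measurable_prob_algebra_generated[OF sets_borel])
  show "Int_stable {S :: (vec \<times> real) set. open S}"
    by (auto simp: Int_stable_def)
  show "prob_space (time_kernel \<kappa> s)" for s
    by (rule prob_space_time_kernel[OF \<kappa>])
  fix U :: "(vec \<times> real) set" assume "U \<in> {S. open S}"
  then have U: "open U" by simp
  interpret J: prob_space "time_kernel \<kappa> s" for s
    by (rule prob_space_time_kernel[OF \<kappa>])
  show "(\<lambda>s. emeasure (time_kernel \<kappa> s) U) \<in> borel_measurable borel"
  \<comment> \<open>The full space is treated apart: its complement is empty, where
    \<open>infdist\<close> has the default value 0 and would spoil the approximation.\<close>
  proof (cases "U = UNIV")
    case True
    have "emeasure (time_kernel \<kappa> s) U = 1" for s
      using J.emeasure_space_1[of s] sets_eq_imp_space_eq[OF sets_time_kernel[of \<kappa> s]] by (simp add: True)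
    then show ?thesis by simp
  next
    case False
    define f where "f n z = min 1 (real n * infdist z (- U))" for n and z :: "vec \<times> real"
    have f_cont: "continuous_on UNIV (f n)" for n
      unfolding f_def by (intro continuous_on_min continuous_on_const continuous_on_mult
          continuous_on_infdist continuous_on_id)
    have [measurable]: "f n \<in> borel_measurable borel" for n
      by (rule borel_measurable_continuous_onI[OF f_cont])
    have [measurable]: "U \<in> sets borel" using U by simp
    have f_lim: "(\<lambda>n. f n z) \<longlonglongrightarrow> indicator U z" for z
    proof (cases "z \<in> U")
      case True
      then have "infdist z (- U) \<noteq> 0"
        using in_closed_iff_infdist_zero[of "- U" z] U False by auto
      then have pos: "0 < infdist z (- U)"
        using infdist_nonneg[of z "- U"] by linarith
      obtain N where N: "1 < real N * infdist z (- U)"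
        using reals_Archimedean3[OF pos] by blast
      have "f n z = 1" if "N \<le> n" for n
      proof -
        have "real N * infdist z (- U) \<le> real n * infdist z (- U)"
          using that pos by (intro mult_right_mono) auto
        then show ?thesis using N by (simp add: f_def)
      qed
      then have "\<forall>\<^sub>F n in sequentially. f n z = 1"
        unfolding eventually_sequentially by blast
      then show ?thesis using True by (simp add: tendsto_eventually)
    next
      case False
      then have "infdist z (- U) = 0" by simp
      then show ?thesis using False by (simp add: f_def)
    qed
    have f_bound: "\<bar>f n z\<bar> \<le> 1" for n z
      by (auto simp: f_def infdist_nonneg)
    have "(\<lambda>n. \<integral>z. f n z \<partial>time_kernel \<kappa> s) \<longlonglongrightarrow> (\<integral>z. indicator U z \<partial>time_kernel \<kappa> s)" for s
      by (rule integral_dominated_convergence[where w = "\<lambda>_. 1"]) (use f_lim f_bound in auto)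
    moreover have "(\<integral>z. indicator U z \<partial>time_kernel \<kappa> s) = measure (time_kernel \<kappa> s) U" for s
      using sets_eq_imp_space_eq[OF sets_time_kernel[of \<kappa> s]] by simp
    moreover have "(\<lambda>s. \<integral>z. f n z \<partial>time_kernel \<kappa> s) \<in> borel_measurable borel" for n
      by (rule borel_measurable_continuous_onI[OF continuous_on_integral_time_kernel[OF \<Omega> \<kappa> f_cont]])
    ultimately have "(\<lambda>s. measure (time_kernel \<kappa> s) U) \<in> borel_measurable borel"
      using borel_measurable_LIMSEQ_real[of borel "\<lambda>n s. \<integral>z. f n z \<partial>time_kernel \<kappa> s"
          "\<lambda>s. measure (time_kernel \<kappa> s) U"] by simp
    then show ?thesis
      by (simp add: J.emeasure_eq_measure)
  qed
qed auto

definition time_law :: "real \<Rightarrow> real measure \<Rightarrow> bool" where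
  "time_law \<sigma> \<tau> \<longleftrightarrow> prob_space \<tau> \<and> sets \<tau> = sets borel \<and> (AE s in \<tau>. s \<in> {0..1}) \<and> \<sigma> \<le> measure \<tau> {0}"

lemma tmarg_bind_time_kernel:
  assumes \<Omega>: "compact \<Omega>" "\<Omega> \<subseteq> Rn d" and \<kappa>: "lip_kernel d \<Omega> C \<kappa>" and \<tau>: "time_law \<sigma> \<tau>"
  shows "tmarg (\<tau> \<bind> time_kernel \<kappa>) = \<tau>"
proof -
  have prob: "prob_space \<tau>" and sets[measurable_cong]: "sets \<tau> = sets borel" and AE: "AE s in \<tau>. s \<in> {0..1}"
    using \<tau> by (auto simp: time_law_def)
  have ne: "space \<tau> \<noteq> {}" by (rule prob_space.not_empty[OF prob])
  have J: "time_kernel \<kappa> \<in> \<tau> \<rightarrow>\<^sub>M subprob_algebra borel"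
    using measurable_prob_algebraD[OF measurable_time_kernel[OF \<Omega> \<kappa>]]
    by (simp add: measurable_cong_sets[OF sets refl])
  have "distr (time_kernel \<kappa> s) borel snd = return borel (clamp01 s)" for s
  proof -
    have "distr (time_kernel \<kappa> s) borel snd = distr (\<kappa> (clamp01 s)) borel (\<lambda>x. clamp01 s)"
      unfolding time_kernel_def
      by (subst distr_distr) (auto simp: o_def measurable_cong_sets[OF lip_kernel_clamp(3)[OF \<kappa>] refl])
    also have "\<dots> = return borel (clamp01 s)"
      by (rule prob_space.distr_const[OF lip_kernel_clamp(2)[OF \<kappa>]]) simp
    finally show ?thesis .
  qed
  then have "tmarg (\<tau> \<bind> time_kernel \<kappa>) = \<tau> \<bind> (\<lambda>s. return borel (clamp01 s))"
    unfolding tmarg_def by (subst distr_bind[OF J ne]) auto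
  also have "\<dots> = distr \<tau> borel clamp01"
    by (rule bind_return_distr'[OF ne]) measurable
  also have "\<dots> = distr \<tau> borel (\<lambda>s. s)"
    by (rule distr_cong_AE) (use AE in \<open>auto simp: clamp01_id\<close>)
  also have "\<dots> = \<tau>"
    by (rule distr_id2[OF sets[symmetric]])
  finally show ?thesis .
qed

lemma emeasure_bind_time_kernel:
  assumes \<Omega>: "compact \<Omega>" "\<Omega> \<subseteq> Rn d" and \<kappa>: "lip_kernel d \<Omega> C \<kappa>" and \<tau>: "time_law \<sigma> \<tau>"
    and A: "A \<in> sets borel"
  shows "emeasure (\<tau> \<bind> time_kernel \<kappa>) A = (\<integral>\<^sup>+ s. emeasure (\<kappa> s) {x. (x, s) \<in> A} \<partial>\<tau>)"
proof -
  have "\<tau> \<in> space (prob_algebra borel)"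
    using \<tau> by (simp add: time_law_def space_prob_algebra)
  then have "emeasure (\<tau> \<bind> time_kernel \<kappa>) A = (\<integral>\<^sup>+ s. emeasure (time_kernel \<kappa> s) A \<partial>\<tau>)"
    by (rule emeasure_bind_prob_algebra[OF _ measurable_time_kernel[OF \<Omega> \<kappa>] A])
  also have "\<dots> = (\<integral>\<^sup>+ s. emeasure (\<kappa> s) {x. (x, s) \<in> A} \<partial>\<tau>)"
  proof (rule nn_integral_cong_AE)
    have "AE s in \<tau>. s \<in> {0..1}"
      using \<tau> by (simp add: time_law_def)
    then show "AE s in \<tau>. emeasure (time_kernel \<kappa> s) A = emeasure (\<kappa> s) {x. (x, s) \<in> A}"
      by eventually_elim (simp add: emeasure_time_kernel[OF \<kappa> A] clamp01_id)
  qed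
  finally show ?thesis .
qed

text \<open>The source of all test measures: a fixed kernel may be mixed with any admissible time
  law without leaving the class.\<close>

lemma bind_time_kernel_LipCS:
  assumes \<Omega>: "compact \<Omega>" "\<Omega> \<subseteq> Rn d" and \<kappa>: "lip_kernel d \<Omega> C \<kappa>" and \<tau>: "time_law \<sigma> \<tau>"
  shows "\<tau> \<bind> time_kernel \<kappa> \<in> LipCS d \<Omega> C \<sigma>"
  unfolding LipCS_iff tmarg_bind_time_kernel[OF assms]
proof (intro conjI exI[of _ \<kappa>] ballI)
  have \<tau>': "\<tau> \<in> space (prob_algebra borel)"
    using \<tau> by (simp add: time_law_def space_prob_algebra)
  show "prob_space (\<tau> \<bind> time_kernel \<kappa>)" "sets (\<tau> \<bind> time_kernel \<kappa>) = sets borel"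
    using prob_space_bind'[OF \<tau>' measurable_time_kernel[OF \<Omega> \<kappa>]] sets_bind'[OF \<tau>' measurable_time_kernel[OF \<Omega> \<kappa>]] by auto
  have "closed (\<Omega> \<times> {0..1::real})"
    using \<Omega>(1) by (intro closed_Times compact_imp_closed) auto
  then have [measurable]: "\<Omega> \<times> {0..1::real} \<in> sets borel" by (rule borel_closed)
  have "emeasure (\<tau> \<bind> time_kernel \<kappa>) (\<Omega> \<times> {0..1}) = (\<integral>\<^sup>+ s. emeasure (\<kappa> s) {x. (x, s) \<in> \<Omega> \<times> {0..1}} \<partial>\<tau>)"
    by (rule emeasure_bind_time_kernel[OF \<Omega> \<kappa> \<tau>]) measurable
  also have "\<dots> = (\<integral>\<^sup>+ s. 1 \<partial>\<tau>)"
  proof (rule nn_integral_cong_AE)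
    have "AE s in \<tau>. s \<in> {0..1}"
      using \<tau> by (simp add: time_law_def)
    then show "AE s in \<tau>. emeasure (\<kappa> s) {x. (x, s) \<in> \<Omega> \<times> {0..1}} = 1"
    proof eventually_elim
      case (elim s)
      then have "concentrated \<Omega> (\<kappa> s)" using \<kappa> by (simp add: lip_kernel_def)
      then show ?case using elim by (simp add: concentrated_def)
    qed
  qed
  also have "\<dots> = 1"
    using \<tau> prob_space.emeasure_space_1 by (auto simp: time_law_def)
  finally show "emeasure (\<tau> \<bind> time_kernel \<kappa>) (\<Omega> \<times> {0..1}) = 1" .
qed (use \<tau> \<kappa> emeasure_bind_time_kernel[OF assms] in \<open>auto simp: time_law_def\<close>)

lemma LipCS_AE:
  assumes "compact \<Omega>" "M \<in> LipCS d \<Omega> C \<sigma>"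
  shows "AE p in M. fst p \<in> \<Omega> \<and> snd p \<in> {0..1}"
proof -
  have "closed (\<Omega> \<times> {0..1::real})"
    using assms by (intro closed_Times compact_imp_closed) auto
  then have "\<Omega> \<times> {0..1::real} \<in> sets M"
    using assms(2) by (auto simp: LipCS_iff)
  then have "AE p in M. p \<in> \<Omega> \<times> {0..1}"
    using assms by (intro AE_in_full_measure) (auto simp: LipCS_iff)
  then show ?thesis by eventually_elim auto
qed

text \<open>The converse direction: the disintegration formula identifies M with the mixture on
  every Borel set, which exposes its time marginal to modification.\<close>

lemma LipCS_bind:
  assumes \<Omega>: "compact \<Omega>" "\<Omega> \<subseteq> Rn d" and M: "M \<in> LipCS d \<Omega> C \<sigma>"
  obtains \<kappa> where "lip_kernel d \<Omega> C \<kappa>" "time_law \<sigma> (tmarg M)" "M = tmarg M \<bind> time_kernel \<kappa>"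
proof -
  obtain \<kappa> where \<kappa>: "lip_kernel d \<Omega> C \<kappa>"
    and eq: "\<And>A. A \<in> sets borel \<Longrightarrow> emeasure M A = (\<integral>\<^sup>+ s. emeasure (\<kappa> s) {x. (x, s) \<in> A} \<partial>(tmarg M))"
    using M unfolding LipCS_iff by blast
  have prob: "prob_space M" and sets[measurable_cong]: "sets M = sets borel" and \<sigma>: "\<sigma> \<le> measure (tmarg M) {0}"
    using M by (auto simp: LipCS_iff)
  have "prob_space (tmarg M)"
    unfolding tmarg_def by (rule prob_space.prob_space_distr[OF prob]) measurable
  moreover have "AE s in tmarg M. s \<in> {0..1}"
    unfolding tmarg_def using LipCS_AE[OF \<Omega>(1) M] by (subst AE_distr_iff) auto
  moreover have "sets (tmarg M) = sets borel"
    by (simp add: tmarg_def)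
  ultimately have \<tau>: "time_law \<sigma> (tmarg M)"
    using \<sigma> unfolding time_law_def by blast
  have "M = tmarg M \<bind> time_kernel \<kappa>"
  proof (rule measure_eqI)
    show "sets M = sets (tmarg M \<bind> time_kernel \<kappa>)"
      using bind_time_kernel_LipCS[OF \<Omega> \<kappa> \<tau>] by (simp add: sets LipCS_iff)
    show "emeasure M A = emeasure (tmarg M \<bind> time_kernel \<kappa>) A" if "A \<in> sets M" for A
      using that by (simp add: sets eq emeasure_bind_time_kernel[OF \<Omega> \<kappa> \<tau>])
  qed
  then show ?thesis using that \<kappa> \<tau> by blast
qed

lemma integral_bind_time_kernel:
  fixes f :: "vec \<times> real \<Rightarrow> real"
  assumes \<Omega>: "compact \<Omega>" "\<Omega> \<subseteq> Rn d" and \<kappa>: "lip_kernel d \<Omega> C \<kappa>" and \<tau>: "time_law \<sigma> \<tau>"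
    and f: "f \<in> borel_measurable borel" "\<And>p. \<bar>f p\<bar> \<le> B"
  shows "(\<integral>p. f p \<partial>(\<tau> \<bind> time_kernel \<kappa>)) = (\<integral>s. \<integral>p. f p \<partial>time_kernel \<kappa> s \<partial>\<tau>)"
proof (rule integral_bind[OF f(1)])
  show "\<bar>f p\<bar> \<le> B" for p by (rule f(2))
  have sets: "sets \<tau> = sets borel" and prob: "prob_space \<tau>"
    using \<tau> by (auto simp: time_law_def)
  show "time_kernel \<kappa> \<in> \<tau> \<rightarrow>\<^sub>M subprob_algebra borel"
    using measurable_prob_algebraD[OF measurable_time_kernel[OF \<Omega> \<kappa>]]
    by (simp add: measurable_cong_sets[OF sets refl])
  show "finite_measure \<tau>"
    using prob by (rule prob_space.finite_measure)
  show "AE s in \<tau>. emeasure (time_kernel \<kappa> s) (space (time_kernel \<kappa> s)) \<le> ennreal 1"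
    by (rule AE_I2) (simp add: prob_space.emeasure_space_1[OF prob_space_time_kernel[OF \<kappa>]])
qed

text \<open>The kernel constantly \<alpha> is admissible by the diagonal coupling, and the Dirac law
  at 0 has atom 1 \<ge> \<sigma>. Thus \<Lambda> can be evaluated at every law on \<Omega>, not only
  at those found as an initial law of a given M.\<close>

lemma dirac_time_LipCS:
  assumes \<Omega>: "compact \<Omega>" "\<Omega> \<subseteq> Rn d" and "\<sigma> \<le> 1" and \<alpha>: "concentrated \<Omega> \<alpha>"
  shows "distr \<alpha> borel (\<lambda>x. (x, 0)) \<in> LipCS d \<Omega> C \<sigma>"
proof -
  have prob: "prob_space \<alpha>" and sets[measurable_cong]: "sets \<alpha> = sets borel"
    using \<alpha> by (auto simp: concentrated_def)
  have [measurable]: "(\<lambda>x :: vec. (x, x)) \<in> borel_measurable borel"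
    by (intro borel_measurable_continuous_onI continuous_on_Pair continuous_on_id)
  have [measurable]: "(fst :: vec \<times> vec \<Rightarrow> vec) \<in> borel_measurable borel" "(snd :: vec \<times> vec \<Rightarrow> vec) \<in> borel_measurable borel"
    by (intro borel_measurable_continuous_onI continuous_on_fst continuous_on_snd continuous_on_id)+
  have [measurable]: "(\<lambda>p :: vec \<times> vec. sqdist d (fst p) (snd p)) \<in> borel_measurable borel"
    by (intro borel_measurable_continuous_onI continuous_on_sqdist continuous_on_fst continuous_on_snd continuous_on_id)
  let ?\<pi> = "distr \<alpha> borel (\<lambda>x. (x, x))"
  have "?\<pi> \<in> couplings \<alpha> \<alpha>"
    unfolding couplings_def
    by (auto intro!: prob_space.prob_space_distr[OF prob] simp: distr_distr o_def distr_id2[OF sets[symmetric]])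
  then have "W2sq d \<alpha> \<alpha> \<le> (\<integral>\<^sup>+ p. ennreal (sqdist d (fst p) (snd p)) \<partial>?\<pi>)"
    unfolding W2sq_def by (rule INF_lower)
  also have "\<dots> = (\<integral>\<^sup>+ x. ennreal (sqdist d (fst (x, x)) (snd (x, x))) \<partial>\<alpha>)"
    by (rule nn_integral_distr) measurable
  also have "\<dots> = 0"
    by (simp add: sqdist_def)
  finally have W: "W2sq d \<alpha> \<alpha> = 0" by simp
  have \<kappa>: "lip_kernel d \<Omega> C (\<lambda>_. \<alpha>)"
    using \<alpha> by (simp add: lip_kernel_def W)
  have \<tau>: "time_law \<sigma> (return borel 0)"
    using \<open>\<sigma> \<le> 1\<close> by (auto simp: time_law_def AE_return prob_space_return measure_return)
  have "return borel 0 \<bind> time_kernel (\<lambda>_. \<alpha>) = time_kernel (\<lambda>_. \<alpha>) 0"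
    by (rule bind_return[OF measurable_prob_algebraD[OF measurable_time_kernel[OF \<Omega> \<kappa>]]]) simp
  also have "\<dots> = distr \<alpha> borel (\<lambda>x. (x, 0))"
    by (simp add: time_kernel_def clamp01_def)
  finally show ?thesis
    using bind_time_kernel_LipCS[OF \<Omega> \<kappa> \<tau>] by simp
qed

section \<open>The law of the particles at time zero\<close>

definition initial_law :: "pmeas \<Rightarrow> vec measure" where
  "initial_law M = distr (mask M 0) borel fst"

lemma measure_tmarg_zero:
  assumes "prob_space M" "sets M = sets borel"
  shows "measure (tmarg M) {0} = (\<integral>p. indicator {0} (snd p) \<partial>M)"
proof -
  interpret prob_space M by fact
  note assms(2)[measurable_cong]
  have "measure (tmarg M) {0} = (\<integral>s. indicator {0} s \<partial>tmarg M)"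
    by (simp add: tmarg_def)
  also have "\<dots> = (\<integral>p. indicator {0} (snd p) \<partial>M)"
    unfolding tmarg_def by (subst integral_distr) auto
  finally show ?thesis .
qed

text \<open>The window is left as {0..0} so that the right-hand side is literally a running average
  at time 0.\<close>

lemma integral_initial_law:
  fixes f :: "vec \<Rightarrow> real"
  assumes "prob_space M" "sets M = sets borel" "f \<in> borel_measurable borel"
  shows "(\<integral>x. f x \<partial>initial_law M) =
    (\<integral>p. indicator {0..0} (snd p) * f (fst p) \<partial>M) / (\<integral>p. indicator {0..0} (snd p) \<partial>M)"
proof -
  interpret prob_space M by fact
  note assms(2)[measurable_cong] assms(3)[measurable]
  have "(\<integral>x. f x \<partial>initial_law M) = (\<integral>p. f (fst p) \<partial>mask M 0)"
    unfolding initial_law_def mask_def by (subst integral_distr) auto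
  also have "\<dots> = (\<integral>p. (indicator {0..0} (snd p) / measure (tmarg M) {0..0}) *\<^sub>R f (fst p) \<partial>M)"
    unfolding mask_def by (subst integral_density) (auto simp: measurable_cong_sets[OF assms(2) refl])
  also have "\<dots> = (\<integral>p. (indicator {0..0} (snd p) * f (fst p)) / measure (tmarg M) {0..0} \<partial>M)"
    by (rule Bochner_Integration.integral_cong) auto
  finally show ?thesis
    using measure_tmarg_zero[OF assms(1,2)] by simp
qed

text \<open>The masked density charges only points with time 0, and the atom of mass at least
  \<sigma> > 0 makes it a genuine probability density. The masked measure is therefore recovered
  from its first marginal.\<close>

lemma mask_zero:
  assumes \<Omega>: "compact \<Omega>" and M: "M \<in> LipCS d \<Omega> C \<sigma>" and "0 < \<sigma>"
  shows "concentrated \<Omega> (initial_law M)" "mask M 0 = distr (initial_law M) borel (\<lambda>x. (x, 0))"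
proof -
  have prob: "prob_space M" and sets[measurable_cong]: "sets M = sets borel" and \<sigma>: "\<sigma> \<le> measure (tmarg M) {0}"
    using M by (auto simp: LipCS_iff)
  interpret prob_space M by fact
  define m where "m = measure (tmarg M) {0}"
  have "0 < m" using \<sigma> \<open>0 < \<sigma>\<close> by (simp add: m_def)
  have mask: "mask M 0 = density M (\<lambda>p. ennreal (indicator {0} (snd p) / m))"
    by (simp add: mask_def m_def)
  have sets_mask[measurable_cong]: "sets (mask M 0) = sets borel"
    by (simp add: mask sets)
  have [measurable]: "\<Omega> \<in> sets borel"
    using \<Omega> by (simp add: borel_closed compact_imp_closed)
  have "emeasure (mask M 0) (space (mask M 0)) = (\<integral>\<^sup>+ p. ennreal (indicator {0} (snd p) / m) \<partial>M)"
    unfolding mask by (subst emeasure_density) (auto intro!: nn_integral_cong)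
  also have "\<dots> = ennreal (\<integral>p. indicator {0} (snd p) / m \<partial>M)"
    using \<open>0 < m\<close> by (intro nn_integral_eq_integral integrable_divide integrable_const_bound[where B = 1]) auto
  also have "\<dots> = 1"
    using \<open>0 < m\<close> measure_tmarg_zero[OF prob sets] by (simp add: m_def)
  finally have prob_mask: "prob_space (mask M 0)"
    by (rule prob_spaceI)
  have AE_mask: "AE p in mask M 0. fst p \<in> \<Omega> \<and> snd p = 0"
    unfolding mask
  proof (subst AE_density)
    show "AE p in M. 0 < ennreal (indicator {0} (snd p) / m) \<longrightarrow> fst p \<in> \<Omega> \<and> snd p = 0"
      using LipCS_AE[OF \<Omega> M] by eventually_elim (auto simp: indicator_def split: if_splits)
  qed measurable
  have "prob_space (initial_law M)"
    unfolding initial_law_def by (rule prob_space.prob_space_distr[OF prob_mask]) measurable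
  moreover have "AE x in initial_law M. x \<in> \<Omega>"
    unfolding initial_law_def using AE_mask by (subst AE_distr_iff) auto
  moreover have "sets (initial_law M) = sets borel"
    by (simp add: initial_law_def)
  ultimately show "concentrated \<Omega> (initial_law M)"
    unfolding concentrated_def by (auto simp: prob_space.emeasure_eq_1_AE)
  have "distr (initial_law M) borel (\<lambda>x. (x, 0 :: real)) = distr (mask M 0) borel (\<lambda>p. (fst p, 0))"
    unfolding initial_law_def by (subst distr_distr) (simp_all add: o_def measurable_at_time)
  also have "\<dots> = distr (mask M 0) borel (\<lambda>p. p)"
  proof (rule distr_cong_AE)
    show "AE p in mask M 0. (fst p, 0) = p"
      using AE_mask by eventually_elim (auto simp: prod_eq_iff)
    show "(\<lambda>p. (fst p, 0 :: real)) \<in> mask M 0 \<rightarrow>\<^sub>M borel"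
      using measurable_compose[OF measurable_fst_vec measurable_at_time[of 0]]
      by (simp add: measurable_cong_sets[OF sets_mask refl])
  qed (auto simp: measurable_cong_sets[OF sets_mask refl])
  also have "\<dots> = mask M 0"
    by (rule distr_id2[OF sets_mask[symmetric]])
  finally show "mask M 0 = distr (initial_law M) borel (\<lambda>x. (x, 0))" by simp
qed

section \<open>Discretised time marginals\<close>

definition round_up :: "nat \<Rightarrow> real \<Rightarrow> real" where
  "round_up n s = of_int \<lceil>real (Suc n) * s\<rceil> / real (Suc n)"

lemma round_up_bounds: "s \<le> round_up n s" "round_up n s \<le> s + 1 / real (Suc n)"
proof -
  have "real (Suc n) * s \<le> of_int \<lceil>real (Suc n) * s\<rceil>" "of_int \<lceil>real (Suc n) * s\<rceil> \<le> real (Suc n) * s + 1"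
    by linarith+
  then have "real (Suc n) * s / real (Suc n) \<le> round_up n s"
    "round_up n s \<le> (real (Suc n) * s + 1) / real (Suc n)"
    unfolding round_up_def by (intro divide_right_mono; simp)+
  then show "s \<le> round_up n s" "round_up n s \<le> s + 1 / real (Suc n)"
    by (simp_all add: add_divide_distrib)
qed

lemma round_up_tendsto: "(\<lambda>n. round_up n s) \<longlonglongrightarrow> s"
proof (rule real_tendsto_sandwich[of "\<lambda>_. s" _ _ "\<lambda>n. s + 1 / real (Suc n)"])
  show "(\<lambda>n. s + 1 / real (Suc n)) \<longlonglongrightarrow> s"
    using tendsto_add[OF tendsto_const LIMSEQ_inverse_real_of_nat, of s] by (simp add: inverse_eq_divide)
qed (use round_up_bounds in \<open>auto intro!: always_eventually simp del: of_nat_Suc\<close>)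

lemma round_up_range: "s \<in> {0..1} \<Longrightarrow> round_up n s \<in> {0..1}"
proof -
  assume s: "s \<in> {0..1}"
  have "\<lceil>real (Suc n) * s\<rceil> \<le> int (Suc n)"
    using s by (intro ceiling_le) (auto intro!: mult_left_le)
  then have "real_of_int \<lceil>real (Suc n) * s\<rceil> \<le> real (Suc n)"
    by linarith
  then have "round_up n s \<le> 1"
    by (simp add: round_up_def)
  then show ?thesis
    using round_up_bounds(1)[of s n] s by auto
qed

lemma measurable_round_up [measurable]: "round_up n \<in> borel_measurable borel"
  unfolding round_up_def by measurable

text \<open>Both 0 and 1 are grid points: rounding fixes 0, so the atom there can only gain mass,
  and rounding does not leave [0, 1].\<close>

lemma time_law_round_up:
  assumes "time_law \<sigma> \<tau>"
  shows "time_law \<sigma> (distr \<tau> borel (round_up n))"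
proof -
  have prob: "prob_space \<tau>" and sets[measurable_cong]: "sets \<tau> = sets borel" and AE: "AE s in \<tau>. s \<in> {0..1}"
    and \<sigma>: "\<sigma> \<le> measure \<tau> {0}"
    using assms by (auto simp: time_law_def)
  interpret prob_space \<tau> by fact
  have "AE s in distr \<tau> borel (round_up n). s \<in> {0..1}"
  proof (subst AE_distr_iff)
    show "AE s in \<tau>. round_up n s \<in> {0..1}"
      using AE by eventually_elim (rule round_up_range)
  qed auto
  moreover have "measure \<tau> {0} \<le> measure (distr \<tau> borel (round_up n)) {0}"
  proof -
    have "round_up n 0 = 0" by (simp add: round_up_def)
    moreover have "round_up n -` {0} \<inter> space \<tau> \<in> sets \<tau>"
      by measurable
    ultimately have "measure \<tau> {0} \<le> measure \<tau> (round_up n -` {0} \<inter> space \<tau>)"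
      using sets_eq_imp_space_eq[OF sets] by (intro finite_measure_mono) simp_all
    also have "\<dots> = measure (distr \<tau> borel (round_up n)) {0}"
      by (subst measure_distr) auto
    finally show ?thesis .
  qed
  moreover have "prob_space (distr \<tau> borel (round_up n))"
    by (rule prob_space_distr) measurable
  ultimately show ?thesis
    using \<sigma> unfolding time_law_def by auto
qed

lemma AE_snd_grid:
  assumes \<Omega>: "compact \<Omega>" "\<Omega> \<subseteq> Rn d" and \<kappa>: "lip_kernel d \<Omega> C \<kappa>" and \<tau>: "time_law \<sigma> \<tau>"
  shows "AE s in tmarg (distr \<tau> borel (round_up n) \<bind> time_kernel \<kappa>). s \<in> range (\<lambda>k::int. of_int k / real (Suc n))"
proof -
  have sets[measurable_cong]: "sets \<tau> = sets borel"
    using \<tau> by (auto simp: time_law_def)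
  have "countable (range (\<lambda>k::int. of_int k / real (Suc n)))" by simp
  then have [measurable]: "range (\<lambda>k::int. of_int k / real (Suc n)) \<in> sets borel"
    by (rule sets.countable[rotated]) auto
  have "AE s in distr \<tau> borel (round_up n). s \<in> range (\<lambda>k::int. of_int k / real (Suc n))"
    by (subst AE_distr_iff) (auto simp: round_up_def simp del: of_nat_Suc)
  then show ?thesis
    unfolding tmarg_bind_time_kernel[OF \<Omega> \<kappa> time_law_round_up[OF \<tau>]] .
qed

text \<open>No grid point separates t from t' when the two floors agree, so the windows coincide
  almost everywhere, including their normalising masses.\<close>

lemma mask_grid_eq:
  assumes sets: "sets N = sets borel"
    and grid: "AE s in tmarg N. s \<in> range (\<lambda>k::int. of_int k / real (Suc n))"
    and fl: "\<lfloor>real (Suc n) * t\<rfloor> = \<lfloor>real (Suc n) * t'\<rfloor>"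
  shows "mask N t = mask N t'"
proof -
  note sets[measurable_cong]
  have iff: "of_int k / real (Suc n) \<in> {0..t} \<longleftrightarrow> of_int k / real (Suc n) \<in> {0..t'}" for k :: int
  proof -
    have "of_int k / real (Suc n) \<le> u \<longleftrightarrow> k \<le> \<lfloor>real (Suc n) * u\<rfloor>" for u
      by (simp add: le_floor_iff divide_le_eq mult.commute)
    then show ?thesis using fl by simp
  qed
  have AE: "AE s in tmarg N. s \<in> {0..t} \<longleftrightarrow> s \<in> {0..t'}"
    using grid by eventually_elim (use iff in blast)
  then have m: "measure (tmarg N) {0..t} = measure (tmarg N) {0..t'}"
    by (rule measure_eq_AE) (auto simp: tmarg_def)
  have "AE p in N. snd p \<in> {0..t} \<longleftrightarrow> snd p \<in> {0..t'}"
    using AE unfolding tmarg_def by (subst (asm) AE_distr_iff) auto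
  then have "AE p in N. ennreal (indicator {0..t} (snd p) / measure (tmarg N) {0..t}) =
      ennreal (indicator {0..t'} (snd p) / measure (tmarg N) {0..t'})"
    by eventually_elim (simp add: m indicator_def)
  then show ?thesis
    unfolding mask_def by (intro density_cong) auto
qed

text \<open>For a time marginal supported on a grid the masked measures take finitely many values, so by
  identifiability \<open>t \<mapsto> \<Lambda> N x t\<close> has finite range; being continuous on an interval it is constant.\<close>

lemma causal_identifiable_grid_constant:
  assumes \<Omega>: "compact \<Omega>"
    and cont: "continuous_map (prod_topology (subtopology weak_star (LipCS d \<Omega> C \<sigma>))
        (subtopology euclidean (\<Omega> \<times> {0..1}))) euclidean (\<lambda>(M, (x, t)). \<Lambda> M x t)"
    and caus: "causal d \<Omega> C \<sigma> \<Lambda>" and ident: "identifiable d \<Omega> C \<sigma> \<Lambda>"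
    and N: "N \<in> LipCS d \<Omega> C \<sigma>"
    and grid: "AE s in tmarg N. s \<in> range (\<lambda>k::int. of_int k / real (Suc n))"
    and x: "x \<in> \<Omega>" and t: "t \<in> {0..1}"
  shows "\<Lambda> N x t = \<Lambda> N x 0"
proof
  fix i
  have sets: "sets N = sets borel" using N by (simp add: LipCS_iff)
  have eq: "\<Lambda> N x s = \<Lambda> N x s'"
    if s: "s \<in> {0..1}" "s' \<in> {0..1}" and fl: "\<lfloor>real (Suc n) * s\<rfloor> = \<lfloor>real (Suc n) * s'\<rfloor>" for s s'
  proof -
    \<comment> \<open>Identifiability only compares values at masked measures; causality is applied
      once to reach them and once to return.\<close>
    have "\<Lambda> N x s = \<Lambda> (mask N s) x s"
      using caus N x s by (simp add: causal_def)
    also have "\<dots> = \<Lambda> (mask N s') x s'"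
      using ident N x s mask_grid_eq[OF sets grid fl] unfolding identifiable_def by blast
    also have "\<dots> = \<Lambda> N x s'"
      using caus N x s by (simp add: causal_def)
    finally show ?thesis .
  qed
  have "(\<lambda>s. \<Lambda> N x s i) constant_on {0..1}"
  proof (rule continuous_finite_range_constant)
    show "continuous_on {0..1} (\<lambda>s. \<Lambda> N x s i)"
      unfolding continuous_on_sequentially
    proof (intro ballI allI impI, elim conjE)
      fix u and s :: "nat \<Rightarrow> real" assume "u \<in> {0..1}" "\<forall>n. s n \<in> {0..1}" "s \<longlonglongrightarrow> u"
      then have "(\<lambda>n. \<Lambda> N x (s n)) \<longlonglongrightarrow> \<Lambda> N x u"
        using N x by (intro continuous_map_weak_star_tendsto[OF cont]) auto
      then show "((\<lambda>s. \<Lambda> N x s i) \<circ> s) \<longlonglongrightarrow> \<Lambda> N x u i"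
        by (simp add: tendsto_fun_iff o_def)
    qed
    \<comment> \<open>Each time is replaced by the last grid point not after it, which leaves n + 2
      candidate values.\<close>
    have "(\<lambda>s. \<Lambda> N x s i) ` {0..1} \<subseteq> (\<lambda>k. \<Lambda> N x (of_int k / real (Suc n)) i) ` {0..int (Suc n)}"
    proof (rule image_subsetI)
      fix s :: real assume s: "s \<in> {0..1}"
      let ?k = "\<lfloor>real (Suc n) * s\<rfloor>"
      have k0: "0 \<le> ?k" using s by simp
      have "real (Suc n) * s \<le> real (Suc n)"
        using s by (intro mult_left_le) auto
      then have k1: "?k \<le> int (Suc n)" by linarith
      have "of_int ?k / real (Suc n) \<in> {0..1}"
        using k0 k1 by simp
      then have "\<Lambda> N x s = \<Lambda> N x (of_int ?k / real (Suc n))"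
        using s by (intro eq) auto
      then show "\<Lambda> N x s i \<in> (\<lambda>k. \<Lambda> N x (of_int k / real (Suc n)) i) ` {0..int (Suc n)}"
        using k0 k1 by (intro image_eqI[of _ _ ?k]) auto
    qed
    then show "finite ((\<lambda>s. \<Lambda> N x s i) ` {0..1})"
      by (rule finite_subset) simp
  qed simp
  then show "\<Lambda> N x t i = \<Lambda> N x 0 i"
    using t unfolding constant_on_def by force
qed

text \<open>The identity holds for time marginals on a grid and passes to the limit at the two times
  t and 0 separately.\<close>

lemma causal_identifiable_time_independent:
  assumes \<Omega>: "compact \<Omega>" "\<Omega> \<subseteq> Rn d"
    and cont: "continuous_map (prod_topology (subtopology weak_star (LipCS d \<Omega> C \<sigma>))
        (subtopology euclidean (\<Omega> \<times> {0..1}))) euclidean (\<lambda>(M, (x, t)). \<Lambda> M x t)"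
    and caus: "causal d \<Omega> C \<sigma> \<Lambda>" and ident: "identifiable d \<Omega> C \<sigma> \<Lambda>"
    and M: "M \<in> LipCS d \<Omega> C \<sigma>" and x: "x \<in> \<Omega>" and t: "t \<in> {0..1}"
  shows "\<Lambda> M x t = \<Lambda> M x 0"
proof -
  obtain \<kappa> where \<kappa>: "lip_kernel d \<Omega> C \<kappa>" and \<tau>: "time_law \<sigma> (tmarg M)" and M_eq: "M = tmarg M \<bind> time_kernel \<kappa>"
    using LipCS_bind[OF \<Omega> M] by blast
  define N where "N n = distr (tmarg M) borel (round_up n) \<bind> time_kernel \<kappa>" for n
  have N: "N n \<in> LipCS d \<Omega> C \<sigma>" for n
    unfolding N_def by (rule bind_time_kernel_LipCS[OF \<Omega> \<kappa> time_law_round_up[OF \<tau>]])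
  have lim: "(\<lambda>n. \<integral>p. f p \<partial>N n) \<longlonglongrightarrow> (\<integral>p. f p \<partial>M)"
    if f: "continuous_on UNIV f" "bounded (range f)" for f :: "vec \<times> real \<Rightarrow> real"
  proof -
    have [measurable]: "f \<in> borel_measurable borel"
      using f(1) by (rule borel_measurable_continuous_onI)
    obtain B where B: "\<And>p. \<bar>f p\<bar> \<le> B"
      using f(2) by (auto simp: bounded_iff)
    define \<phi> where "\<phi> s = (\<integral>p. f p \<partial>time_kernel \<kappa> s)" for s
    have \<phi>_cont: "continuous_on UNIV \<phi>"
      unfolding \<phi>_def by (rule continuous_on_integral_time_kernel[OF \<Omega> \<kappa> f(1)])
    then have [measurable]: "\<phi> \<in> borel_measurable borel"
      by (rule borel_measurable_continuous_onI)
    have \<phi>_bound: "\<bar>\<phi> s\<bar> \<le> B" for s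
    proof -
      interpret J: prob_space "time_kernel \<kappa> s" by (rule prob_space_time_kernel[OF \<kappa>])
      have "\<bar>\<phi> s\<bar> \<le> (\<integral>p. \<bar>f p\<bar> \<partial>time_kernel \<kappa> s)"
        unfolding \<phi>_def by (rule integral_abs_bound)
      also have "\<dots> \<le> (\<integral>p. B \<partial>time_kernel \<kappa> s)"
      proof (rule integral_mono)
        show "integrable (time_kernel \<kappa> s) (\<lambda>p. \<bar>f p\<bar>)"
          by (rule J.integrable_const_bound[where B = B]) (use B in auto)
      qed (use B in simp_all)
      finally show ?thesis by (simp add: J.prob_space)
    qed
    interpret T: prob_space "tmarg M" using \<tau> by (simp add: time_law_def)
    have [measurable_cong]: "sets (tmarg M) = sets borel" by (simp add: tmarg_def)
    \<comment> \<open>Since \<phi> is continuous and bounded, moving the times by rounding is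
      harmless; this is where the regularity of the kernel pays off.\<close>
    have "(\<lambda>n. \<integral>s. \<phi> (round_up n s) \<partial>tmarg M) \<longlonglongrightarrow> (\<integral>s. \<phi> s \<partial>tmarg M)"
    proof (rule integral_dominated_convergence[where w = "\<lambda>_. B"])
      show "AE s in tmarg M. (\<lambda>n. \<phi> (round_up n s)) \<longlonglongrightarrow> \<phi> s"
        using continuous_on_tendsto_compose[OF \<phi>_cont round_up_tendsto] by auto
    qed (use \<phi>_bound in auto)
    moreover have "(\<integral>p. f p \<partial>N n) = (\<integral>s. \<phi> (round_up n s) \<partial>tmarg M)" for n
    proof -
      have "(\<integral>p. f p \<partial>N n) = (\<integral>s. \<phi> s \<partial>distr (tmarg M) borel (round_up n))"
        unfolding N_def \<phi>_def
        by (rule integral_bind_time_kernel[OF \<Omega> \<kappa> time_law_round_up[OF \<tau>], where B = B]) (use B in auto)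
      then show ?thesis by (simp add: integral_distr)
    qed
    moreover have "(\<integral>p. f p \<partial>M) = (\<integral>s. \<phi> s \<partial>tmarg M)"
      by (subst M_eq, unfold \<phi>_def, rule integral_bind_time_kernel[OF \<Omega> \<kappa> \<tau>, where B = B]) (use B in auto)
    ultimately show ?thesis by simp
  qed
  have "(\<lambda>n. \<Lambda> (N n) x t) \<longlonglongrightarrow> \<Lambda> M x t"
    using N M x t lim by (intro continuous_map_weak_star_tendsto[OF cont]) auto
  moreover have "(\<lambda>n. \<Lambda> (N n) x 0) \<longlonglongrightarrow> \<Lambda> M x 0"
    using N M x lim by (intro continuous_map_weak_star_tendsto[OF cont]) auto
  moreover have "\<Lambda> (N n) x t = \<Lambda> (N n) x 0" for n
    by (rule causal_identifiable_grid_constant[OF \<Omega>(1) cont caus ident N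
          AE_snd_grid[OF \<Omega> \<kappa> \<tau>, folded N_def] x t])
  ultimately show ?thesis
    using LIMSEQ_unique by simp
qed

lemma causal_identifiable_initial_law:
  assumes \<Omega>: "compact \<Omega>" "\<Omega> \<subseteq> Rn d" and "0 < \<sigma>"
    and cont: "continuous_map (prod_topology (subtopology weak_star (LipCS d \<Omega> C \<sigma>))
        (subtopology euclidean (\<Omega> \<times> {0..1}))) euclidean (\<lambda>(M, (x, t)). \<Lambda> M x t)"
    and caus: "causal d \<Omega> C \<sigma> \<Lambda>" and ident: "identifiable d \<Omega> C \<sigma> \<Lambda>"
    and M: "M \<in> LipCS d \<Omega> C \<sigma>" and x: "x \<in> \<Omega>" and t: "t \<in> {0..1}"
  shows "\<Lambda> M x t = \<Lambda> (distr (initial_law M) borel (\<lambda>x. (x, 0))) x 0"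
proof -
  have "\<Lambda> M x t = \<Lambda> M x 0"
    by (rule causal_identifiable_time_independent[OF \<Omega> cont caus ident M x t])
  also have "\<dots> = \<Lambda> (mask M 0) x 0"
    using caus M x by (simp add: causal_def)
  finally show ?thesis
    using mask_zero(2)[OF \<Omega>(1) M \<open>0 < \<sigma>\<close>] by simp
qed

section \<open>Shallow ReLU networks\<close>

text \<open>One hidden layer with linear output, each unit being an outer weight, an input weight
  vector and a bias. There is no output bias: \<open>relu_sum_affine\<close> produces constants from
  hidden units.\<close>

definition relu_sum :: "nat \<Rightarrow> (vec \<Rightarrow> real) \<Rightarrow> bool" where
  "relu_sum n f \<longleftrightarrow> (\<exists>L :: (real \<times> vec \<times> real) list.
     \<forall>x. f x = (\<Sum>(a, w, b)\<leftarrow>L. a * max 0 ((\<Sum>j<n. w j * x j) + b)))"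

lemma relu_sum_add:
  assumes "relu_sum n f" "relu_sum n g"
  shows "relu_sum n (\<lambda>x. f x + g x)"
proof -
  obtain L L' where "\<forall>x. f x = (\<Sum>(a, w, b)\<leftarrow>L. a * max 0 ((\<Sum>j<n. w j * x j) + b))"
    "\<forall>x. g x = (\<Sum>(a, w, b)\<leftarrow>L'. a * max 0 ((\<Sum>j<n. w j * x j) + b))"
    using assms unfolding relu_sum_def by blast
  then show ?thesis
    unfolding relu_sum_def by (intro exI[of _ "L @ L'"]) simp
qed

lemma relu_sum_scale:
  assumes "relu_sum n f"
  shows "relu_sum n (\<lambda>x. c * f x)"
proof -
  obtain L where "\<forall>x. f x = (\<Sum>(a, w, b)\<leftarrow>L. a * max 0 ((\<Sum>j<n. w j * x j) + b))"
    using assms unfolding relu_sum_def by blast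
  then show ?thesis
    unfolding relu_sum_def
    by (intro exI[of _ "map (\<lambda>(a, w, b). (c * a, w, b)) L"])
       (simp add: sum_list_const_mult[symmetric] o_def case_prod_unfold mult.assoc)
qed

lemma relu_sum_unit: "relu_sum n (\<lambda>x. max 0 ((\<Sum>j<n. w j * x j) + b))"
  unfolding relu_sum_def by (rule exI[of _ "[(1, w, b)]"]) simp

lemma relu_sum_zero: "relu_sum n (\<lambda>x. 0)"
  unfolding relu_sum_def by (rule exI[of _ "[]"]) simp

lemma relu_sum_sum:
  fixes N :: nat
  assumes "\<And>k. k < N \<Longrightarrow> relu_sum n (f k)"
  shows "relu_sum n (\<lambda>x. \<Sum>k<N. f k x)"
  using assms
proof (induction N)
  case (Suc N)
  then show ?case by (simp add: relu_sum_add)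
qed (simp add: relu_sum_zero)

text \<open>Uses z = max 0 z - max 0 (-z), so registers can be copied through a ReLU layer without
  loss.\<close>

lemma relu_sum_affine: "relu_sum n (\<lambda>x. (\<Sum>j<n. w j * x j) + b)"
proof -
  have "relu_sum n (\<lambda>x. max 0 ((\<Sum>j<n. w j * x j) + b) + (-1) * max 0 ((\<Sum>j<n. (- w j) * x j) + - b))"
    by (intro relu_sum_add relu_sum_scale relu_sum_unit)
  also have "(\<lambda>x. max 0 ((\<Sum>j<n. w j * x j) + b) + (-1) * max 0 ((\<Sum>j<n. (- w j) * x j) + - b)) =
      (\<lambda>x. (\<Sum>j<n. w j * x j) + b)"
    by (auto simp: fun_eq_iff sum_negf max_def)
  finally show ?thesis .
qed

lemma relu_sum_cong:
  assumes "relu_sum n f" "\<And>j. j < n \<Longrightarrow> x j = y j"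
  shows "f x = f y"
proof -
  have "(\<Sum>j<n. w j * x j) = (\<Sum>j<n. w j * y j)" for w
    using assms(2) by (intro sum.cong) auto
  then show ?thesis using assms(1) unfolding relu_sum_def by auto
qed

lemma relu_sum_measurable:
  assumes "relu_sum n f"
  shows "f \<in> borel_measurable borel"
proof -
  obtain L where L: "\<And>x. f x = (\<Sum>(a, w, b)\<leftarrow>L. a * max 0 ((\<Sum>j<n. w j * x j) + b))"
    using assms unfolding relu_sum_def by blast
  have coord[measurable]: "(\<lambda>x :: vec. x i) \<in> borel_measurable borel" for i
    by (rule borel_measurable_continuous_onI[OF continuous_on_product_coordinates])
  have "(\<lambda>x. \<Sum>(a, w, b)\<leftarrow>L. a * max 0 ((\<Sum>j<n. w j * x j) + b)) \<in> borel_measurable borel"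
  proof (induction L)
    case (Cons e L)
    obtain a w b where e: "e = (a, w, b)" by (cases e)
    have "(\<lambda>x. a * max 0 ((\<Sum>j<n. w j * x j) + b)) \<in> borel_measurable borel"
      by measurable
    then show ?case using Cons by (simp add: e)
  qed simp
  then show ?thesis by (simp add: L[abs_def])
qed

lemma relu_sum_bounded:
  assumes "relu_sum n f" "0 \<le> R"
  obtains B where "\<And>x. (\<And>j. j < n \<Longrightarrow> \<bar>x j\<bar> \<le> R) \<Longrightarrow> \<bar>f x\<bar> \<le> B"
proof -
  obtain L where L: "\<And>x. f x = (\<Sum>(a, w, b)\<leftarrow>L. a * max 0 ((\<Sum>j<n. w j * x j) + b))"
    using assms(1) unfolding relu_sum_def by blast
  have "\<exists>B. \<forall>x. (\<forall>j<n. \<bar>x j\<bar> \<le> R) \<longrightarrow> \<bar>\<Sum>(a, w, b)\<leftarrow>L. a * max 0 ((\<Sum>j<n. w j * x j) + b)\<bar> \<le> B"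
  proof (induction L)
    case Nil
    then show ?case by (intro exI[of _ 0]) simp
  next
    case (Cons e L)
    obtain a w b where e: "e = (a, w, b)" by (cases e)
    obtain B where B: "\<And>x. (\<forall>j<n. \<bar>x j\<bar> \<le> R) \<Longrightarrow> \<bar>\<Sum>(a, w, b)\<leftarrow>L. a * max 0 ((\<Sum>j<n. w j * x j) + b)\<bar> \<le> B"
      using Cons by blast
    show ?case
    proof (intro exI allI impI)
      fix x :: vec assume x: "\<forall>j<n. \<bar>x j\<bar> \<le> R"
      have "\<bar>\<Sum>j<n. w j * x j\<bar> \<le> (\<Sum>j<n. \<bar>w j\<bar> * R)"
        using x by (intro order.trans[OF sum_abs] sum_mono) (auto simp: abs_mult intro: mult_left_mono)
      then have "\<bar>max 0 ((\<Sum>j<n. w j * x j) + b)\<bar> \<le> (\<Sum>j<n. \<bar>w j\<bar> * R) + \<bar>b\<bar>"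
        by linarith
      then have "\<bar>a * max 0 ((\<Sum>j<n. w j * x j) + b)\<bar> \<le> \<bar>a\<bar> * ((\<Sum>j<n. \<bar>w j\<bar> * R) + \<bar>b\<bar>)"
        by (simp only: abs_mult mult_left_mono abs_ge_zero)
      then show "\<bar>\<Sum>(a, w, b)\<leftarrow>e # L. a * max 0 ((\<Sum>j<n. w j * x j) + b)\<bar>
          \<le> \<bar>a\<bar> * ((\<Sum>j<n. \<bar>w j\<bar> * R) + \<bar>b\<bar>) + B"
        using B[OF x] unfolding e by simp
    qed
  qed
  then show ?thesis using that L by metis
qed

text \<open>The hidden units of all outputs are placed side by side in \<open>H\<close>, each tagged
  with the output that it feeds; the second matrix reads off the tag.\<close>

lemma relu_sum_mlp:
  assumes "\<And>i. i < m \<Longrightarrow> relu_sum n (F i)"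
  obtains \<xi> where "mlp_ok \<xi> n m" "\<And>M x t. mlp_map \<xi> M x t = (\<lambda>i. if i < m then F i x else 0)"
proof -
  define L where "L i = (SOME L. \<forall>x. F i x = (\<Sum>(a, w, b)\<leftarrow>L. a * max 0 ((\<Sum>j<n. w j * x j) + b)))" for i
  have L: "\<forall>x. F i x = (\<Sum>(a, w, b)\<leftarrow>L i. a * max 0 ((\<Sum>j<n. w j * x j) + b))" if "i < m" for i
    unfolding L_def by (rule someI_ex) (rule assms[OF that, unfolded relu_sum_def])
  define H where "H = concat (map (\<lambda>i. map (\<lambda>e. (i, e)) (L i)) [0..<m])"
  define A1 :: mat where "A1 k j = fst (snd (snd (H ! k))) j" for k j
  define c1 :: vec where "c1 k = snd (snd (snd (H ! k)))" for k
  define A2 :: mat where "A2 i k = (if fst (H ! k) = i then fst (snd (H ! k)) else 0)" for i k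
  define \<xi> :: mlp where "\<xi> = ([n, length H, m], [(A1, c1), (A2, \<lambda>_. 0)])"
  have "mlp_eval (fst \<xi>) (snd \<xi>) x i = (if i < m then F i x else 0)" for x i
  proof (cases "i < m")
    case True
    define r where "r e = (case e of (a, w, b) \<Rightarrow> a * max 0 ((\<Sum>j<n. w j * x j) + b))"
      for e :: "real \<times> vec \<times> real"
    have "mlp_eval (fst \<xi>) (snd \<xi>) x i =
        (\<Sum>k<length H. A2 i k * max 0 ((\<Sum>j<n. A1 k j * x j) + c1 k))"
      using True by (auto simp: \<xi>_def affine_map_def relu_def intro!: sum.cong)
    also have "\<dots> = (\<Sum>k<length H. (\<lambda>(i', e). if i' = i then r e else 0) (H ! k))"
      by (intro sum.cong) (auto simp: A1_def A2_def c1_def r_def case_prod_unfold)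
    also have "\<dots> = sum_list (map (\<lambda>(i', e). if i' = i then r e else 0) H)"
      by (simp add: sum_list_sum_nth atLeast0LessThan)
    also have "\<dots> = (\<Sum>i'\<leftarrow>[0..<m]. if i' = i then sum_list (map r (L i')) else 0)"
      unfolding H_def by (induction m) (auto simp: o_def)
    also have "\<dots> = (\<Sum>i'\<in>{..<m}. if i' = i then sum_list (map r (L i')) else 0)"
      by (simp add: sum_list_distinct_conv_sum_set atLeast0LessThan)
    also have "\<dots> = sum_list (map r (L i))"
      using True by simp
    also have "\<dots> = F i x"
      using L[OF True] by (simp add: r_def[abs_def])
    finally show ?thesis using True by simp
  qed (simp add: \<xi>_def affine_map_def)
  then have "mlp_map \<xi> M x t = (\<lambda>i. if i < m then F i x else 0)" for M x t
    by (simp add: mlp_map_def fun_eq_iff)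
  moreover have "mlp_ok \<xi> n m"
    by (simp add: mlp_ok_def \<xi>_def)
  ultimately show ?thesis using that by blast
qed

text \<open>Left Riemann sums of \<open>y\<^sup>2 = 2 * \<integral> (y - s)\<^sub>+ ds\<close> over \<open>0 \<le> s\<close>.\<close>

lemma riemann_square:
  fixes y h :: real
  assumes "0 \<le> y" "y \<le> real N * h" "0 \<le> h"
  shows "\<bar>(\<Sum>k<N. 2 * h * max 0 (y - real k * h)) - y\<^sup>2\<bar> \<le> 2 * h * y"
proof -
  \<comment> \<open>The difference q k - q (k + 1) is the exact integral of 2 (y - s)_+ over the
    k-th cell, hence lies between the values at the right and left endpoints.\<close>
  define q where "q k = (max 0 (y - real k * h))\<^sup>2" for k
  have step: "2 * h * max 0 (y - real (Suc k) * h) \<le> q k - q (Suc k)"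
    "q k - q (Suc k) \<le> 2 * h * max 0 (y - real k * h)" for k
  proof -
    define a where "a = y - real k * h"
    have a: "y - real (Suc k) * h = a - h" by (simp add: a_def algebra_simps)
    have "2 * h * max 0 (a - h) \<le> (max 0 a)\<^sup>2 - (max 0 (a - h))\<^sup>2 \<and>
        (max 0 a)\<^sup>2 - (max 0 (a - h))\<^sup>2 \<le> 2 * h * max 0 a"
    proof -
      consider "a \<le> 0" | "0 < a" "a \<le> h" | "h < a" by linarith
      then show ?thesis
      proof cases
        case 2
        have "a * a \<le> h * a" using 2 by (intro mult_right_mono) auto
        moreover have "0 \<le> h * a" using 2 assms(3) by simp
        ultimately show ?thesis using 2 by (simp add: power2_eq_square max_def)
      next
        case 3
        then show ?thesis using assms(3) by (simp add: power2_eq_square max_def algebra_simps)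
      qed (use assms(3) in \<open>simp add: max_def\<close>)
    qed
    then show "2 * h * max 0 (y - real (Suc k) * h) \<le> q k - q (Suc k)"
      "q k - q (Suc k) \<le> 2 * h * max 0 (y - real k * h)"
      unfolding q_def a a_def[symmetric] by auto
  qed
  have "(\<Sum>k<N. q k - q (Suc k)) = q 0 - q N"
    by (rule sum_lessThan_telescope')
  also have "\<dots> = y\<^sup>2" using assms by (simp add: q_def)
  finally have tel: "(\<Sum>k<N. q k - q (Suc k)) = y\<^sup>2" .
  have lower: "y\<^sup>2 \<le> (\<Sum>k<N. 2 * h * max 0 (y - real k * h))"
    unfolding tel[symmetric] by (intro sum_mono step)
  \<comment> \<open>Left and right sums differ by the two boundary terms. The one at N is
    nonnegative, so the excess is at most the term 2 h y at 0.\<close>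
  have "(\<Sum>k<N. 2 * h * max 0 (y - real k * h)) + 2 * h * max 0 (y - real N * h)
      = 2 * h * y + (\<Sum>k<N. 2 * h * max 0 (y - real (Suc k) * h))"
    using sum.lessThan_Suc[of "\<lambda>k. 2 * h * max 0 (y - real k * h)" N]
      sum.lessThan_Suc_shift[of "\<lambda>k. 2 * h * max 0 (y - real k * h)" N] assms(1) by simp
  moreover have "(\<Sum>k<N. 2 * h * max 0 (y - real (Suc k) * h)) \<le> y\<^sup>2"
    unfolding tel[symmetric] by (intro sum_mono step)
  moreover have "0 \<le> 2 * h * max 0 (y - real N * h)" using assms(3) by simp
  ultimately show ?thesis using lower by linarith
qed

lemma relu_sum_square:
  assumes "0 < R" "0 < e"
  obtains f where "relu_sum n f"
    "\<And>x. \<bar>\<Sum>j<n. w j * x j\<bar> \<le> R \<Longrightarrow> \<bar>f x - (\<Sum>j<n. w j * x j)\<^sup>2\<bar> \<le> e"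
proof -
  \<comment> \<open>With mesh h = R / N the Riemann error is at most 2 h R = 2 R^2 / N, which this N
    makes smaller than e.\<close>
  obtain N :: nat where N: "2 * R\<^sup>2 / e < real N"
    using reals_Archimedean2 by blast
  have "0 < 2 * R\<^sup>2 / e" using assms by simp
  then have "0 < real N" using N by linarith
  define h where "h = R / real N"
  have h: "0 \<le> h" "real N * h = R" using assms \<open>0 < real N\<close> by (auto simp: h_def)
  have hR: "2 * h * R \<le> e"
    using N \<open>0 < real N\<close> assms by (simp add: h_def field_simps power2_eq_square)
  define l where "l x = (\<Sum>j<n. w j * x j)" for x :: vec
  define f where "f x = (\<Sum>k<N. 2 * h * (max 0 (l x + - (real k * h)) + max 0 ((\<Sum>j<n. (- w j) * x j) + - (real k * h))))" for x
  have "relu_sum n f"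
    unfolding f_def l_def by (intro relu_sum_sum relu_sum_scale relu_sum_add relu_sum_unit)
  moreover have "\<bar>f x - (l x)\<^sup>2\<bar> \<le> e" if "\<bar>l x\<bar> \<le> R" for x
  proof -
    have neg: "(\<Sum>j<n. (- w j) * x j) = - l x"
      by (simp add: l_def sum_negf)
    \<comment> \<open>At most one of the two mirrored hinges is active, so their sum is a hinge in
      the absolute value. This reduces the square to nonnegative arguments.\<close>
    have split: "max 0 (l x + - (real k * h)) + max 0 (- l x + - (real k * h)) = max 0 (\<bar>l x\<bar> - real k * h)" for k
    proof -
      have "max 0 (z + - c) + max 0 (- z + - c) = max 0 (\<bar>z\<bar> - c)" if "0 \<le> c" for z c :: real
        using that by (auto simp: max_def abs_if)
      then show ?thesis using h(1) by simp
    qed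
    have "f x = (\<Sum>k<N. 2 * h * max 0 (\<bar>l x\<bar> - real k * h))"
      unfolding f_def neg split ..
    then have "\<bar>f x - \<bar>l x\<bar>\<^sup>2\<bar> \<le> 2 * h * \<bar>l x\<bar>"
      using riemann_square[of "\<bar>l x\<bar>" N h] that h by simp
    also have "\<dots> \<le> 2 * h * R"
      using that h(1) by (intro mult_left_mono) auto
    also have "\<dots> \<le> e" by (rule hR)
    finally show ?thesis by simp
  qed
  ultimately show ?thesis using that unfolding l_def by blast
qed

text \<open>Polarisation: the product is the square of half the sum minus the square of half the
  difference.\<close>

lemma relu_sum_product:
  assumes "0 < R" "0 < e" "p < n" "q < n"
  obtains f where "relu_sum n f"
    "\<And>x. \<bar>x p\<bar> \<le> R \<Longrightarrow> \<bar>x q\<bar> \<le> R \<Longrightarrow> \<bar>f x - x p * x q\<bar> \<le> e"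
proof -
  \<comment> \<open>Coefficients of (x p + s x q) / 2. Adding two conditionals, rather than nesting
    them, also covers p = q.\<close>
  define u where "u s j = (if j = p then 1/2 else 0) + (if j = q then s/2 else 0)" for s :: real and j
  have u: "(\<Sum>j<n. u s j * x j) = (x p + s * x q) / 2" for s and x :: vec
    using assms(3,4) by (simp add: u_def distrib_right sum.distrib if_distrib[of "\<lambda>a. a * _"] add_divide_distrib cong: if_cong)
  obtain f where f: "relu_sum n f" "\<And>x. \<bar>(x p + 1 * x q) / 2\<bar> \<le> R \<Longrightarrow> \<bar>f x - ((x p + 1 * x q) / 2)\<^sup>2\<bar> \<le> e / 2"
    using relu_sum_square[OF \<open>0 < R\<close>, of "e / 2" n "u 1"] \<open>0 < e\<close> unfolding u by auto
  obtain g where g: "relu_sum n g" "\<And>x. \<bar>(x p + -1 * x q) / 2\<bar> \<le> R \<Longrightarrow> \<bar>g x - ((x p + -1 * x q) / 2)\<^sup>2\<bar> \<le> e / 2"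
    using relu_sum_square[OF \<open>0 < R\<close>, of "e / 2" n "u (-1)"] \<open>0 < e\<close> unfolding u by auto
  show ?thesis
  proof (rule that[of "\<lambda>x. f x + (-1) * g x"])
    show "relu_sum n (\<lambda>x. f x + (-1) * g x)"
      by (intro relu_sum_add relu_sum_scale f g)
    fix x :: vec assume x: "\<bar>x p\<bar> \<le> R" "\<bar>x q\<bar> \<le> R"
    have "x p * x q = ((x p + 1 * x q) / 2)\<^sup>2 - ((x p + -1 * x q) / 2)\<^sup>2"
      by (simp add: power2_eq_square field_simps)
    moreover have "\<bar>f x - ((x p + 1 * x q) / 2)\<^sup>2\<bar> \<le> e / 2"
      by (rule f(2)) (use x in \<open>auto simp: abs_le_iff\<close>)
    moreover have "\<bar>g x - ((x p + -1 * x q) / 2)\<^sup>2\<bar> \<le> e / 2"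
      by (rule g(2)) (use x in \<open>auto simp: abs_le_iff\<close>)
    ultimately show "\<bar>f x + (-1) * g x - x p * x q\<bar> \<le> e" by linarith
  qed
qed

text \<open>A single bound covers both the approximation of \<open>f\<close> by ReLU sums on boxes and the
  propagation of an error in the argument.\<close>

definition box_approx :: "nat \<Rightarrow> (vec \<Rightarrow> real) \<Rightarrow> bool" where
  "box_approx n f \<longleftrightarrow> f \<in> borel_measurable borel \<and> (\<forall>R e. 0 < e \<longrightarrow> (\<exists>g \<delta>. relu_sum n g \<and> 0 < \<delta> \<and>
     (\<forall>x y. (\<forall>j<n. \<bar>x j\<bar> \<le> R \<and> \<bar>y j - x j\<bar> \<le> \<delta>) \<longrightarrow> \<bar>g y - f x\<bar> \<le> e)))"

lemma box_approx_affine: "box_approx n (\<lambda>x. (\<Sum>j<n. w j * x j) + b)"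
  unfolding box_approx_def
proof (intro conjI allI impI)
  show "(\<lambda>x. (\<Sum>j<n. w j * x j) + b) \<in> borel_measurable borel"
    by (rule relu_sum_measurable[OF relu_sum_affine])
  fix R e :: real assume "0 < e"
  define s where "s = (\<Sum>j<n. \<bar>w j\<bar>)"
  have "0 \<le> s" by (simp add: s_def sum_nonneg)
  show "\<exists>g \<delta>. relu_sum n g \<and> 0 < \<delta> \<and>
     (\<forall>x y. (\<forall>j<n. \<bar>x j\<bar> \<le> R \<and> \<bar>y j - x j\<bar> \<le> \<delta>) \<longrightarrow> \<bar>g y - ((\<Sum>j<n. w j * x j) + b)\<bar> \<le> e)"
  proof (rule exI[of _ "\<lambda>x. (\<Sum>j<n. w j * x j) + b"], rule exI[of _ "e / (s + 1)"], intro conjI allI impI)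
    show "relu_sum n (\<lambda>x. (\<Sum>j<n. w j * x j) + b)" by (rule relu_sum_affine)
    show "0 < e / (s + 1)" using \<open>0 < e\<close> \<open>0 \<le> s\<close> by simp
    fix x y :: vec assume xy: "\<forall>j<n. \<bar>x j\<bar> \<le> R \<and> \<bar>y j - x j\<bar> \<le> e / (s + 1)"
    have "\<bar>((\<Sum>j<n. w j * y j) + b) - ((\<Sum>j<n. w j * x j) + b)\<bar> = \<bar>\<Sum>j<n. w j * (y j - x j)\<bar>"
      by (simp add: right_diff_distrib sum_subtractf)
    also have "\<dots> \<le> (\<Sum>j<n. \<bar>w j\<bar> * (e / (s + 1)))"
      using xy by (intro order.trans[OF sum_abs] sum_mono)
        (auto simp: abs_mult simp del: times_divide_eq_right intro!: mult_left_mono)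
    also have "\<dots> = s * (e / (s + 1))"
      unfolding s_def by (rule sum_distrib_right[symmetric])
    also have "\<dots> \<le> e"
      using \<open>0 \<le> s\<close> \<open>0 < e\<close> by (simp add: field_simps)
    finally show "\<bar>((\<Sum>j<n. w j * y j) + b) - ((\<Sum>j<n. w j * x j) + b)\<bar> \<le> e" .
  qed
qed

lemma box_approx_product:
  assumes "p < n" "q < n"
  shows "box_approx n (\<lambda>x. x p * x q)"
  unfolding box_approx_def
proof (intro conjI allI impI)
  have [measurable]: "(\<lambda>x :: vec. x i) \<in> borel_measurable borel" for i
    by (rule borel_measurable_continuous_onI[OF continuous_on_product_coordinates])
  show "(\<lambda>x :: vec. x p * x q) \<in> borel_measurable borel" by measurable
  fix R e :: real assume "0 < e"
  \<comment> \<open>The perturbed argument leaves the box by at most \<delta> \<le> 1, so the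
    approximation is taken on the enlarged box. Half of e pays for it, and \<delta> \<le> e / (4 r)
    keeps the propagated error 2 r \<delta> within the other half.\<close>
  define r where "r = \<bar>R\<bar> + 1"
  have r: "0 < r" "\<bar>R\<bar> \<le> r" by (auto simp: r_def)
  obtain g where g: "relu_sum n g" "\<And>x. \<bar>x p\<bar> \<le> r \<Longrightarrow> \<bar>x q\<bar> \<le> r \<Longrightarrow> \<bar>g x - x p * x q\<bar> \<le> e / 2"
    using relu_sum_product[OF r(1), of "e / 2" p n q] assms \<open>0 < e\<close> by auto
  define \<delta> where "\<delta> = min 1 (e / (4 * r))"
  have \<delta>: "0 < \<delta>" "\<delta> \<le> 1" "\<delta> \<le> e / (4 * r)" using \<open>0 < e\<close> r by (auto simp: \<delta>_def)
  show "\<exists>g \<delta>. relu_sum n g \<and> 0 < \<delta> \<and>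
     (\<forall>x y. (\<forall>j<n. \<bar>x j\<bar> \<le> R \<and> \<bar>y j - x j\<bar> \<le> \<delta>) \<longrightarrow> \<bar>g y - x p * x q\<bar> \<le> e)"
  proof (rule exI[of _ g], rule exI[of _ \<delta>], intro conjI allI impI)
    fix x y :: vec assume xy: "\<forall>j<n. \<bar>x j\<bar> \<le> R \<and> \<bar>y j - x j\<bar> \<le> \<delta>"
    then have x: "\<bar>x q\<bar> \<le> R" "\<bar>x p\<bar> \<le> R" and d: "\<bar>y p - x p\<bar> \<le> \<delta>" "\<bar>y q - x q\<bar> \<le> \<delta>"
      using assms by auto
    have y: "\<bar>y p\<bar> \<le> r" "\<bar>y q\<bar> \<le> r"
      using x d \<delta>(2) unfolding r_def by linarith+
    have "y p * y q - x p * x q = y p * (y q - x q) + (y p - x p) * x q"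
      by (simp add: algebra_simps)
    then have "\<bar>y p * y q - x p * x q\<bar> \<le> \<bar>y p\<bar> * \<bar>y q - x q\<bar> + \<bar>y p - x p\<bar> * \<bar>x q\<bar>"
      using abs_triangle_ineq[of "y p * (y q - x q)" "(y p - x p) * x q"] by (simp add: abs_mult)
    also have "\<dots> \<le> r * \<delta> + \<delta> * r"
      using x y d r by (intro add_mono mult_mono) auto
    also have "\<dots> = 2 * r * \<delta>" by simp
    also have "\<dots> \<le> 2 * r * (e / (4 * r))"
      using r \<delta> by (intro mult_left_mono) auto
    also have "\<dots> = e / 2" using r by simp
    finally show "\<bar>g y - x p * x q\<bar> \<le> e"
      using g(2)[OF y] by linarith
  qed (use g \<delta> in auto)
qed

text \<open>Taking y = x and accuracy 1 compares f with a ReLU sum, and ReLU sums are bounded on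
  boxes.\<close>

lemma box_approx_bounded:
  assumes "box_approx n f"
  obtains B where "\<And>x. (\<And>j. j < n \<Longrightarrow> \<bar>x j\<bar> \<le> R) \<Longrightarrow> \<bar>f x\<bar> \<le> B"
proof -
  obtain g \<delta> where g: "relu_sum n g" "0 < \<delta>"
    "\<And>x y. (\<forall>j<n. \<bar>x j\<bar> \<le> R \<and> \<bar>y j - x j\<bar> \<le> \<delta>) \<Longrightarrow> \<bar>g y - f x\<bar> \<le> 1"
    using assms unfolding box_approx_def by (meson zero_less_one)
  obtain B where B: "\<And>x. (\<And>j. j < n \<Longrightarrow> \<bar>x j\<bar> \<le> \<bar>R\<bar>) \<Longrightarrow> \<bar>g x\<bar> \<le> B"
    using relu_sum_bounded[OF g(1), of "\<bar>R\<bar>"] by auto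
  show ?thesis
  proof (rule that[of "B + 1"])
    fix x :: vec assume x: "\<And>j. j < n \<Longrightarrow> \<bar>x j\<bar> \<le> R"
    then have "\<bar>g x\<bar> \<le> B" by (intro B) (meson abs_ge_self order_trans)
    moreover have "\<bar>g x - f x\<bar> \<le> 1" using x g(2) by (intro g(3)) auto
    ultimately show "\<bar>f x\<bar> \<le> B + 1" by linarith
  qed
qed

section \<open>Networks with averaging heads\<close>

text \<open>With vanishing scores the softmax weights are uniform on the window, so this is exactly
  what such a head adds.\<close>

definition ravg :: "pmeas \<Rightarrow> (vec \<times> real \<Rightarrow> real) \<Rightarrow> real \<Rightarrow> real" where
  "ravg M f t = (\<integral>p. indicator {0..t} (snd p) * f p \<partial>M) / (\<integral>p. indicator {0..t} (snd p) \<partial>M)"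

text \<open>Every MLP must follow an attention layer. Without heads only the residual connection is
  left, up to truncation to the first n registers.\<close>

definition idle_attn :: "nat \<Rightarrow> attn_params" where
  "idle_attn n = \<lparr>din = n, dhead = 1, kdim = 1, heads = []\<rparr>"

definition avg_attn :: "nat \<Rightarrow> nat \<Rightarrow> attn_params" where
  "avg_attn n c = \<lparr>din = n, dhead = 1, kdim = 1,
     heads = [(\<lambda>i j. if i = c then 1 else 0, \<lambda>i j. 0, \<lambda>i j. 0, \<lambda>i j. if j = c then 1 else 0)]\<rparr>"

lemma idle_attn_simps [simp]:
  "din (idle_attn n) = n" "dhead (idle_attn n) = 1" "kdim (idle_attn n) = 1" "heads (idle_attn n) = []"
  by (simp_all add: idle_attn_def)

lemma avg_attn_simps [simp]:
  "din (avg_attn n c) = n" "dhead (avg_attn n c) = 1" "kdim (avg_attn n c) = 1"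
  "heads (avg_attn n c) = [(\<lambda>i j. if i = c then 1 else 0, \<lambda>i j. 0, \<lambda>i j. 0, \<lambda>i j. if j = c then 1 else 0)]"
  by (simp_all add: avg_attn_def)

lemma attn_idle: "attn (idle_attn n) M x t = (\<lambda>i. if i < n then x i else 0)"
  by (simp add: attn_def fun_eq_iff)

lemma attn_avg:
  assumes "c < n"
  shows "attn (avg_attn n c) M x t =
    (\<lambda>i. if i < n then x i + (if i = c then ravg M (\<lambda>p. fst p c) t else 0) else 0)"
proof -
  have "(\<Sum>l<n. (if l = c then 1 else 0) * y l) = y c" for y :: vec
    using assms by (simp add: if_distrib[of "\<lambda>a. a * _"] cong: if_cong)
  then show ?thesis
    by (simp add: attn_def score_def ravg_def fun_eq_iff)
qed

abbreviation push :: "(pmeas \<Rightarrow> vec \<Rightarrow> real \<Rightarrow> vec) \<Rightarrow> pmeas \<Rightarrow> pmeas" where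
  "push u M \<equiv> distr M borel (\<lambda>(y, s). (u M y s, s))"

lemma measurable_coordinate [measurable]: "(\<lambda>x :: vec. x i) \<in> borel_measurable borel"
  by (rule borel_measurable_continuous_onI[OF continuous_on_product_coordinates])

text \<open>A deeper layer integrates against the measure transported by the earlier ones. Change of
  variables brings the average back to M and needs u M to be jointly measurable in point and
  time.\<close>

lemma ravg_push:
  assumes sets: "sets M = sets borel" and u: "(\<lambda>p. u M (fst p) (snd p)) \<in> borel_measurable borel"
  shows "ravg (push u M) (\<lambda>p. fst p c) t = ravg M (\<lambda>p. u M (fst p) (snd p) c) t"
proof -
  note sets[measurable_cong]
  have "(\<lambda>p. (u M (fst p) (snd p), snd p)) \<in> borel \<rightarrow>\<^sub>M borel \<Otimes>\<^sub>M borel"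
    by (intro measurable_Pair u measurable_snd_vec)
  then have pm: "(\<lambda>p. (u M (fst p) (snd p), snd p)) \<in> borel_measurable M"
    by (simp add: borel_prod measurable_cong_sets[OF sets refl])
  have [measurable]: "(\<lambda>p :: vec \<times> real. fst p c) \<in> borel_measurable borel"
    by (rule measurable_compose[OF measurable_fst_vec measurable_coordinate])
  have eq: "(\<integral>p. g p \<partial>push u M) = (\<integral>p. g (u M (fst p) (snd p), snd p) \<partial>M)"
    if "g \<in> borel_measurable borel" for g :: "vec \<times> real \<Rightarrow> real"
    by (subst integral_distr) (simp_all add: case_prod_unfold that pm)
  have "(\<lambda>p :: vec \<times> real. indicator {0..t} (snd p) * fst p c :: real) \<in> borel_measurable borel"
    "(\<lambda>p :: vec \<times> real. indicator {0..t} (snd p) :: real) \<in> borel_measurable borel"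
    by measurable
  from this[THEN eq]
  have "(\<integral>p. indicator {0..t} (snd p) * fst p c \<partial>push u M) =
      (\<integral>p. indicator {0..t} (snd p) * u M (fst p) (snd p) c \<partial>M)"
    "(\<integral>p. indicator {0..t} (snd p) \<partial>push u M) = (\<integral>p. indicator {0..t} (snd p) \<partial>M :: real)"
    by simp_all
  then show ?thesis by (simp add: ravg_def)
qed

lemma measurable_ravg:
  assumes "prob_space M" and sets: "sets M = sets borel" and f: "f \<in> borel_measurable borel"
  shows "ravg M f \<in> borel_measurable borel"
proof -
  interpret prob_space M by fact
  note sets[measurable_cong] f[measurable]
  \<comment> \<open>The integrand depends on the parameter t through the window, so joint
    measurability is obtained from the closed condition 0 \<le> s \<le> t.\<close>
  have [measurable]: "(\<lambda>(t, p). indicator {0..t} (snd p) * g p) \<in> borel_measurable (borel \<Otimes>\<^sub>M M)"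
    if g: "g \<in> borel_measurable M" for g :: "vec \<times> real \<Rightarrow> real"
  proof -
    note g[measurable]
    have "(\<lambda>q :: real \<times> vec \<times> real. if 0 \<le> snd (snd q) \<and> snd (snd q) \<le> fst q then g (snd q) else 0)
        \<in> borel_measurable (borel \<Otimes>\<^sub>M M)"
    proof (rule measurable_If)
      have [measurable]: "(\<lambda>q. snd (snd q)) \<in> borel_measurable (borel \<Otimes>\<^sub>M M)"
        by (rule measurable_compose[OF measurable_snd]) measurable
      show "{q \<in> space (borel \<Otimes>\<^sub>M M). 0 \<le> snd (snd q) \<and> snd (snd q) \<le> fst q} \<in> sets (borel \<Otimes>\<^sub>M M)"
        by measurable
    qed auto
    then show ?thesis
      by (rule measurable_cong[THEN iffD1, rotated]) (auto simp: indicator_def)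
  qed
  have "(\<lambda>t. \<integral>p. indicator {0..t} (snd p) * f p \<partial>M) \<in> borel_measurable borel"
    by (rule borel_measurable_lebesgue_integral) measurable
  moreover have "(\<lambda>t. \<integral>p. indicator {0..t} (snd p) * (1::real) \<partial>M) \<in> borel_measurable borel"
    by (rule borel_measurable_lebesgue_integral) measurable
  ultimately show ?thesis
    unfolding ravg_def by simp
qed

text \<open>Measurability is carried along because the next attention layer averages over
  \<open>push u M\<close>. A single head per layer is enough throughout.\<close>

definition net :: "nat \<Rightarrow> nat \<Rightarrow> nat \<Rightarrow> (pmeas \<Rightarrow> vec \<Rightarrow> real \<Rightarrow> vec) \<Rightarrow> bool" where
  "net W d m u \<longleftrightarrow> (\<exists>ls. compatible d m ls \<and>
     (\<forall>(\<theta>, \<xi>)\<in>set ls. din \<theta> \<le> W \<and> dhead \<theta> = 1 \<and> kdim \<theta> = 1 \<and> length (heads \<theta>) \<le> 1) \<and>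
     (\<forall>M. prob_space M \<longrightarrow> sets M = sets borel \<longrightarrow> tnet ls M = u M \<and>
        (\<lambda>p. u M (fst p) (snd p)) \<in> borel_measurable borel))"

lemma mcomp_mlp_map: "(mlp_map \<xi> \<diamond> G) M x t = mlp_map \<xi> M (G M x t) t"
  by (simp add: mcomp_def mlp_map_def)

lemma tnet_snoc:
  assumes "ls \<noteq> []"
  shows "tnet (ls @ [(\<theta>, \<xi>)]) = mlp_map \<xi> \<diamond> (attn \<theta> \<diamond> tnet ls)"
proof -
  have "tnet_aux G (ls @ [(\<theta>, \<xi>)]) = mlp_map \<xi> \<diamond> (attn \<theta> \<diamond> tnet_aux G ls)" for G ls
    by (induction ls arbitrary: G) auto
  then show ?thesis
    using assms by (cases ls) auto
qed

lemma compatible_snoc: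
  assumes "compatible d n ls" "din \<theta> = n" "mlp_ok \<xi> n m"
  shows "compatible d m (ls @ [(\<theta>, \<xi>)])"
  unfolding compatible_def
proof (intro conjI allI impI)
  have ls: "ls \<noteq> []" using assms(1) by (simp add: compatible_def)
  show "ls @ [(\<theta>, \<xi>)] \<noteq> []" by simp
  show "din (fst ((ls @ [(\<theta>, \<xi>)]) ! 0)) = d"
    using assms(1) ls by (simp add: compatible_def nth_append)
  fix i assume "i < length (ls @ [(\<theta>, \<xi>)])"
  then consider "Suc i < length ls" | "Suc i = length ls" | "i = length ls" by fastforce
  then show "mlp_ok (snd ((ls @ [(\<theta>, \<xi>)]) ! i)) (din (fst ((ls @ [(\<theta>, \<xi>)]) ! i)))
      (if Suc i < length (ls @ [(\<theta>, \<xi>)]) then din (fst ((ls @ [(\<theta>, \<xi>)]) ! Suc i)) else m)"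
  proof cases
    case 1
    then have "mlp_ok (snd (ls ! i)) (din (fst (ls ! i))) (din (fst (ls ! Suc i)))"
      using assms(1) by (auto simp: compatible_def dest!: spec[of _ i])
    then show ?thesis using 1 by (simp add: nth_append)
  next
    case 2
    then have "mlp_ok (snd (ls ! i)) (din (fst (ls ! i))) n"
      using assms(1) by (auto simp: compatible_def dest!: spec[of _ i])
    then show ?thesis using 2 assms(2) by (simp add: nth_append)
  next
    case 3
    then show ?thesis using assms by (simp add: nth_append)
  qed
qed

text \<open>The hypothesis on v may use the measurability of u, which the change of variables in the
  new attention layer requires.\<close>

lemma net_snoc:
  assumes u: "net W d n u" and \<theta>: "din \<theta> = n" "n \<le> W" "dhead \<theta> = 1" "kdim \<theta> = 1" "length (heads \<theta>) \<le> 1"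
    and \<xi>: "mlp_ok \<xi> n m"
    and v: "\<And>M. prob_space M \<Longrightarrow> sets M = sets borel \<Longrightarrow> (\<lambda>p. u M (fst p) (snd p)) \<in> borel_measurable borel \<Longrightarrow>
      (\<forall>x t. mlp_map \<xi> M (attn \<theta> (push u M) (u M x t) t) t = v M x t) \<and>
      (\<lambda>p. v M (fst p) (snd p)) \<in> borel_measurable borel"
  shows "net W d m v"
proof -
  obtain ls where ls: "compatible d n ls"
    "\<forall>(\<theta>, \<xi>)\<in>set ls. din \<theta> \<le> W \<and> dhead \<theta> = 1 \<and> kdim \<theta> = 1 \<and> length (heads \<theta>) \<le> 1"
    and tn: "\<And>M. prob_space M \<Longrightarrow> sets M = sets borel \<Longrightarrow> tnet ls M = u M \<and>
        (\<lambda>p. u M (fst p) (snd p)) \<in> borel_measurable borel"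
    using u unfolding net_def by blast
  have "tnet (ls @ [(\<theta>, \<xi>)]) M = v M \<and> (\<lambda>p. v M (fst p) (snd p)) \<in> borel_measurable borel"
    if M: "prob_space M" "sets M = sets borel" for M
  proof -
    have "ls \<noteq> []" using ls(1) by (simp add: compatible_def)
    then have "tnet (ls @ [(\<theta>, \<xi>)]) M x t = mlp_map \<xi> M (attn \<theta> (push u M) (u M x t) t) t" for x t
      using tn[OF M] by (simp add: tnet_snoc mcomp_mlp_map) (simp add: mcomp_def)
    then show ?thesis
      using v[OF M] tn[OF M] by (auto simp: fun_eq_iff)
  qed
  then show ?thesis
    unfolding net_def using compatible_snoc[OF ls(1) \<theta>(1) \<xi>] ls(2) \<theta>
    by (intro exI[of _ "ls @ [(\<theta>, \<xi>)]"]) auto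
qed

lemma measurable_vecI:
  fixes f :: "'a \<Rightarrow> vec"
  assumes "\<And>i. (\<lambda>x. f x i) \<in> borel_measurable M"
  shows "f \<in> borel_measurable M"
  using assms by (rule measurable_coordinatewise_then_product)

lemma net_mlp:
  assumes u: "net W d n u" and "n \<le> W" and F: "\<And>i. i < m \<Longrightarrow> relu_sum n (F i)"
  shows "net W d m (\<lambda>M x t i. if i < m then F i (u M x t) else 0)"
proof -
  obtain \<xi> where \<xi>: "mlp_ok \<xi> n m" "\<And>M x t. mlp_map \<xi> M x t = (\<lambda>i. if i < m then F i x else 0)"
    using relu_sum_mlp[of m n F] F by blast
  show ?thesis
  proof (rule net_snoc[OF u, of "idle_attn n" \<xi>])
    fix M :: pmeas assume u: "(\<lambda>p. u M (fst p) (snd p)) \<in> borel_measurable borel"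
    have "F i (\<lambda>j. if j < n then y j else 0) = F i y" if "i < m" for i y
      by (rule relu_sum_cong[OF F[OF that]]) simp
    moreover have "(\<lambda>p. \<lambda>i. if i < m then F i (u M (fst p) (snd p)) else 0) \<in> borel_measurable borel"
    proof (rule measurable_vecI)
      show "(\<lambda>p. if i < m then F i (u M (fst p) (snd p)) else 0) \<in> borel_measurable borel" for i
        using measurable_compose[OF u relu_sum_measurable[OF F]] by (cases "i < m") auto
    qed
    ultimately show "(\<forall>x t. mlp_map \<xi> M (attn (idle_attn n) (push u M) (u M x t) t) t =
        (\<lambda>i. if i < m then F i (u M x t) else 0)) \<and>
        (\<lambda>p. \<lambda>i. if i < m then F i (u M (fst p) (snd p)) else 0) \<in> borel_measurable borel"
      by (auto simp: \<xi>(2) attn_idle fun_eq_iff)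
  qed (use \<xi> \<open>n \<le> W\<close> in auto)
qed

lemma net_init:
  assumes "d \<le> W" and F: "\<And>i. i < m \<Longrightarrow> relu_sum d (F i)"
  shows "net W d m (\<lambda>M x t i. if i < m then F i x else 0)"
proof -
  obtain \<xi> where \<xi>: "mlp_ok \<xi> d m" "\<And>M x t. mlp_map \<xi> M x t = (\<lambda>i. if i < m then F i x else 0)"
    using relu_sum_mlp[of m d F] F by blast
  have "F i (\<lambda>j. if j < d then y j else 0) = F i y" if "i < m" for i y
    by (rule relu_sum_cong[OF F[OF that]]) simp
  then have "tnet [(idle_attn d, \<xi>)] M = (\<lambda>x t i. if i < m then F i x else 0)" for M
    by (auto simp: mcomp_mlp_map \<xi>(2) attn_idle fun_eq_iff)
  moreover have "(\<lambda>p :: vec \<times> real. \<lambda>i. if i < m then F i (fst p) else 0) \<in> borel_measurable borel"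
  proof (rule measurable_vecI)
    show "(\<lambda>p :: vec \<times> real. if i < m then F i (fst p) else 0) \<in> borel_measurable borel" for i
      using measurable_compose[OF measurable_fst_vec relu_sum_measurable[OF F]] by (cases "i < m") auto
  qed
  ultimately show ?thesis
    unfolding net_def using \<xi>(1) \<open>d \<le> W\<close>
    by (intro exI[of _ "[(idle_attn d, \<xi>)]"]) (auto simp: compatible_def)
qed

text \<open>The head delivers c + avg c because of its residual connection; the factor 1/2 supplied
  by the following MLP turns this into a mean of the register and its running average.\<close>

definition half_avg :: "nat \<Rightarrow> (pmeas \<Rightarrow> vec \<Rightarrow> real \<Rightarrow> vec) \<Rightarrow> pmeas \<Rightarrow> vec \<Rightarrow> real \<Rightarrow> vec" where
  "half_avg c u M x t = (u M x t)(c := (u M x t c + ravg M (\<lambda>p. u M (fst p) (snd p) c) t) / 2)"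

lemma net_half_avg:
  assumes u: "net W d n u" and "n \<le> W" "c < n"
  shows "net W d n (\<lambda>M x t i. if i < n then half_avg c u M x t i else 0)"
proof -
  \<comment> \<open>The identity matrix with 1/2 in place of the diagonal entry at c: all other
    registers pass unchanged.\<close>
  define w where "w i j = (if j = i then (if i = c then 1/2 else 1) else 0 :: real)" for i j :: nat
  define F where "F i x = (\<Sum>j<n. w i j * x j) + 0" for i and x :: vec
  have F: "F i x = (if i = c then 1/2 else 1) * x i" if "i < n" for i x
    using that by (simp add: F_def w_def if_distrib[of "\<lambda>a. a * _"] cong: if_cong)
  have "relu_sum n (F i)" for i
    unfolding F_def[abs_def] by (rule relu_sum_affine)
  then obtain \<xi> where \<xi>: "mlp_ok \<xi> n n" "\<And>M x t. mlp_map \<xi> M x t = (\<lambda>i. if i < n then F i x else 0)"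
    using relu_sum_mlp[of n n F] by blast
  show ?thesis
  proof (rule net_snoc[OF u, of "avg_attn n c" \<xi>])
    fix M :: pmeas assume M: "prob_space M" "sets M = sets borel"
      and um: "(\<lambda>p. u M (fst p) (snd p)) \<in> borel_measurable borel"
    have uc: "(\<lambda>p. u M (fst p) (snd p) i) \<in> borel_measurable borel" for i
      by (rule measurable_compose[OF um measurable_coordinate])
    have "(\<lambda>p :: vec \<times> real. ravg M (\<lambda>p. u M (fst p) (snd p) c) (snd p)) \<in> borel_measurable borel"
      by (rule measurable_compose[OF measurable_snd_vec measurable_ravg[OF M uc]])
    then have "(\<lambda>p. if i < n then half_avg c u M (fst p) (snd p) i else 0) \<in> borel_measurable borel" for i
      using uc by (cases "i < n"; cases "i = c") (simp_all add: half_avg_def)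
    then have "(\<lambda>p. \<lambda>i. if i < n then half_avg c u M (fst p) (snd p) i else 0) \<in> borel_measurable borel"
      by (rule measurable_vecI)
    then show "(\<forall>x t. mlp_map \<xi> M (attn (avg_attn n c) (push u M) (u M x t) t) t =
        (\<lambda>i. if i < n then half_avg c u M x t i else 0)) \<and>
        (\<lambda>p. \<lambda>i. if i < n then half_avg c u M (fst p) (snd p) i else 0) \<in> borel_measurable borel"
      using \<open>c < n\<close> by (auto simp: \<xi>(2) attn_avg F ravg_push[of M u, OF M(2) um] half_avg_def fun_eq_iff)
  qed (use \<xi> \<open>n \<le> W\<close> in auto)
qed

section \<open>Approximable register maps\<close>

text \<open>\<open>D\<close> counts the registers held between layers, \<open>W\<close> is the cap
  on the input dimension of the attention layers.\<close>

locale attention_machine =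
  fixes d D W :: nat and \<Omega> :: "vec set" and C \<sigma> :: real
  assumes compact_\<Omega>: "compact \<Omega>" and \<Omega>_Rn: "\<Omega> \<subseteq> Rn d"
    and \<sigma>: "0 < \<sigma>" "\<sigma> \<le> 1" and d_le_D: "d \<le> D" and D_le_W: "D \<le> W"
begin

abbreviation \<L> :: "pmeas set" where
  "\<L> \<equiv> LipCS d \<Omega> C \<sigma>"

lemma \<L>D:
  assumes "M \<in> \<L>"
  shows "prob_space M" "sets M = sets borel" "\<sigma> \<le> measure (tmarg M) {0}"
  using assms by (auto simp: LipCS_iff)

section \<open>Running averages over the class\<close>

lemma integrable_\<L>:
  fixes f :: "vec \<times> real \<Rightarrow> real"
  assumes M: "M \<in> \<L>" and f: "f \<in> borel_measurable borel"
    and b: "\<And>x s. x \<in> \<Omega> \<Longrightarrow> s \<in> {0..1} \<Longrightarrow> \<bar>f (x, s)\<bar> \<le> b"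
  shows "integrable M f" "integrable M (\<lambda>p. indicator {0..t} (snd p) * f p)"
proof -
  interpret prob_space M using \<L>D(1)[OF M] .
  note \<L>D(2)[OF M, measurable_cong] f[measurable]
  have AE: "AE p in M. \<bar>f p\<bar> \<le> b"
    using LipCS_AE[OF compact_\<Omega> M] by eventually_elim (use b in \<open>metis prod.collapse\<close>)
  show "integrable M f"
    by (rule integrable_const_bound[where B = b]) (use AE in auto)
  then show "integrable M (\<lambda>p. indicator {0..t} (snd p) * f p)"
    by (rule Bochner_Integration.integrable_bound) (auto simp: indicator_def)
qed

lemma weight_bounds:
  assumes M: "M \<in> \<L>" and "0 \<le> t"
  shows "\<sigma> \<le> (\<integral>p. indicator {0..t} (snd p) \<partial>M)" "(\<integral>p. indicator {0..t} (snd p) \<partial>M) \<le> (1::real)"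
proof -
  interpret prob_space M using \<L>D(1)[OF M] .
  note \<L>D(2)[OF M, measurable_cong]
  have int: "integrable M (\<lambda>p. indicator {0..s} (snd p) :: real)" for s
    by (rule integrable_const_bound[where B = 1]) auto
  have "\<sigma> \<le> (\<integral>p. indicator {0..0} (snd p) \<partial>M)"
    using measure_tmarg_zero[OF \<L>D(1,2)[OF M]] \<L>D(3)[OF M] by simp
  also have "\<dots> \<le> (\<integral>p. indicator {0..t} (snd p) \<partial>M)"
    using \<open>0 \<le> t\<close> by (intro integral_mono int) (auto simp: indicator_def)
  finally show "\<sigma> \<le> (\<integral>p. indicator {0..t} (snd p) \<partial>M)" .
  have "(\<integral>p. indicator {0..t} (snd p) \<partial>M) \<le> (\<integral>p. 1 \<partial>M :: real)"
    by (intro integral_mono int) (auto simp: indicator_def)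
  then show "(\<integral>p. indicator {0..t} (snd p) \<partial>M) \<le> (1::real)"
    by (simp add: prob_space)
qed

lemma integral_window_le:
  fixes f :: "vec \<times> real \<Rightarrow> real"
  assumes M: "M \<in> \<L>" and f: "f \<in> borel_measurable borel" and "0 \<le> b" "r \<le> t" "0 \<le> r"
    and b: "\<And>x s. x \<in> \<Omega> \<Longrightarrow> s \<in> {0..1} \<Longrightarrow> \<bar>f (x, s)\<bar> \<le> b"
  shows "\<bar>(\<integral>p. indicator {0..t} (snd p) * f p \<partial>M) - (\<integral>p. indicator {0..r} (snd p) * f p \<partial>M)\<bar>
    \<le> b * ((\<integral>p. indicator {0..t} (snd p) \<partial>M) - (\<integral>p. indicator {0..r} (snd p) \<partial>M))"
proof -
  interpret prob_space M using \<L>D(1)[OF M] .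
  note \<L>D(2)[OF M, measurable_cong] f[measurable]
  have int: "integrable M (\<lambda>p. indicator {0..s} (snd p) * f p)" for s
    by (rule integrable_\<L>(2)[OF M f b])
  have int1: "integrable M (\<lambda>p. indicator {0..s} (snd p) :: real)" for s
    by (rule integrable_const_bound[where B = 1]) auto
  have "\<bar>(\<integral>p. indicator {0..t} (snd p) * f p \<partial>M) - (\<integral>p. indicator {0..r} (snd p) * f p \<partial>M)\<bar>
      = \<bar>\<integral>p. indicator {0..t} (snd p) * f p - indicator {0..r} (snd p) * f p \<partial>M\<bar>"
    using int by simp
  also have "\<dots> \<le> (\<integral>p. \<bar>indicator {0..t} (snd p) * f p - indicator {0..r} (snd p) * f p\<bar> \<partial>M)"
    by (rule integral_abs_bound)
  also have "\<dots> \<le> (\<integral>p. b * (indicator {0..t} (snd p) - indicator {0..r} (snd p)) \<partial>M)"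
  proof (rule integral_mono_AE)
    show "AE p in M. \<bar>indicator {0..t} (snd p) * f p - indicator {0..r} (snd p) * f p\<bar>
        \<le> b * (indicator {0..t} (snd p) - indicator {0..r} (snd p))"
      using LipCS_AE[OF compact_\<Omega> M]
    proof eventually_elim
      case (elim p)
      then have "\<bar>f p\<bar> \<le> b" using b[of "fst p" "snd p"] by simp
      then show ?case using \<open>r \<le> t\<close> by (auto simp: indicator_def)
    qed
  qed (use int int1 in auto)
  also have "\<dots> = b * ((\<integral>p. indicator {0..t} (snd p) \<partial>M) - (\<integral>p. indicator {0..r} (snd p) \<partial>M))"
    using int1 by simp
  finally show ?thesis .
qed

text \<open>Running averages are nonexpansive in the supremum over \<Omega> times [0, 1]. Comparison
  with the zero function gives bounds, and e = 0 transfers equalities that are only known on that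
  set.\<close>

lemma ravg_diff_le:
  fixes f g :: "vec \<times> real \<Rightarrow> real"
  assumes M: "M \<in> \<L>" and f: "f \<in> borel_measurable borel" and g: "g \<in> borel_measurable borel" and "0 \<le> t"
    and bf: "\<And>x s. x \<in> \<Omega> \<Longrightarrow> s \<in> {0..1} \<Longrightarrow> \<bar>f (x, s)\<bar> \<le> B"
    and bg: "\<And>x s. x \<in> \<Omega> \<Longrightarrow> s \<in> {0..1} \<Longrightarrow> \<bar>g (x, s)\<bar> \<le> B'"
    and e: "\<And>x s. x \<in> \<Omega> \<Longrightarrow> s \<in> {0..1} \<Longrightarrow> \<bar>f (x, s) - g (x, s)\<bar> \<le> e"
  shows "\<bar>ravg M f t - ravg M g t\<bar> \<le> e"
proof -
  interpret prob_space M using \<L>D(1)[OF M] .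
  note \<L>D(2)[OF M, measurable_cong] f[measurable] g[measurable]
  define A where "A = (\<integral>p. indicator {0..t} (snd p) \<partial>M :: real)"
  have "0 < A" using weight_bounds(1)[OF M \<open>0 \<le> t\<close>] \<sigma> by (simp add: A_def)
  have int: "integrable M (\<lambda>p. indicator {0..t} (snd p) * f p)" "integrable M (\<lambda>p. indicator {0..t} (snd p) * g p)"
    using integrable_\<L>(2)[OF M f bf] integrable_\<L>(2)[OF M g bg] by auto
  have int1: "integrable M (\<lambda>p. indicator {0..t} (snd p) :: real)"
    by (rule integrable_const_bound[where B = 1]) auto
  have "\<bar>(\<integral>p. indicator {0..t} (snd p) * f p \<partial>M) - (\<integral>p. indicator {0..t} (snd p) * g p \<partial>M)\<bar>
      = \<bar>\<integral>p. indicator {0..t} (snd p) * f p - indicator {0..t} (snd p) * g p \<partial>M\<bar>"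
    using int by simp
  also have "\<dots> \<le> (\<integral>p. \<bar>indicator {0..t} (snd p) * f p - indicator {0..t} (snd p) * g p\<bar> \<partial>M)"
    by (rule integral_abs_bound)
  also have "\<dots> \<le> (\<integral>p. e * indicator {0..t} (snd p) \<partial>M)"
  proof (rule integral_mono_AE)
    show "AE p in M. \<bar>indicator {0..t} (snd p) * f p - indicator {0..t} (snd p) * g p\<bar> \<le> e * indicator {0..t} (snd p)"
      using LipCS_AE[OF compact_\<Omega> M]
    proof eventually_elim
      case (elim p)
      then have "\<bar>f p - g p\<bar> \<le> e" using e[of "fst p" "snd p"] by simp
      then show ?case by (auto simp: indicator_def)
    qed
  qed (use int int1 in auto)
  also have "\<dots> = e * A"
    by (simp add: A_def)
  finally have le: "\<bar>(\<integral>p. indicator {0..t} (snd p) * f p \<partial>M) - (\<integral>p. indicator {0..t} (snd p) * g p \<partial>M)\<bar> \<le> e * A" .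
  have "ravg M f t - ravg M g t =
      ((\<integral>p. indicator {0..t} (snd p) * f p \<partial>M) - (\<integral>p. indicator {0..t} (snd p) * g p \<partial>M)) / A"
    by (simp add: ravg_def A_def diff_divide_distrib)
  then show ?thesis
    using le \<open>0 < A\<close> by (simp add: pos_divide_le_eq)
qed

text \<open>The mass at time \<open>0\<close> contributes exactly \<open>m\<close> to each running average, whence the
  contraction factor \<open>1 - \<sigma>\<close>.\<close>

lemma ravg_contract:
  fixes f :: "vec \<times> real \<Rightarrow> real"
  assumes M: "M \<in> \<L>" and f: "f \<in> borel_measurable borel" and "0 \<le> b" and t: "t \<in> {0..1}"
    and b: "\<And>x s. x \<in> \<Omega> \<Longrightarrow> s \<in> {0..1} \<Longrightarrow> \<bar>f (x, s) - m\<bar> \<le> b"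
    and m: "ravg M f 0 = m"
  shows "\<bar>ravg M f t - m\<bar> \<le> (1 - \<sigma>) * b"
proof -
  interpret prob_space M using \<L>D(1)[OF M] .
  note \<L>D(2)[OF M, measurable_cong] f[measurable]
  define A where "A s = (\<integral>p. indicator {0..s} (snd p) \<partial>M :: real)" for s
  define g where "g p = f p - m" for p
  have g[measurable]: "g \<in> borel_measurable borel"
    unfolding g_def by measurable
  have A: "\<sigma> \<le> A s" "A s \<le> 1" "0 < A s" if "0 \<le> s" for s
    using weight_bounds[OF M that] \<sigma> by (auto simp: A_def)
  have "\<bar>f (x, s)\<bar> \<le> b + \<bar>m\<bar>" if "x \<in> \<Omega>" "s \<in> {0..1}" for x s
    using b[OF that] by linarith
  then have int: "integrable M (\<lambda>p. indicator {0..s} (snd p) * f p)" for s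
    by (rule integrable_\<L>(2)[OF M f])
  have int1: "integrable M (\<lambda>p. indicator {0..s} (snd p) :: real)" for s
    by (rule integrable_const_bound[where B = 1]) auto
  have G: "(\<integral>p. indicator {0..s} (snd p) * g p \<partial>M) = (ravg M f s - m) * A s" if "0 \<le> s" for s
  proof -
    have "(\<integral>p. indicator {0..s} (snd p) * g p \<partial>M) =
        (\<integral>p. indicator {0..s} (snd p) * f p - m * indicator {0..s} (snd p) \<partial>M)"
      by (rule Bochner_Integration.integral_cong) (auto simp: g_def algebra_simps)
    also have "\<dots> = (\<integral>p. indicator {0..s} (snd p) * f p \<partial>M) - m * A s"
      using int int1 by (simp add: A_def)
    also have "\<dots> = (ravg M f s - m) * A s"
      using A(3)[OF that] by (simp add: ravg_def A_def[symmetric] left_diff_distrib)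
    finally show ?thesis .
  qed
  \<comment> \<open>The centred function g has zero integral over time 0 because m is the mean
    there, so only the mass A t - A 0 of later times can contribute.\<close>
  have "\<bar>(\<integral>p. indicator {0..t} (snd p) * g p \<partial>M) - (\<integral>p. indicator {0..0} (snd p) * g p \<partial>M)\<bar> \<le> b * (A t - A 0)"
    unfolding A_def by (rule integral_window_le[OF M g \<open>0 \<le> b\<close>]) (use b t in \<open>auto simp: g_def\<close>)
  then have "\<bar>(ravg M f t - m) * A t - (ravg M f 0 - m) * A 0\<bar> \<le> b * (A t - A 0)"
    using G[of t] G[of 0] t by (simp only: atLeastAtMost_iff order_refl)
  then have "\<bar>ravg M f t - m\<bar> * A t \<le> b * (A t - A 0)"
    using A(3)[of t] t m by (simp add: abs_mult)
  also have "\<dots> \<le> b * ((1 - \<sigma>) * A t)"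
  proof (rule mult_left_mono[OF _ \<open>0 \<le> b\<close>])
    \<comment> \<open>From A 0 \<ge> \<sigma> and A t \<le> 1 follows A t - A 0 \<le> A t - \<sigma>
      \<le> (1 - \<sigma>) A t.\<close>
    have "\<sigma> * A t \<le> \<sigma> * 1"
      using A(2)[of t] t \<sigma> by (intro mult_left_mono) auto
    then show "A t - A 0 \<le> (1 - \<sigma>) * A t"
      using A(1)[of 0] by (simp add: left_diff_distrib)
  qed
  finally have "\<bar>ravg M f t - m\<bar> * A t \<le> ((1 - \<sigma>) * b) * A t"
    by (simp add: mult.assoc mult.left_commute)
  then show ?thesis
    using A(3)[of t] t by simp
qed

text \<open>On the particles with time 0 the inner average is the constant
  \<open>ravg M f 0\<close>, so averaging it in does not move their mean.\<close>

lemma ravg_half_avg_zero: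
  fixes f :: "vec \<times> real \<Rightarrow> real"
  assumes M: "M \<in> \<L>" and f: "f \<in> borel_measurable borel"
    and b: "\<And>x s. x \<in> \<Omega> \<Longrightarrow> s \<in> {0..1} \<Longrightarrow> \<bar>f (x, s)\<bar> \<le> b"
  shows "ravg M (\<lambda>p. (f p + ravg M f (snd p)) / 2) 0 = ravg M f 0"
proof -
  interpret prob_space M using \<L>D(1)[OF M] .
  note \<L>D(2)[OF M, measurable_cong] f[measurable]
  define A where "A = (\<integral>p. indicator {0..0} (snd p) \<partial>M :: real)"
  have "0 < A" using weight_bounds(1)[OF M, of 0] \<sigma> by (simp add: A_def)
  have int: "integrable M (\<lambda>p. indicator {0..0} (snd p) * f p)"
    by (rule integrable_\<L>(2)[OF M f b])
  have int1: "integrable M (\<lambda>p. indicator {0..0} (snd p) :: real)"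
    by (rule integrable_const_bound[where B = 1]) auto
  have "(\<integral>p. indicator {0..0} (snd p) * ((f p + ravg M f (snd p)) / 2) \<partial>M) =
      (\<integral>p. indicator {0..0} (snd p) * f p / 2 + ravg M f 0 / 2 * indicator {0..0} (snd p) \<partial>M)"
    by (rule Bochner_Integration.integral_cong) (auto simp: indicator_def add_divide_distrib)
  also have "\<dots> = (\<integral>p. indicator {0..0} (snd p) * f p \<partial>M) / 2 + ravg M f 0 / 2 * A"
    using int int1 by (simp add: A_def)
  also have "(\<integral>p. indicator {0..0} (snd p) * f p \<partial>M) = ravg M f 0 * A"
    using \<open>0 < A\<close> unfolding ravg_def A_def by simp
  finally have "(\<integral>p. indicator {0..0} (snd p) * ((f p + ravg M f (snd p)) / 2) \<partial>M) / A = ravg M f 0"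
    using \<open>0 < A\<close> by (simp add: field_simps)
  then show ?thesis
    unfolding A_def ravg_def[of M "\<lambda>p. (f p + ravg M f (snd p)) / 2"] .
qed

text \<open>The exact map u need not be a network. Its bound provides the box on which the next
  update is approximated, and its measurability permits running averages of u itself. Only the first
  D registers are constrained.\<close>

definition appr :: "(pmeas \<Rightarrow> vec \<Rightarrow> real \<Rightarrow> vec) \<Rightarrow> bool" where
  "appr u \<longleftrightarrow> (\<exists>B. \<forall>M\<in>\<L>. \<forall>x\<in>\<Omega>. \<forall>t\<in>{0..1}. \<forall>i<D. \<bar>u M x t i\<bar> \<le> B) \<and>
     (\<forall>M\<in>\<L>. \<forall>i<D. (\<lambda>p. u M (fst p) (snd p) i) \<in> borel_measurable borel) \<and>
     (\<forall>e>0. \<exists>v. net W d D v \<and> (\<forall>M\<in>\<L>. \<forall>x\<in>\<Omega>. \<forall>t\<in>{0..1}. \<forall>i<D. \<bar>v M x t i - u M x t i\<bar> \<le> e))"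

lemma appr_bound:
  assumes "appr u"
  obtains B where "0 \<le> B" "\<And>M x t i. M \<in> \<L> \<Longrightarrow> x \<in> \<Omega> \<Longrightarrow> t \<in> {0..1} \<Longrightarrow> i < D \<Longrightarrow> \<bar>u M x t i\<bar> \<le> B"
proof -
  obtain B where B: "\<forall>M\<in>\<L>. \<forall>x\<in>\<Omega>. \<forall>t\<in>{0..1}. \<forall>i<D. \<bar>u M x t i\<bar> \<le> B"
    using assms unfolding appr_def by blast
  show ?thesis
    by (rule that[of "\<bar>B\<bar>"]) (use B in \<open>auto intro: order_trans[OF _ abs_ge_self]\<close>)
qed

lemma appr_measurable:
  assumes "appr u" "M \<in> \<L>" "i < D"
  shows "(\<lambda>p. u M (fst p) (snd p) i) \<in> borel_measurable borel"
  using assms unfolding appr_def by blast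

lemma appr_net:
  assumes "appr u" "0 < e"
  obtains v where "net W d D v"
    "\<And>M x t i. M \<in> \<L> \<Longrightarrow> x \<in> \<Omega> \<Longrightarrow> t \<in> {0..1} \<Longrightarrow> i < D \<Longrightarrow> \<bar>v M x t i - u M x t i\<bar> \<le> e"
proof -
  obtain v where "net W d D v \<and> (\<forall>M\<in>\<L>. \<forall>x\<in>\<Omega>. \<forall>t\<in>{0..1}. \<forall>i<D. \<bar>v M x t i - u M x t i\<bar> \<le> e)"
    using assms unfolding appr_def by blast
  then show ?thesis using that[of v] by blast
qed

lemma net_measurable:
  assumes "net W d m v" "M \<in> \<L>"
  shows "(\<lambda>p. v M (fst p) (snd p) i) \<in> borel_measurable borel"
proof -
  have "(\<lambda>p. v M (fst p) (snd p)) \<in> borel_measurable borel"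
    using assms \<L>D[OF assms(2)] unfolding net_def by blast
  then show ?thesis
    by (rule measurable_compose[OF _ measurable_coordinate])
qed

lemma appr_init: "appr (\<lambda>M x t i. if i < d then x i else 0)"
  unfolding appr_def
proof (intro conjI allI impI ballI)
  obtain R where R: "\<And>x i. x \<in> \<Omega> \<Longrightarrow> \<bar>x i\<bar> \<le> R i" "\<And>i. 0 \<le> R i"
    using compact_vec_coordinate_bound[OF compact_\<Omega>] by blast
  have "\<bar>if i < d then x i else 0\<bar> \<le> (\<Sum>j<d. R j)" if "x \<in> \<Omega>" for x i
  proof (cases "i < d")
    case True
    then have "R i \<le> (\<Sum>j<d. R j)"
      using R(2) by (intro member_le_sum) auto
    then show ?thesis using R(1)[OF that, of i] True by simp
  qed (simp add: R(2) sum_nonneg)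
  then show "\<exists>B. \<forall>M\<in>\<L>. \<forall>x\<in>\<Omega>. \<forall>t\<in>{0..1::real}. \<forall>i<D. \<bar>if i < d then x i else 0\<bar> \<le> B"
    by blast
  show "(\<lambda>p :: vec \<times> real. if i < d then fst p i else 0) \<in> borel_measurable borel" for i
    using measurable_compose[OF measurable_fst_vec measurable_coordinate[of i]] by (cases "i < d") auto
  fix e :: real assume "0 < e"
  define F where "F i x = (\<Sum>j<d. (if j = i then 1 else 0) * x j) + 0" for i and x :: vec
  have F: "F i x = (if i < d then x i else 0)" for i x
    by (simp add: F_def if_distrib[of "\<lambda>a. a * _"] cong: if_cong)
  have "net W d D (\<lambda>M x t i. if i < D then F i x else 0)"
    unfolding F_def using d_le_D D_le_W by (intro net_init relu_sum_affine) auto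
  then show "\<exists>v. net W d D v \<and> (\<forall>M\<in>\<L>. \<forall>x\<in>\<Omega>. \<forall>t\<in>{0..1}. \<forall>i<D. \<bar>v M x t i - (if i < d then x i else 0)\<bar> \<le> e)"
    using \<open>0 < e\<close> by (intro exI[of _ "\<lambda>M x t i. if i < D then F i x else 0"]) (auto simp: F)
qed

text \<open>\<open>box_approx\<close> fixes the admissible input error \<delta> before the network
  for u is chosen with that accuracy, so errors never have to be tracked through several
  layers.\<close>

lemma appr_update:
  assumes u: "appr u" and F: "\<And>i. i < D \<Longrightarrow> box_approx D (F i)"
  shows "appr (\<lambda>M x t i. F i (u M x t))"
  unfolding appr_def
proof (intro conjI allI impI ballI)
  obtain B where B: "0 \<le> B" "\<And>M x t i. M \<in> \<L> \<Longrightarrow> x \<in> \<Omega> \<Longrightarrow> t \<in> {0..1} \<Longrightarrow> i < D \<Longrightarrow> \<bar>u M x t i\<bar> \<le> B"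
    using appr_bound[OF u] by blast
  have "\<exists>b. \<forall>y. (\<forall>j<D. \<bar>y j\<bar> \<le> B) \<longrightarrow> \<bar>F i y\<bar> \<le> b" if "i < D" for i
    using box_approx_bounded[OF F[OF that], of B] by metis
  then obtain b where b: "\<And>i y. i < D \<Longrightarrow> (\<forall>j<D. \<bar>y j\<bar> \<le> B) \<Longrightarrow> \<bar>F i y\<bar> \<le> b i"
    by metis
  have "\<bar>F i (u M x t)\<bar> \<le> (\<Sum>j<D. \<bar>b j\<bar>)" if "M \<in> \<L>" "x \<in> \<Omega>" "t \<in> {0..1}" "i < D" for M x t i
  proof -
    have "\<bar>F i (u M x t)\<bar> \<le> b i" using that B by (intro b) auto
    also have "\<dots> \<le> \<bar>b i\<bar>" by simp
    also have "\<dots> \<le> (\<Sum>j<D. \<bar>b j\<bar>)" using that by (intro member_le_sum) auto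
    finally show ?thesis .
  qed
  then show "\<exists>B. \<forall>M\<in>\<L>. \<forall>x\<in>\<Omega>. \<forall>t\<in>{0..1}. \<forall>i<D. \<bar>F i (u M x t)\<bar> \<le> B"
    by blast
next
  fix M i assume M: "M \<in> \<L>" and i: "i < D"
  \<comment> \<open>Registers beyond \<open>D\<close> need not be measurable, so \<open>F i\<close> is composed with a truncation.\<close>
  have meas: "F i \<in> borel_measurable borel"
    using F[OF i] by (simp add: box_approx_def)
  \<comment> \<open>\<open>box_approx\<close> looks at the first D coordinates only, so one value
    \<open>g y\<close> is within a third of the supposed gap of both sides.\<close>
  have cong: "F i y = F i (\<lambda>j. if j < D then y j else 0)" for y
  proof (rule ccontr)
    assume ne: "F i y \<noteq> F i (\<lambda>j. if j < D then y j else 0)"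
    define z where "z = (\<lambda>j. if j < D then y j else 0)"
    define e where "e = \<bar>F i y - F i z\<bar> / 3"
    have "0 < e" using ne by (simp add: e_def z_def)
    then obtain g \<delta> where g: "0 < \<delta>"
      "\<And>x w. (\<forall>j<D. \<bar>x j\<bar> \<le> (\<Sum>j<D. \<bar>y j\<bar>) \<and> \<bar>w j - x j\<bar> \<le> \<delta>) \<Longrightarrow> \<bar>g w - F i x\<bar> \<le> e"
      using F[OF i] unfolding box_approx_def by blast
    have le: "\<bar>y j\<bar> \<le> (\<Sum>j<D. \<bar>y j\<bar>)" if "j < D" for j
      using that by (intro member_le_sum) auto
    have "\<bar>g y - F i y\<bar> \<le> e" "\<bar>g y - F i z\<bar> \<le> e"
      using le g(1) by (auto intro!: g(2) simp: z_def)
    moreover have "\<bar>F i y - F i z\<bar> = 3 * e" by (simp add: e_def)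
    ultimately show False using \<open>0 < e\<close> by linarith
  qed
  have "(\<lambda>p. \<lambda>j. if j < D then u M (fst p) (snd p) j else 0) \<in> borel_measurable borel"
  proof (rule measurable_vecI)
    show "(\<lambda>p. if j < D then u M (fst p) (snd p) j else 0) \<in> borel_measurable borel" for j
      using appr_measurable[OF u M] by (cases "j < D") auto
  qed
  from measurable_compose[OF this meas]
  show "(\<lambda>p. F i (u M (fst p) (snd p))) \<in> borel_measurable borel"
    by (simp flip: cong)
next
  fix e :: real assume "0 < e"
  obtain B where B: "0 \<le> B" "\<And>M x t i. M \<in> \<L> \<Longrightarrow> x \<in> \<Omega> \<Longrightarrow> t \<in> {0..1} \<Longrightarrow> i < D \<Longrightarrow> \<bar>u M x t i\<bar> \<le> B"
    using appr_bound[OF u] by blast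
  have "\<forall>i. \<exists>g \<delta>. i < D \<longrightarrow> relu_sum D g \<and> 0 < \<delta> \<and>
     (\<forall>x y. (\<forall>j<D. \<bar>x j\<bar> \<le> B \<and> \<bar>y j - x j\<bar> \<le> \<delta>) \<longrightarrow> \<bar>g y - F i x\<bar> \<le> e)"
    using F \<open>0 < e\<close> unfolding box_approx_def by blast
  then obtain g \<delta> where g: "\<And>i. i < D \<Longrightarrow> relu_sum D (g i)" "\<And>i. i < D \<Longrightarrow> 0 < \<delta> i"
    "\<And>i x y. i < D \<Longrightarrow> (\<forall>j<D. \<bar>x j\<bar> \<le> B \<and> \<bar>y j - x j\<bar> \<le> \<delta> i) \<Longrightarrow> \<bar>g i y - F i x\<bar> \<le> e"
    by metis
  \<comment> \<open>The inserted 1 keeps the minimum over a nonempty set when D = 0.\<close>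
  define \<delta>0 where "\<delta>0 = Min (insert 1 (\<delta> ` {..<D}))"
  have \<delta>0: "0 < \<delta>0" "\<And>i. i < D \<Longrightarrow> \<delta>0 \<le> \<delta> i"
    using g(2) by (auto simp: \<delta>0_def)
  obtain v where v: "net W d D v"
    "\<And>M x t i. M \<in> \<L> \<Longrightarrow> x \<in> \<Omega> \<Longrightarrow> t \<in> {0..1} \<Longrightarrow> i < D \<Longrightarrow> \<bar>v M x t i - u M x t i\<bar> \<le> \<delta>0"
    using appr_net[OF u \<delta>0(1)] by blast
  have "net W d D (\<lambda>M x t i. if i < D then g i (v M x t) else 0)"
    by (rule net_mlp[OF v(1) D_le_W g(1)])
  moreover have "\<bar>g i (v M x t) - F i (u M x t)\<bar> \<le> e" if "M \<in> \<L>" "x \<in> \<Omega>" "t \<in> {0..1}" "i < D" for M x t i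
  proof (rule g(3)[OF \<open>i < D\<close>], intro allI impI)
    fix j assume "j < D"
    then show "\<bar>u M x t j\<bar> \<le> B \<and> \<bar>v M x t j - u M x t j\<bar> \<le> \<delta> i"
      using B(2)[OF that(1-3)] v(2)[OF that(1-3)] \<delta>0(2)[OF that(4)] by fastforce
  qed
  ultimately show "\<exists>v. net W d D v \<and> (\<forall>M\<in>\<L>. \<forall>x\<in>\<Omega>. \<forall>t\<in>{0..1}. \<forall>i<D. \<bar>v M x t i - F i (u M x t)\<bar> \<le> e)"
    by (intro exI[of _ "\<lambda>M x t i. if i < D then g i (v M x t) else 0"]) auto
qed

end

section \<open>Means at time zero by iteration\<close>

context attention_machine
begin

text \<open>Three facts are carried through the iteration: the other registers are exactly
  unchanged, the mean at time 0 is preserved, and the distance to it shrinks geometrically. The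
  initial 2 B bounds a value plus a mean.\<close>

lemma half_avg_iterate:
  assumes v: "net W d D v" and c: "c < D" and "0 \<le> B"
    and B: "\<And>M x t. M \<in> \<L> \<Longrightarrow> x \<in> \<Omega> \<Longrightarrow> t \<in> {0..1} \<Longrightarrow> \<bar>v M x t c\<bar> \<le> B"
  shows "\<exists>w. net W d D w \<and> (\<forall>M\<in>\<L>. \<forall>x. \<forall>t. \<forall>i<D. i \<noteq> c \<longrightarrow> w M x t i = v M x t i) \<and>
    (\<forall>M\<in>\<L>. ravg M (\<lambda>p. w M (fst p) (snd p) c) 0 = ravg M (\<lambda>p. v M (fst p) (snd p) c) 0 \<and>
      (\<forall>x\<in>\<Omega>. \<forall>t\<in>{0..1}. \<bar>w M x t c - ravg M (\<lambda>p. v M (fst p) (snd p) c) 0\<bar> \<le> (1 - \<sigma> / 2) ^ k * (2 * B)))"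
proof (induction k)
  case 0
  have "\<bar>v M x t c - ravg M (\<lambda>p. v M (fst p) (snd p) c) 0\<bar> \<le> 2 * B"
    if M: "M \<in> \<L>" "x \<in> \<Omega>" "t \<in> {0..1}" for M x t
  proof -
    have "\<bar>ravg M (\<lambda>p. v M (fst p) (snd p) c) 0 - ravg M (\<lambda>_. 0) 0\<bar> \<le> B"
      using B[OF M(1)] by (intro ravg_diff_le[OF M(1) net_measurable[OF v M(1)], where B = B and B' = 0]) auto
    moreover have "ravg M (\<lambda>_. 0) 0 = 0" by (simp add: ravg_def)
    ultimately show ?thesis using B[OF M] by linarith
  qed
  then show ?case
    using v by (intro exI[of _ v]) simp
next
  case (Suc k)
  then obtain w where w: "net W d D w"
    and frame: "\<And>M x t i. M \<in> \<L> \<Longrightarrow> i < D \<Longrightarrow> i \<noteq> c \<Longrightarrow> w M x t i = v M x t i"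
    and mean: "\<And>M. M \<in> \<L> \<Longrightarrow> ravg M (\<lambda>p. w M (fst p) (snd p) c) 0 = ravg M (\<lambda>p. v M (fst p) (snd p) c) 0"
    and err: "\<And>M x t. M \<in> \<L> \<Longrightarrow> x \<in> \<Omega> \<Longrightarrow> t \<in> {0..1} \<Longrightarrow>
      \<bar>w M x t c - ravg M (\<lambda>p. v M (fst p) (snd p) c) 0\<bar> \<le> (1 - \<sigma> / 2) ^ k * (2 * B)"
    by blast
  define w' where "w' = (\<lambda>M x t i. if i < D then half_avg c w M x t i else 0)"
  have w': "net W d D w'"
    unfolding w'_def by (rule net_half_avg[OF w D_le_W c])
  have w'_c: "w' M x t c = (w M x t c + ravg M (\<lambda>p. w M (fst p) (snd p) c) t) / 2" for M x t
    using c by (simp add: w'_def half_avg_def)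
  have "w' M x t i = v M x t i" if "M \<in> \<L>" "i < D" "i \<noteq> c" for M x t i
    using that frame by (simp add: w'_def half_avg_def)
  moreover have "ravg M (\<lambda>p. w' M (fst p) (snd p) c) 0 = ravg M (\<lambda>p. v M (fst p) (snd p) c) 0 \<and>
      (\<forall>x\<in>\<Omega>. \<forall>t\<in>{0..1}. \<bar>w' M x t c - ravg M (\<lambda>p. v M (fst p) (snd p) c) 0\<bar> \<le> (1 - \<sigma> / 2) ^ Suc k * (2 * B))"
    if M: "M \<in> \<L>" for M
  proof (intro conjI ballI)
    define m where "m = ravg M (\<lambda>p. v M (fst p) (snd p) c) 0"
    define b where "b = (1 - \<sigma> / 2) ^ k * (2 * B)"
    have "0 \<le> b" using \<sigma> \<open>0 \<le> B\<close> by (simp add: b_def)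
    have err': "\<bar>w M x t c - m\<bar> \<le> b" if "x \<in> \<Omega>" "t \<in> {0..1}" for x t
      using err[OF M that] by (simp add: m_def b_def)
    have bound: "\<bar>w M x t c\<bar> \<le> b + \<bar>m\<bar>" if "x \<in> \<Omega>" "t \<in> {0..1}" for x t
      using err'[OF that] by linarith
    have wm: "(\<lambda>p. w M (fst p) (snd p) c) \<in> borel_measurable borel"
      by (rule net_measurable[OF w M])
    show "ravg M (\<lambda>p. w' M (fst p) (snd p) c) 0 = ravg M (\<lambda>p. v M (fst p) (snd p) c) 0"
      unfolding w'_c mean[OF M, symmetric]
      by (rule ravg_half_avg_zero[OF M wm, where b = "b + \<bar>m\<bar>"]) (use bound in simp)
    fix x t assume x: "x \<in> \<Omega>" and t: "t \<in> {0..1::real}"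
    have "\<bar>ravg M (\<lambda>p. w M (fst p) (snd p) c) t - m\<bar> \<le> (1 - \<sigma>) * b"
      by (rule ravg_contract[OF M wm \<open>0 \<le> b\<close> t]) (use err' mean[OF M] in \<open>simp_all add: m_def\<close>)
    \<comment> \<open>The register has error b and its running average has error (1 - \<sigma>) b;
      their midpoint has error (1 - \<sigma>/2) b.\<close>
    moreover have "\<bar>(A + R) / 2 - m\<bar> \<le> (b + b') / 2" if "\<bar>A - m\<bar> \<le> b" "\<bar>R - m\<bar> \<le> b'" for A R b'
      using that by (auto simp: abs_le_iff field_simps)
    ultimately have "\<bar>(w M x t c + ravg M (\<lambda>p. w M (fst p) (snd p) c) t) / 2 - m\<bar> \<le> (b + (1 - \<sigma>) * b) / 2"
      using err'[OF x t] by blast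
    also have "\<dots> = (1 - \<sigma> / 2) ^ Suc k * (2 * B)"
      by (simp add: b_def field_simps)
    finally show "\<bar>w' M x t c - ravg M (\<lambda>p. v M (fst p) (snd p) c) 0\<bar> \<le> (1 - \<sigma> / 2) ^ Suc k * (2 * B)"
      unfolding w'_c m_def .
  qed
  ultimately show ?case
    using w' by (intro exI[of _ w']) blast
qed

text \<open>The error splits into e/2 for replacing u by a network v, which averaging does not
  amplify, and e/2 for stopping the iteration on v after k rounds. As k depends only on \<sigma> and
  the bound, it is uniform over the class.\<close>

lemma appr_mean:
  assumes u: "appr u" and c: "c < D"
  shows "appr (\<lambda>M x t. (u M x t)(c := ravg M (\<lambda>p. u M (fst p) (snd p) c) 0))"
proof -
  define m where "m M = ravg M (\<lambda>p. u M (fst p) (snd p) c) 0" for M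
  obtain B where B: "0 \<le> B" "\<And>M x t i. M \<in> \<L> \<Longrightarrow> x \<in> \<Omega> \<Longrightarrow> t \<in> {0..1} \<Longrightarrow> i < D \<Longrightarrow> \<bar>u M x t i\<bar> \<le> B"
    using appr_bound[OF u] by blast
  have m: "\<bar>m M\<bar> \<le> B" if M: "M \<in> \<L>" for M
  proof -
    have "\<bar>m M - ravg M (\<lambda>_. 0) 0\<bar> \<le> B"
      unfolding m_def using B(2)[OF M] c
      by (intro ravg_diff_le[OF M appr_measurable[OF u M c], where B = B and B' = 0]) auto
    moreover have "ravg M (\<lambda>_. 0) 0 = 0" by (simp add: ravg_def)
    ultimately show ?thesis by simp
  qed
  have "appr (\<lambda>M x t. (u M x t)(c := m M))"
    unfolding appr_def
  proof (intro conjI allI impI ballI)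
    show "\<exists>B. \<forall>M\<in>\<L>. \<forall>x\<in>\<Omega>. \<forall>t\<in>{0..1}. \<forall>i<D. \<bar>((u M x t)(c := m M)) i\<bar> \<le> B"
      using B m by (intro exI[of _ B]) auto
    show "(\<lambda>p. ((u M (fst p) (snd p))(c := m M)) i) \<in> borel_measurable borel" if "M \<in> \<L>" "i < D" for M i
      using appr_measurable[OF u that] by (cases "i = c") auto
    fix e :: real assume "0 < e"
    obtain v where v: "net W d D v"
      "\<And>M x t i. M \<in> \<L> \<Longrightarrow> x \<in> \<Omega> \<Longrightarrow> t \<in> {0..1} \<Longrightarrow> i < D \<Longrightarrow> \<bar>v M x t i - u M x t i\<bar> \<le> e / 2"
      using appr_net[OF u, of "e / 2"] \<open>0 < e\<close> by auto
    have vB: "\<bar>v M x t c\<bar> \<le> B + e / 2" if "M \<in> \<L>" "x \<in> \<Omega>" "t \<in> {0..1}" for M x t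
      using v(2)[OF that c] B(2)[OF that c] by linarith
    have "(\<lambda>k. (1 - \<sigma> / 2) ^ k * (2 * (B + e / 2))) \<longlonglongrightarrow> 0 * (2 * (B + e / 2))"
      using \<sigma> by (intro tendsto_intros LIMSEQ_power_zero) auto
    then have "\<forall>\<^sub>F k in sequentially. (1 - \<sigma> / 2) ^ k * (2 * (B + e / 2)) < e / 2"
      using \<open>0 < e\<close> by (intro order_tendstoD(2)) auto
    then obtain k where k: "(1 - \<sigma> / 2) ^ k * (2 * (B + e / 2)) < e / 2"
      by (auto simp: eventually_sequentially)
    have "0 \<le> B + e / 2" using B(1) \<open>0 < e\<close> by simp
    then have "\<exists>w. net W d D w \<and> (\<forall>M\<in>\<L>. \<forall>x. \<forall>t. \<forall>i<D. i \<noteq> c \<longrightarrow> w M x t i = v M x t i) \<and>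
      (\<forall>M\<in>\<L>. ravg M (\<lambda>p. w M (fst p) (snd p) c) 0 = ravg M (\<lambda>p. v M (fst p) (snd p) c) 0 \<and>
        (\<forall>x\<in>\<Omega>. \<forall>t\<in>{0..1}. \<bar>w M x t c - ravg M (\<lambda>p. v M (fst p) (snd p) c) 0\<bar> \<le> (1 - \<sigma> / 2) ^ k * (2 * (B + e / 2))))"
      by (rule half_avg_iterate[OF v(1) c _ vB])
    then obtain w where w: "net W d D w"
      and frame: "\<And>M x t i. M \<in> \<L> \<Longrightarrow> i < D \<Longrightarrow> i \<noteq> c \<Longrightarrow> w M x t i = v M x t i"
      and err: "\<And>M x t. M \<in> \<L> \<Longrightarrow> x \<in> \<Omega> \<Longrightarrow> t \<in> {0..1} \<Longrightarrow>
        \<bar>w M x t c - ravg M (\<lambda>p. v M (fst p) (snd p) c) 0\<bar> \<le> (1 - \<sigma> / 2) ^ k * (2 * (B + e / 2))"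
      by blast
    have "\<bar>w M x t i - ((u M x t)(c := m M)) i\<bar> \<le> e" if M: "M \<in> \<L>" "x \<in> \<Omega>" "t \<in> {0..1}" "i < D" for M x t i
    proof (cases "i = c")
      case True
      have "\<bar>ravg M (\<lambda>p. v M (fst p) (snd p) c) 0 - m M\<bar> \<le> e / 2"
        unfolding m_def using vB[OF M(1)] B(2)[OF M(1)] v(2)[OF M(1)] c
        by (intro ravg_diff_le[OF M(1) net_measurable[OF v(1) M(1)] appr_measurable[OF u M(1) c],
              where B = "B + e / 2" and B' = B]) auto
      then have "\<bar>w M x t c - m M\<bar> \<le> e" using err[OF M(1-3)] k by linarith
      then show ?thesis using True by simp
    next
      case False
      then show ?thesis using frame[OF M(1,4)] v(2)[OF M] \<open>0 < e\<close> by simp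
    qed
    then show "\<exists>v. net W d D v \<and> (\<forall>M\<in>\<L>. \<forall>x\<in>\<Omega>. \<forall>t\<in>{0..1}. \<forall>i<D. \<bar>v M x t i - ((u M x t)(c := m M)) i\<bar> \<le> e)"
      using w by blast
  qed
  then show ?thesis by (simp add: m_def)
qed

lemma appr_cong:
  assumes eq: "\<And>M x t i. i < D \<Longrightarrow> u M x t i = v M x t i" and u: "appr u"
  shows "appr v"
  unfolding appr_def
proof (intro conjI)
  show "\<exists>B. \<forall>M\<in>\<L>. \<forall>x\<in>\<Omega>. \<forall>t\<in>{0..1}. \<forall>i<D. \<bar>v M x t i\<bar> \<le> B"
    using appr_bound[OF u] eq by metis
  show "\<forall>M\<in>\<L>. \<forall>i<D. (\<lambda>p. v M (fst p) (snd p) i) \<in> borel_measurable borel"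
    using appr_measurable[OF u] by (simp add: eq)
  show "\<forall>e>0. \<exists>w. net W d D w \<and> (\<forall>M\<in>\<L>. \<forall>x\<in>\<Omega>. \<forall>t\<in>{0..1}. \<forall>i<D. \<bar>w M x t i - v M x t i\<bar> \<le> e)"
  proof (intro allI impI)
    fix e :: real assume "0 < e"
    then obtain w where "net W d D w"
      "\<And>M x t i. M \<in> \<L> \<Longrightarrow> x \<in> \<Omega> \<Longrightarrow> t \<in> {0..1} \<Longrightarrow> i < D \<Longrightarrow> \<bar>w M x t i - u M x t i\<bar> \<le> e"
      using appr_net[OF u] by blast
    then show "\<exists>w. net W d D w \<and> (\<forall>M\<in>\<L>. \<forall>x\<in>\<Omega>. \<forall>t\<in>{0..1}. \<forall>i<D. \<bar>w M x t i - v M x t i\<bar> \<le> e)"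
      by (intro exI[of _ w]) (simp add: eq)
  qed
qed

lemma appr_set:
  assumes u: "appr u" and f: "box_approx D f"
  shows "appr (\<lambda>M x t. (u M x t)(r := f (u M x t)))"
proof -
  define F where "F i y = (if i = r then f y else (\<Sum>j<D. (if j = i then 1 else 0) * y j) + 0)" for i and y :: vec
  have "box_approx D (F i)" for i
  proof (cases "i = r")
    case True
    then have "F i = f" by (simp add: F_def fun_eq_iff)
    then show ?thesis using f by simp
  next
    case False
    then have "F i = (\<lambda>y. (\<Sum>j<D. (if j = i then 1 else 0) * y j) + 0)" by (simp add: F_def fun_eq_iff)
    then show ?thesis by (simp only: box_approx_affine)
  qed
  then have "appr (\<lambda>M x t i. F i (u M x t))"
    by (rule appr_update[OF u])
  moreover have "F i y = (y(r := f y)) i" if "i < D" for i y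
    using that by (simp add: F_def if_distrib[of "\<lambda>a. a * _"] cong: if_cong)
  ultimately show ?thesis
    by (rule appr_cong[rotated])
qed

lemma appr_set_affine:
  assumes "appr u"
  shows "appr (\<lambda>M x t. (u M x t)(r := (\<Sum>j<D. w j * u M x t j) + k))"
  using appr_set[OF assms box_approx_affine] .

lemma appr_set_const:
  assumes "appr u"
  shows "appr (\<lambda>M x t. (u M x t)(r := k))"
  using appr_set_affine[OF assms, of r "\<lambda>_. 0" k] by simp

lemma appr_set_product:
  assumes "appr u" "p < D" "q < D"
  shows "appr (\<lambda>M x t. (u M x t)(r := u M x t p * u M x t q))"
  using appr_set[OF assms(1) box_approx_product[OF assms(2,3)]] .

section \<open>Register programs for moment polynomials\<close>

definition holds_input :: "(pmeas \<Rightarrow> vec \<Rightarrow> real \<Rightarrow> vec) \<Rightarrow> bool" where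
  "holds_input u \<longleftrightarrow> (\<forall>M\<in>\<L>. \<forall>x\<in>\<Omega>. \<forall>t\<in>{0..1}. \<forall>i<d. u M x t i = x i)"

definition same_except :: "nat set \<Rightarrow> (pmeas \<Rightarrow> vec \<Rightarrow> real \<Rightarrow> vec) \<Rightarrow> (pmeas \<Rightarrow> vec \<Rightarrow> real \<Rightarrow> vec) \<Rightarrow> bool" where
  "same_except S u v \<longleftrightarrow> (\<forall>M\<in>\<L>. \<forall>x\<in>\<Omega>. \<forall>t\<in>{0..1}. \<forall>i. i \<notin> S \<longrightarrow> v M x t i = u M x t i)"

text \<open>The specification f has no time argument, in accordance with the time independence of
  the target.\<close>

definition register :: "(pmeas \<Rightarrow> vec \<Rightarrow> real \<Rightarrow> vec) \<Rightarrow> nat \<Rightarrow> (pmeas \<Rightarrow> vec \<Rightarrow> real) \<Rightarrow> bool" where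
  "register u r f \<longleftrightarrow> (\<forall>M\<in>\<L>. \<forall>x\<in>\<Omega>. \<forall>t\<in>{0..1}. u M x t r = f M x)"

lemma same_except_trans: "same_except S u v \<Longrightarrow> same_except T v w \<Longrightarrow> same_except (S \<union> T) u w"
  by (auto simp: same_except_def)

lemma same_except_mono: "same_except S u v \<Longrightarrow> S \<subseteq> T \<Longrightarrow> same_except T u v"
  unfolding same_except_def by blast

lemma same_except_upd: "same_except {r} u (\<lambda>M x t. (u M x t)(r := f M x t))"
  by (simp add: same_except_def)

lemma holds_input_same: "holds_input u \<Longrightarrow> same_except S u v \<Longrightarrow> (\<And>r. r \<in> S \<Longrightarrow> d \<le> r) \<Longrightarrow> holds_input v"
  unfolding holds_input_def same_except_def by (metis not_le)

lemma register_same: "register u r f \<Longrightarrow> same_except S u v \<Longrightarrow> r \<notin> S \<Longrightarrow> register v r f"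
  by (simp add: register_def same_except_def)

lemma compute_times_input:
  assumes u: "appr u" "holds_input u" "register u r f" and r: "d \<le> r" "r < D"
  shows "\<exists>v. appr v \<and> same_except {r} u v \<and> register v r (\<lambda>M x. x i * f M x)"
proof (cases "i < d")
  case True
  let ?v = "\<lambda>M x t. (u M x t)(r := u M x t i * u M x t r)"
  have "register ?v r (\<lambda>M x. x i * f M x)"
    using u True by (simp add: register_def holds_input_def)
  moreover have "appr ?v"
    using u(1) True d_le_D r by (intro appr_set_product) auto
  ultimately show ?thesis
    by (intro exI[of _ ?v] conjI same_except_upd)
next
  \<comment> \<open>Moments may mention coordinates beyond d. These vanish on \<Omega>, so the
    product is 0 and no input register is read.\<close>
  case False
  let ?v = "\<lambda>M x t. (u M x t)(r := 0)"
  have "x i = 0" if "x \<in> \<Omega>" for x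
    using \<Omega>_Rn that False by (auto simp: Rn_def)
  then have "register ?v r (\<lambda>M x. x i * f M x)"
    by (simp add: register_def)
  moreover have "appr ?v"
    using u(1) by (rule appr_set_const)
  ultimately show ?thesis
    by (intro exI[of _ ?v] conjI same_except_upd)
qed

lemma compute_prod_list:
  assumes u: "appr u" "holds_input u" and r: "d \<le> r" "r < D"
  shows "\<exists>v. appr v \<and> same_except {r} u v \<and> register v r (\<lambda>M x. prod_list (map x l))"
proof (induction l)
  case Nil
  have "register (\<lambda>M x t. (u M x t)(r := 1)) r (\<lambda>M x. prod_list (map x []))"
    by (simp add: register_def)
  then show ?case
    by (intro exI[of _ "\<lambda>M x t. (u M x t)(r := 1)"] conjI appr_set_const[OF u(1)] same_except_upd)
next
  case (Cons i l)
  then obtain v where v: "appr v" "same_except {r} u v" "register v r (\<lambda>M x. prod_list (map x l))"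
    by blast
  have "holds_input v"
    using u(2) v(2) r by (auto intro: holds_input_same)
  then obtain w where w: "appr w" "same_except {r} v w" "register w r (\<lambda>M x. x i * prod_list (map x l))"
    using compute_times_input[OF v(1) _ v(3) r] by blast
  then show ?case
    using same_except_trans[OF v(2) w(2)] by auto
qed

text \<open>Each particle first computes the monomial of its own position; replacing the register by
  its mean at time 0 then turns the monomial into its expectation under the initial law.\<close>

lemma compute_moment:
  assumes u: "appr u" "holds_input u" and r: "d \<le> r" "r < D"
  shows "\<exists>v. appr v \<and> same_except {r} u v \<and> register v r (\<lambda>M x. moment (initial_law M) l)"
proof -
  obtain v where v: "appr v" "same_except {r} u v" "register v r (\<lambda>M x. prod_list (map x l))"
    using compute_prod_list[OF u r] by blast
  let ?w = "\<lambda>M x t. (v M x t)(r := ravg M (\<lambda>p. v M (fst p) (snd p) r) 0)"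
  have "ravg M (\<lambda>p. v M (fst p) (snd p) r) 0 = moment (initial_law M) l" if M: "M \<in> \<L>" for M
  proof -
    have pm: "(\<lambda>x :: vec. prod_list (map x l)) \<in> borel_measurable borel"
      by (rule borel_measurable_continuous_onI[OF continuous_on_prod_list_map])
    obtain B where "0 \<le> B" and B: "\<And>M x t i. M \<in> \<L> \<Longrightarrow> x \<in> \<Omega> \<Longrightarrow> t \<in> {0..1} \<Longrightarrow> i < D \<Longrightarrow> \<bar>v M x t i\<bar> \<le> B"
      using appr_bound[OF v(1)] by blast
    have eq: "v M x t r = prod_list (map x l)" if "x \<in> \<Omega>" "t \<in> {0..1}" for x t
      using v(3) M that by (simp add: register_def)
    have "\<bar>ravg M (\<lambda>p. v M (fst p) (snd p) r) 0 - ravg M (\<lambda>p. prod_list (map (fst p) l)) 0\<bar> \<le> 0"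
    proof (rule ravg_diff_le[OF M appr_measurable[OF v(1) M r(2)] measurable_compose[OF measurable_fst_vec pm],
          where B = B and B' = B])
      fix x s assume xs: "x \<in> \<Omega>" "s \<in> {0..1::real}"
      show "\<bar>v M (fst (x, s)) (snd (x, s)) r\<bar> \<le> B"
        using B[OF M xs r(2)] by simp
      then show "\<bar>prod_list (map (fst (x, s)) l)\<bar> \<le> B"
        using eq[OF xs] by simp
      show "\<bar>v M (fst (x, s)) (snd (x, s)) r - prod_list (map (fst (x, s)) l)\<bar> \<le> 0"
        using eq[OF xs] by simp
    qed simp
    moreover have "ravg M (\<lambda>p. prod_list (map (fst p) l)) 0 = moment (initial_law M) l"
      unfolding moment_def ravg_def integral_initial_law[OF \<L>D(1,2)[OF M] pm] ..
    ultimately show ?thesis by simp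
  qed
  then have "register ?w r (\<lambda>M x. moment (initial_law M) l)"
    by (simp add: register_def)
  moreover have "appr ?w"
    by (rule appr_mean[OF v(1) r(2)])
  moreover have "same_except {r} u ?w"
    by (rule same_except_mono[OF same_except_trans[OF v(2) same_except_upd]]) simp
  ultimately show ?thesis by blast
qed

text \<open>Register b holds the partial product while c is used to build the next moment factor,
  since \<open>compute_moment\<close> overwrites the register in which it works. An input factor is
  multiplied into b directly.\<close>

lemma compute_monomial:
  assumes "p \<in> monomials moment_gens" and u: "appr u" "holds_input u"
    and b: "d \<le> b" "b < D" and c: "d \<le> c" "c < D" and "b \<noteq> c"
  shows "\<exists>v. appr v \<and> same_except {b, c} u v \<and> register v b (\<lambda>M x. p (x, moment (initial_law M)))"
  using assms(1)
proof induction
  case one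
  have "register (\<lambda>M x t. (u M x t)(b := 1)) b (\<lambda>M x. 1)"
    by (simp add: register_def)
  moreover have "same_except {b, c} u (\<lambda>M x t. (u M x t)(b := 1))"
    by (rule same_except_mono[OF same_except_upd]) simp
  ultimately show ?case
    by (intro exI[of _ "\<lambda>M x t. (u M x t)(b := 1)"] conjI appr_set_const[OF u(1)])
next
  case (mult g p)
  then obtain v where v: "appr v" "same_except {b, c} u v" "register v b (\<lambda>M x. p (x, moment (initial_law M)))"
    by blast
  have vi: "holds_input v"
    using u(2) v(2) b c by (auto intro: holds_input_same)
  consider i where "g = (\<lambda>q. fst q i)" | l where "g = (\<lambda>q. snd q l)"
    using mult.hyps(1) unfolding moment_gens_def by blast
  then show ?case
  proof cases
    case (1 i)
    obtain w where w: "appr w" "same_except {b} v w" "register w b (\<lambda>M x. x i * p (x, moment (initial_law M)))"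
      using compute_times_input[OF v(1) vi v(3) b] by blast
    have "same_except {b, c} u w"
      using same_except_mono[OF same_except_trans[OF v(2) w(2)]] by simp
    then show ?thesis using w by (auto simp: 1)
  next
    case (2 l)
    obtain w where w: "appr w" "same_except {c} v w" "register w c (\<lambda>M x. moment (initial_law M) l)"
      using compute_moment[OF v(1) vi c] by blast
    have wb: "register w b (\<lambda>M x. p (x, moment (initial_law M)))"
      using register_same[OF v(3) w(2)] \<open>b \<noteq> c\<close> by simp
    let ?z = "\<lambda>M x t. (w M x t)(b := w M x t c * w M x t b)"
    have "appr ?z"
      by (rule appr_set_product[OF w(1) c(2) b(2)])
    moreover have "same_except {b, c} u ?z"
      by (rule same_except_mono[OF same_except_trans[OF same_except_trans[OF v(2) w(2)] same_except_upd]]) auto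
    moreover have "register ?z b (\<lambda>M x. g (x, moment (initial_law M)) * p (x, moment (initial_law M)))"
      using w(3) wb by (simp add: register_def 2)
    ultimately show ?thesis by blast
  qed
qed

text \<open>Both scratch registers are free again once a monomial has been added to r, so the number
  of terms does not affect the width.\<close>

lemma compute_polynomial:
  assumes "p \<in> polynomials moment_gens" and u: "appr u" "holds_input u" "register u r (\<lambda>M x. 0)"
    and b: "d \<le> b" "b < D" and c: "d \<le> c" "c < D" and r: "d \<le> r" "r < D"
    and ne: "b \<noteq> c" "r \<noteq> b" "r \<noteq> c"
  shows "\<exists>v. appr v \<and> same_except {r, b, c} u v \<and> register v r (\<lambda>M x. p (x, moment (initial_law M)))"
  using assms(1)
proof induction
  case zero
  have "same_except {r, b, c} u u" by (simp add: same_except_def)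
  with u(1,3) show ?case by (intro exI[of _ u] conjI)
next
  case (add p q a)
  then obtain v where v: "appr v" "same_except {r, b, c} u v" "register v r (\<lambda>M x. q (x, moment (initial_law M)))"
    by blast
  have vi: "holds_input v"
    using u(2) v(2) b c r by (auto intro: holds_input_same)
  obtain w where w: "appr w" "same_except {b, c} v w" "register w b (\<lambda>M x. p (x, moment (initial_law M)))"
    using compute_monomial[OF add.hyps(1) v(1) vi b c ne(1)] by blast
  have wr: "register w r (\<lambda>M x. q (x, moment (initial_law M)))"
    using register_same[OF v(3) w(2)] ne by simp
  let ?f = "\<lambda>M x t. (\<Sum>j<D. (if j = b then a else if j = r then 1 else 0) * w M x t j) + 0"
  have f: "?f M x t = a * w M x t b + w M x t r" for M x t
  proof -
    have "?f M x t = (\<Sum>j<D. (if j = b then a * w M x t j else 0) + (if j = r then w M x t j else 0)) + 0"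
      using ne by (intro arg_cong2[where f = "(+)"] sum.cong) auto
    then show ?thesis using b r by (simp add: sum.distrib)
  qed
  let ?z = "\<lambda>M x t. (w M x t)(r := ?f M x t)"
  have "appr ?z"
    by (rule appr_set_affine[OF w(1)])
  moreover have "same_except {r, b, c} u ?z"
    by (rule same_except_mono[OF same_except_trans[OF same_except_trans[OF v(2) w(2)] same_except_upd]]) auto
  moreover have "register ?z r (\<lambda>M x. a * p (x, moment (initial_law M)) + q (x, moment (initial_law M)))"
    using w(3) wr unfolding register_def f by simp
  ultimately show ?case by blast
qed

text \<open>Registers d + n and d + n + 1 are scratch space shared by all outputs. The induction
  keeps the accumulators not yet used at 0, as \<open>compute_polynomial\<close> requires of its
  target.\<close>

lemma compute_polynomials:
  assumes D: "D = d + n + 2" and p: "\<And>j. j < n \<Longrightarrow> p j \<in> polynomials moment_gens"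
  shows "\<exists>v. appr v \<and> (\<forall>j<n. register v (d + j) (\<lambda>M x. p j (x, moment (initial_law M))))"
proof -
  have "\<exists>v. appr v \<and> holds_input v \<and> (\<forall>j<k. register v (d + j) (\<lambda>M x. p j (x, moment (initial_law M)))) \<and>
      (\<forall>j. k \<le> j \<longrightarrow> j < n \<longrightarrow> register v (d + j) (\<lambda>M x. 0))" if "k \<le> n" for k
    using that
  proof (induction k)
    case 0
    let ?u = "\<lambda>(M :: pmeas) x (t :: real) i. if i < d then x i else 0 :: real"
    have "holds_input ?u" "\<And>j. register ?u (d + j) (\<lambda>M x. 0)"
      by (simp_all add: holds_input_def register_def)
    then show ?case
      using appr_init by blast
  next
    case (Suc k)
    then obtain u where u: "appr u" "holds_input u"
      "\<And>j. j < k \<Longrightarrow> register u (d + j) (\<lambda>M x. p j (x, moment (initial_law M)))"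
      "\<And>j. k \<le> j \<Longrightarrow> j < n \<Longrightarrow> register u (d + j) (\<lambda>M x. 0)"
      by auto
    have "register u (d + k) (\<lambda>M x. 0)"
      using u(4)[of k] Suc.prems by simp
    then obtain v where v: "appr v" "same_except {d + k, d + n, d + n + 1} u v"
      "register v (d + k) (\<lambda>M x. p k (x, moment (initial_law M)))"
      using compute_polynomial[OF p[of k] u(1,2), of "d + k" "d + n" "d + n + 1"] Suc.prems D by auto
    have "holds_input v"
      using u(2) v(2) by (auto intro: holds_input_same)
    moreover have "register v (d + j) (\<lambda>M x. p j (x, moment (initial_law M)))" if "j < Suc k" for j
      using that v(3) register_same[OF u(3) v(2), of j] Suc.prems by (cases "j = k") auto
    moreover have "register v (d + j) (\<lambda>M x. 0)" if "Suc k \<le> j" "j < n" for j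
      using that register_same[OF u(4) v(2), of j] by auto
    ultimately show ?case using v(1) by blast
  qed
  from this[of n] show ?thesis by auto
qed

end

section \<open>Assembly of the approximating network\<close>

lemma edist_le:
  assumes "\<And>i. i < n \<Longrightarrow> \<bar>x i - y i\<bar> \<le> e"
  shows "edist n x y \<le> real n * e"
proof -
  have "edist n x y = L2_set (\<lambda>i. x i - y i) {..<n}"
    by (simp add: edist_def sqdist_def L2_set_def)
  also have "\<dots> \<le> (\<Sum>i<n. \<bar>x i - y i\<bar>)"
    by (rule L2_set_le_sum_abs)
  also have "\<dots> \<le> (\<Sum>i<n. e)"
    using assms by (intro sum_mono) auto
  finally show ?thesis by simp
qed

text \<open>A test function f on the product restricts to the test function f(., 0) on vectors, so
  weakly convergent laws give weak-star convergent measures at time 0. This makes \<open>G\<close>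
  sequentially continuous, and rigidity identifies it with \<Lambda>.\<close>

lemma approx_on_initial_law:
  fixes \<Lambda> :: "pmeas \<Rightarrow> vec \<Rightarrow> real \<Rightarrow> vec"
  assumes \<Omega>: "compact \<Omega>" "\<Omega> \<subseteq> Rn d" and \<sigma>: "0 < \<sigma>" "\<sigma> \<le> 1"
    and cont: "continuous_map (prod_topology (subtopology weak_star (LipCS d \<Omega> C \<sigma>))
        (subtopology euclidean (\<Omega> \<times> {0..1}))) euclidean (\<lambda>(M, (x, t)). \<Lambda> M x t)"
    and caus: "causal d \<Omega> C \<sigma> \<Lambda>" and ident: "identifiable d \<Omega> C \<sigma> \<Lambda>" and "0 < e"
  obtains p where "p \<in> polynomials moment_gens"
    "\<And>M x t. M \<in> LipCS d \<Omega> C \<sigma> \<Longrightarrow> x \<in> \<Omega> \<Longrightarrow> t \<in> {0..1} \<Longrightarrow>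
      \<bar>p (x, moment (initial_law M)) - \<Lambda> M x t i\<bar> \<le> e"
proof -
  define G where "G \<alpha> x = \<Lambda> (distr \<alpha> borel (\<lambda>x. (x, 0))) x 0 i" for \<alpha> x
  have "(\<lambda>n. G (\<alpha> n) (x n)) \<longlonglongrightarrow> G \<beta> z"
    if \<alpha>: "\<And>n. concentrated \<Omega> (\<alpha> n)" and \<beta>: "concentrated \<Omega> \<beta>" and x: "\<And>n. x n \<in> \<Omega>" "z \<in> \<Omega>"
      and w: "weakly_to \<alpha> \<beta>" and xz: "x \<longlonglongrightarrow> z" for \<alpha> \<beta> x z
  proof -
    have eq: "(\<integral>p. f p \<partial>distr \<gamma> borel (\<lambda>x. (x, 0))) = (\<integral>x. f (x, 0) \<partial>\<gamma>)"
      if "concentrated \<Omega> \<gamma>" "continuous_on UNIV f" for \<gamma> and f :: "vec \<times> real \<Rightarrow> real"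
      by (rule integral_distr)
         (simp_all add: measurable_cong_sets[OF concentratedD(2)[OF that(1)] refl] measurable_at_time
           borel_measurable_continuous_onI[OF that(2)])
    have "(\<lambda>n. \<Lambda> (distr (\<alpha> n) borel (\<lambda>x. (x, 0))) (x n) 0) \<longlonglongrightarrow> \<Lambda> (distr \<beta> borel (\<lambda>x. (x, 0))) z 0"
    proof (rule continuous_map_weak_star_tendsto[OF cont])
      fix f :: "vec \<times> real \<Rightarrow> real" assume f: "continuous_on UNIV f" "bounded (range f)"
      have "continuous_on UNIV (\<lambda>x. f (x, 0))"
        by (rule continuous_on_compose2[OF f(1) continuous_on_at_time]) simp
      moreover have "bounded (range (\<lambda>x. f (x, 0)))"
        by (rule bounded_subset[OF f(2)]) auto
      ultimately have "(\<lambda>n. \<integral>x. f (x, 0) \<partial>\<alpha> n) \<longlonglongrightarrow> (\<integral>x. f (x, 0) \<partial>\<beta>)"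
        using w by blast
      then show "(\<lambda>n. \<integral>p. f p \<partial>distr (\<alpha> n) borel (\<lambda>x. (x, 0))) \<longlonglongrightarrow> (\<integral>p. f p \<partial>distr \<beta> borel (\<lambda>x. (x, 0)))"
        by (simp add: eq[OF \<alpha> f(1)] eq[OF \<beta> f(1)])
    qed (use \<alpha> \<beta> x xz dirac_time_LipCS[OF \<Omega> \<sigma>(2)] in auto)
    then show ?thesis
      by (simp add: G_def tendsto_fun_iff)
  qed
  then obtain p where p: "p \<in> polynomials moment_gens"
    "\<And>\<alpha> x. concentrated \<Omega> \<alpha> \<Longrightarrow> x \<in> \<Omega> \<Longrightarrow> \<bar>G \<alpha> x - p (x, moment \<alpha>)\<bar> < e"
    using approx_by_moment_polynomial[of \<Omega> G e] \<Omega>(1) \<open>0 < e\<close> by blast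
  show ?thesis
  proof (rule that[OF p(1)])
    fix M x t assume M: "M \<in> LipCS d \<Omega> C \<sigma>" and x: "x \<in> \<Omega>" and t: "t \<in> {0..1::real}"
    have "\<Lambda> M x t i = G (initial_law M) x"
      unfolding G_def using causal_identifiable_initial_law[OF \<Omega> \<sigma>(1) cont caus ident M x t] by simp
    then show "\<bar>p (x, moment (initial_law M)) - \<Lambda> M x t i\<bar> \<le> e"
      using p(2)[OF mask_zero(1)[OF \<Omega>(1) M \<sigma>(1)] x] by linarith
  qed
qed

theorem theorem2:
  fixes d d' :: nat and \<Omega> :: "vec set" and C \<sigma> \<epsilon> :: real
    and \<Lambda> :: "pmeas \<Rightarrow> vec \<Rightarrow> real \<Rightarrow> vec"
  assumes "compact \<Omega>" and "\<Omega> \<subseteq> Rn d"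
    and "C > 0" and "0 < \<sigma>" and "\<sigma> < 1"
    and "\<forall>M\<in>LipCS d \<Omega> C \<sigma>. \<forall>x\<in>\<Omega>. \<forall>t\<in>{0..1}. \<Lambda> M x t \<in> Rn d'"
    and "continuous_map
           (prod_topology (subtopology weak_star (LipCS d \<Omega> C \<sigma>))
                          (subtopology euclidean (\<Omega> \<times> {0..1})))
           euclidean (\<lambda>(M, (x, t)). \<Lambda> M x t)"
    and "causal d \<Omega> C \<sigma> \<Lambda>" and "identifiable d \<Omega> C \<sigma> \<Lambda>"
    and "\<epsilon> > 0"
  shows "\<exists>ls :: (attn_params \<times> mlp) list. compatible d d' ls \<and>
           (\<forall>(\<theta>, \<xi>)\<in>set ls. din \<theta> \<le> d + 3 * d' \<and> dhead \<theta> = 1 \<and> kdim \<theta> = 1 \<and>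
                               length (heads \<theta>) \<le> d') \<and>
           (\<forall>M\<in>LipCS d \<Omega> C \<sigma>. \<forall>x\<in>\<Omega>. \<forall>t\<in>{0..1}.
               edist d' (tnet ls M x t) (\<Lambda> M x t) \<le> \<epsilon>)"
proof (cases "d' = 0")
  case True
  \<comment> \<open>With no outputs the error is 0, but no head is allowed and d + d' + 2 exceeds d
    + 3 d'. One idle layer serves, since the list of layers must be nonempty.\<close>
  define \<xi> :: mlp where "\<xi> = ([d, 0], [(\<lambda>_ _. 0, \<lambda>_. 0)])"
  have "mlp_ok \<xi> d 0"
    by (simp add: mlp_ok_def \<xi>_def)
  then show ?thesis
    using True \<open>\<epsilon> > 0\<close>
    by (intro exI[of _ "[(idle_attn d, \<xi>)]"]) (auto simp: compatible_def edist_def sqdist_def)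
next
  case False
  define D where "D = d + d' + 2"
  interpret attention_machine d D "d + 3 * d'" \<Omega> C \<sigma>
    using assms False by unfold_locales (auto simp: D_def)
  \<comment> \<open>Each of the d' coordinates meets two errors of size \<eta>, one from the
    polynomial and one from the network, and the Euclidean distance is bounded by the sum of the
    coordinate errors.\<close>
  define \<eta> where "\<eta> = \<epsilon> / real d' / 2"
  have "0 < \<eta>" using False \<open>\<epsilon> > 0\<close> by (simp add: \<eta>_def)
  have "\<exists>p. p \<in> polynomials moment_gens \<and> (\<forall>M\<in>\<L>. \<forall>x\<in>\<Omega>. \<forall>t\<in>{0..1}.
      \<bar>p (x, moment (initial_law M)) - \<Lambda> M x t i\<bar> \<le> \<eta>)" for i
    by (rule approx_on_initial_law[OF assms(1,2,4) less_imp_le[OF assms(5)] assms(7-9) \<open>0 < \<eta>\<close>, of i]) blast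
  then obtain p where p: "\<And>i. p i \<in> polynomials moment_gens"
    "\<And>i M x t. M \<in> \<L> \<Longrightarrow> x \<in> \<Omega> \<Longrightarrow> t \<in> {0..1} \<Longrightarrow> \<bar>p i (x, moment (initial_law M)) - \<Lambda> M x t i\<bar> \<le> \<eta>"
    by metis
  obtain u where u: "appr u" "\<And>j. j < d' \<Longrightarrow> register u (d + j) (\<lambda>M x. p j (x, moment (initial_law M)))"
    using compute_polynomials[of d' p] p(1) D_def by blast
  obtain v where v: "net (d + 3 * d') d D v"
    "\<And>M x t i. M \<in> \<L> \<Longrightarrow> x \<in> \<Omega> \<Longrightarrow> t \<in> {0..1} \<Longrightarrow> i < D \<Longrightarrow> \<bar>v M x t i - u M x t i\<bar> \<le> \<eta>"
    using appr_net[OF u(1) \<open>0 < \<eta>\<close>] by blast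
  \<comment> \<open>The last layer reads off the accumulators, which start after the d input
    registers.\<close>
  define F where "F i y = (\<Sum>j<D. (if j = d + i then 1 else 0) * y j) + 0" for i and y :: vec
  have F: "F i y = y (d + i)" if "i < d'" for i y
    using that by (simp add: F_def D_def if_distrib[of "\<lambda>a. a * _"] cong: if_cong)
  have "relu_sum D (F i)" for i
    unfolding F_def[abs_def] by (rule relu_sum_affine)
  then have "net (d + 3 * d') d d' (\<lambda>M x t i. if i < d' then F i (v M x t) else 0)"
    by (intro net_mlp[OF v(1) D_le_W])
  then obtain ls where ls: "compatible d d' ls"
    "\<forall>(\<theta>, \<xi>)\<in>set ls. din \<theta> \<le> d + 3 * d' \<and> dhead \<theta> = 1 \<and> kdim \<theta> = 1 \<and> length (heads \<theta>) \<le> 1"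
    "\<And>M. prob_space M \<Longrightarrow> sets M = sets borel \<Longrightarrow> tnet ls M = (\<lambda>x t i. if i < d' then F i (v M x t) else 0)"
    unfolding net_def by blast
  have "edist d' (tnet ls M x t) (\<Lambda> M x t) \<le> \<epsilon>" if M: "M \<in> \<L>" "x \<in> \<Omega>" "t \<in> {0..1}" for M x t
  proof -
    have "\<bar>tnet ls M x t i - \<Lambda> M x t i\<bar> \<le> 2 * \<eta>" if i: "i < d'" for i
    proof -
      have "tnet ls M x t i = v M x t (d + i)"
        using ls(3)[OF \<L>D(1,2)[OF M(1)]] i by (simp add: F)
      moreover have "\<bar>v M x t (d + i) - u M x t (d + i)\<bar> \<le> \<eta>"
        using v(2)[OF M] i by (simp add: D_def)
      moreover have "u M x t (d + i) = p i (x, moment (initial_law M))"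
        using u(2)[OF i] M by (simp add: register_def)
      ultimately show ?thesis
        using p(2)[OF M, of i] by linarith
    qed
    then have "edist d' (tnet ls M x t) (\<Lambda> M x t) \<le> real d' * (2 * \<eta>)"
      by (rule edist_le)
    also have "\<dots> = \<epsilon>" using False by (simp add: \<eta>_def)
    finally show ?thesis .
  qed
  moreover have "\<forall>(\<theta>, \<xi>)\<in>set ls. din \<theta> \<le> d + 3 * d' \<and> dhead \<theta> = 1 \<and> kdim \<theta> = 1 \<and> length (heads \<theta>) \<le> d'"
    using ls(2) False by fastforce
  ultimately show ?thesis
    using ls(1) by blast
qed

end
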